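(* Let $G$ be a finite group, let $\mathcal{G}$ be a Green ring and let $\mathcal{M}$, $\mathcal{N}$ be Mackey functors on $\mathcal{D}(G)$, and let $X$ be a finite $G$-set. (i) If $\mathcal{M}$ is a Green module over $\mathcal{G}$ and $X$ is a Dress generating set for $\mathcal{G}$, then $X$ is a Dress generating set for $\mathcal{M}$. (ii) If $\mathcal{N}$ is a sub-quotient of $\mathcal{M}$ and $X$ is a Dress generating set for $\mathcal{M}$, then $X$ is a Dress generating set for $\mathcal{N}$. (iii) If $\mathcal{M}$ is a full lattice in $\mathcal{N}$ and $X$ is a Dress generating set for $\mathcal{M}$, then $X$ is a Dress generating set for $\mathcal{N}$.
   Context: $G$ is a finite group, $\mathcal{D}(G)$ is the category of finite left $G$-sets and $G$-maps, $\bullet$ is the one-point $G$-set, $\mathcal{A}b$ is the category of abelian groups. Mackey functors. A Mackey functor is a pair $\mathcal{M}=(\mathcal{M}_*,\mathcal{M}^* )$ of a covariant functor $\mathcal{M}_*$ and a contravariant functor $\mathcal{M}^*$ from $\mathcal{D}(G)$ to $\mathcal{A}b$ with the same value $\mathcal{M}(S)$ on each object $S$; for $\varphi\colon S\to T$ write $\varphi_{\mathcal{M}}=\mathcal{M}_*(\varphi)\colon\mathcal{M}(S)\to\mathcal{M}(T)$ and $\varphi^{\mathcal{M}}=\mathcal{M}^*(\varphi)\colon\mathcal{M}(T)\to\mathcal{M}(S)$. It must satisfy: (M1) for every pullback square with maps $\Psi\colon S\to S_1$, $\Phi\colon S\to S_2$, $\varphi\colon S_1\to T$, $\psi\colon S_2\to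 T$, $\varphi^{\mathcal{M}}\circ\psi_{\mathcal{M}}=\Psi_{\mathcal{M}}\circ\Phi^{\mathcal{M}}$; (M2) the inclusions induce an isomorphism $\mathcal{M}^*(S_1\sqcup S_2)\to\mathcal{M}^*(S_1)\oplus\mathcal{M}^*(S_2)$, and $\mathcal{M}(\emptyset)=0$. A natural transformation (homomorphism) $\Theta\colon\mathcal{M}\to\mathcal{N}$ is a family of group homomorphisms $\Theta_S\colon\mathcal{M}(S)\to\mathcal{N}(S)$ commuting with both the covariant and the contravariant maps. $\mathcal{M}$ is a sub-functor of $\mathcal{N}$ (resp. $\mathcal{N}$ is a quotient functor of $\mathcal{M}$) if there is such a $\Theta\colon\mathcal{M}\to\mathcal{N}$ with every $\Theta_S$ injective (resp. surjective). $\mathcal{N}$ is a sub-quotient of $\mathcal{M}$ if there is a finite sequence of Mackey functors $\mathcal{N}=\mathcal{L}_0,\dots,\mathcal{L}_r=\mathcal{M}$ with each $\mathcal{L}_i$ a sub-functor or a quotient functor of $\mathcal{L}_{i+1}$. $\mathcal{M}$ is a full lattice in $\mathcal{N}$ if there is a natural transformation $\Theta\colon\mathcal{M}\to\mathcal{N}$ such that $\Theta_S^*\colon\mathrm{Hom}(\mathcal{N}(S),\mathcal{N}(S))\to\mathrm{Hom}(\mathcal{M}(S),\mathcal{N}(S))$ is injective for all finite $G$-sets $S$. Green rings. A pairing $\mathcal{M}\times\mathcal{N}\to\mathcal{L}$ is a family of bilinear maps $\mathcal{M}(S)\times\mathcal{N}(S)\to\mathcal{L}(S)$ such that for all $\varphi\colon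 S\to T$: $\varphi^{\mathcal{L}}(x\cdot y)=\varphi^{\mathcal{M}}(x)\cdot\varphi^{\mathcal{N}}(y)$; $x\cdot\varphi_{\mathcal{N}}(y)=\varphi_{\mathcal{L}}(\varphi^{\mathcal{M}}(x)\cdot y)$; $\varphi_{\mathcal{M}}(x)\cdot y=\varphi_{\mathcal{L}}(x\cdot\varphi^{\mathcal{N}}(y))$. A Green ring is a Mackey functor $\mathcal{G}$ with a pairing $\mathcal{G}\times\mathcal{G}\to\mathcal{G}$ and elements $1_S\in\mathcal{G}(S)$ making each $\mathcal{G}(S)$ an associative ring with unit $1_S$, with $\varphi^{\mathcal{G}}(1_T)=1_S$ for all $\varphi\colon S\to T$. A Mackey functor $\mathcal{M}$ is a Green module over $\mathcal{G}$ if there is a pairing $\mathcal{G}\times\mathcal{M}\to\mathcal{M}$ making each $\mathcal{M}(S)$ a unital left $\mathcal{G}(S)$-module. Burnside quotient Green ring. $\mathcal{A}(S)$ is the Grothendieck group (under disjoint union) of isomorphism classes of finite $G$-sets $(X,f\colon X\to S)$ over $S$; $\varphi_{\mathcal{A}}$ is composition with $\varphi$, $\varphi^{\mathcal{A}}$ is pullback along $\varphi$, and the product is fibre product over $S$. This is a Green ring (the Burnside ring), acting on any Mackey functor $\mathcal{M}$ by $[X,f]\cdot x=f_{\mathcal{M}}(f^{\mathcal{M}}(x))$. Let $I_{\mathcal{M}}(S)$ be the set of $a\in\mathcal{A}(S)$ such that $\varphi_{\mathcal{A}}(a)\cdot y=0$ and $\psi^{\mathcal{A}}(a)\cdot z=0$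 for all $\varphi\colon S\to T$, $\psi\colon U\to S$, $y\in\mathcal{M}(T)$, $z\in\mathcal{M}(U)$. Then $\mathcal{A}_{\mathcal{M}}:=\mathcal{A}/I_{\mathcal{M}}$ is a Green ring, the Burnside quotient Green ring of $\mathcal{M}$. Dress generating sets. A family of subgroups of $G$ is a set of subgroups closed under conjugation and taking subgroups; $\mathcal{F}(X)$ is the family generated by the isotropy subgroups of a finite $G$-set $X$; for a family $\mathcal{F}$, $X(\mathcal{F})=\bigsqcup G/H$ with one $H$ for each conjugacy class of maximal elements of $\mathcal{F}$. For a prime $p$, $O^p(H)$ is the intersection of all normal subgroups of $H$ with $p$-group quotient; $hyper_p\text{-}\mathcal{F}$ is the family of all $H\le G$ with $O^p(H)\in\mathcal{F}$; $hyper_p\text{-}X:=X(hyper_p\text{-}\mathcal{F}(X))$. A finite $G$-set $X$ is a Dress generating set for a Green ring $\mathcal{G}$ if for every prime $p$ the covariantly induced map $\mathcal{G}(hyper_p\text{-}X)\otimes\mathbf{Z}_{(p)}\to\mathcal{G}(\bullet)\otimes\mathbf{Z}_{(p)}$ is surjective. $X$ is a Dress generating set for a Mackey functor $\mathcal{M}$ if it is a Dress generating set for the Green ring $\mathcal{A}_{\mathcal{M}}$. *)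

theory Defs
  imports Complex_Main "HOL-Computational_Algebra.Primes" "HOL-Algebra.Ring"
    "HOL-Algebra.Left_Coset" "HOL-Algebra.Group_Action" "HOL-Algebra.Free_Abelian_Groups"
begin

section \<open>Finite \<open>G\<close>-sets\<close>

text \<open>
  A \<open>G\<close>-set is a carrier together with an action in the sense of \<^locale>\<open>group_action\<close>.
  The points of all \<open>G\<close>-sets are drawn from one type \<open>'u\<close>, which the theorem assumes to be infinite:
  every finite \<open>G\<close>-set then has an isomorphic copy in \<open>'u\<close>, so these \<open>G\<close>-sets form a full subcategory
  equivalent to that of all finite \<open>G\<close>-sets. No canonical disjoint unions or fibre products exist
  in \<open>'u\<close>; they are therefore described below as diagrams, up to isomorphism.
\<close>

type_synonym ('g, 'u) gset = "'u set \<times> ('g \<Rightarrow> 'u \<Rightarrow> 'u)"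

definition is_gset :: "('g, 'b) monoid_scheme \<Rightarrow> ('g, 'u) gset \<Rightarrow> bool" where
  "is_gset G S \<longleftrightarrow>
     group_action G (fst S) (snd S) \<and> finite (fst S) \<and> snd S \<in> extensional (carrier G)"

definition gmaps ::
  "('g, 'b) monoid_scheme \<Rightarrow> ('g, 'u) gset \<Rightarrow> ('g, 'v) gset \<Rightarrow> ('u \<Rightarrow> 'v) set" where
  "gmaps G S T = {f \<in> fst S \<rightarrow>\<^sub>E fst T.
     \<forall>g\<in>carrier G. \<forall>x\<in>fst S. f (snd S g x) = snd T g (f x)}"

definition gset_iso :: "('g, 'b) monoid_scheme \<Rightarrow> ('g, 'u) gset \<Rightarrow> ('g, 'v) gset \<Rightarrow> bool" where
  "gset_iso G S T \<longleftrightarrow> (\<exists>h\<in>gmaps G S T. bij_betw h (fst S) (fst T))"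

definition point_gset :: "('g, 'b) monoid_scheme \<Rightarrow> ('g, 'u) gset" where
  "point_gset G = ({undefined}, \<lambda>g\<in>carrier G. \<lambda>x\<in>{undefined}. x)"

definition to_point :: "('g, 'u) gset \<Rightarrow> 'u \<Rightarrow> 'u" where
  "to_point S = (\<lambda>x\<in>fst S. undefined)"

text \<open>\<open>S\<close> is the disjoint union of \<open>S1\<close> and \<open>S2\<close> with inclusions \<open>i\<close> and \<open>j\<close>.\<close>

definition is_disj_union ::
  "('g, 'b) monoid_scheme \<Rightarrow> ('g, 'u) gset \<Rightarrow> ('g, 'u) gset \<Rightarrow> ('g, 'u) gset
    \<Rightarrow> ('u \<Rightarrow> 'u) \<Rightarrow> ('u \<Rightarrow> 'u) \<Rightarrow> bool" where
  "is_disj_union G S S1 S2 i j \<longleftrightarrow>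
     is_gset G S \<and> is_gset G S1 \<and> is_gset G S2 \<and> i \<in> gmaps G S1 S \<and> j \<in> gmaps G S2 S \<and>
     inj_on i (fst S1) \<and> inj_on j (fst S2) \<and>
     i ` fst S1 \<inter> j ` fst S2 = {} \<and> i ` fst S1 \<union> j ` fst S2 = fst S"

text \<open>The square with top-left corner \<open>S\<close>, projections \<open>p: S \<rightarrow> S1\<close>, \<open>q: S \<rightarrow> S2\<close> and maps
  \<open>f: S1 \<rightarrow> T\<close>, \<open>g: S2 \<rightarrow> T\<close> is a pullback, i.e. \<open>S\<close> is the fibre product of \<open>S1\<close> and \<open>S2\<close> over \<open>T\<close>.\<close>

definition is_pullback ::
  "('g, 'b) monoid_scheme \<Rightarrow> ('g, 'u) gset \<Rightarrow> ('g, 'u) gset \<Rightarrow> ('g, 'u) gset \<Rightarrow> ('g, 'u) gset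
    \<Rightarrow> ('u \<Rightarrow> 'u) \<Rightarrow> ('u \<Rightarrow> 'u) \<Rightarrow> ('u \<Rightarrow> 'u) \<Rightarrow> ('u \<Rightarrow> 'u) \<Rightarrow> bool" where
  "is_pullback G S S1 S2 T p q f g \<longleftrightarrow>
     is_gset G S \<and> is_gset G S1 \<and> is_gset G S2 \<and> is_gset G T \<and>
     p \<in> gmaps G S S1 \<and> q \<in> gmaps G S S2 \<and> f \<in> gmaps G S1 T \<and> g \<in> gmaps G S2 T \<and>
     bij_betw (\<lambda>s. (p s, q s)) (fst S) {(a, b). a \<in> fst S1 \<and> b \<in> fst S2 \<and> f a = g b}"


section \<open>Mackey functors\<close>

text \<open>
  The abelian groups are \<^locale>\<open>comm_group\<close>s, hence written multiplicatively. For \<open>f: S \<rightarrow> T\<close>,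
  \<open>cov M S T f\<close> is the covariant map from \<open>M(S)\<close> to \<open>M(T)\<close> and \<open>con M S T f\<close> is
  the contravariant map from \<open>M(T)\<close> to \<open>M(S)\<close>.
\<close>

record ('g, 'u, 'm) mackey =
  val :: "('g, 'u) gset \<Rightarrow> 'm monoid"
  cov :: "('g, 'u) gset \<Rightarrow> ('g, 'u) gset \<Rightarrow> ('u \<Rightarrow> 'u) \<Rightarrow> 'm \<Rightarrow> 'm"
  con :: "('g, 'u) gset \<Rightarrow> ('g, 'u) gset \<Rightarrow> ('u \<Rightarrow> 'u) \<Rightarrow> 'm \<Rightarrow> 'm"

definition is_bifunctor ::
  "('g, 'b) monoid_scheme \<Rightarrow> ('g, 'u, 'm, 'z) mackey_scheme \<Rightarrow> bool" where
  "is_bifunctor G M \<longleftrightarrow>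
     (\<forall>S. is_gset G S \<longrightarrow> comm_group (val M S)) \<and>
     (\<forall>S T f. is_gset G S \<and> is_gset G T \<and> f \<in> gmaps G S T \<longrightarrow>
        cov M S T f \<in> hom (val M S) (val M T) \<and> con M S T f \<in> hom (val M T) (val M S)) \<and>
     (\<forall>S. is_gset G S \<longrightarrow> (\<forall>x\<in>carrier (val M S).
        cov M S S (\<lambda>s\<in>fst S. s) x = x \<and> con M S S (\<lambda>s\<in>fst S. s) x = x)) \<and>
     (\<forall>S T U f g. is_gset G S \<and> is_gset G T \<and> is_gset G U \<and> f \<in> gmaps G S T \<and> g \<in> gmaps G T U \<longrightarrow>
        (\<forall>x\<in>carrier (val M S). cov M S U (compose (fst S) g f) x = cov M T U g (cov M S T f x)) \<and>
        (\<forall>x\<in>carrier (val M U). con M S U (compose (fst S) g f) x = con M S T f (con M T U g x)))"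

definition is_mackey ::
  "('g, 'b) monoid_scheme \<Rightarrow> ('g, 'u, 'm, 'z) mackey_scheme \<Rightarrow> bool" where
  "is_mackey G M \<longleftrightarrow>
     is_bifunctor G M \<and>
     (\<forall>S S1 S2 T p q f g. is_pullback G S S1 S2 T p q f g \<longrightarrow>
        (\<forall>x\<in>carrier (val M S2). con M S1 T f (cov M S2 T g x) = cov M S S1 p (con M S S2 q x))) \<and>
     (\<forall>S S1 S2 i j. is_disj_union G S S1 S2 i j \<longrightarrow>
        (\<lambda>x. (con M S1 S i x, con M S2 S j x)) \<in> iso (val M S) (val M S1 \<times>\<times> val M S2)) \<and>
     (\<forall>S. is_gset G S \<and> fst S = {} \<longrightarrow> carrier (val M S) = {\<one>\<^bsub>val M S\<^esub>})"

definition nat_transf ::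
  "('g, 'b) monoid_scheme \<Rightarrow> ('g, 'u, 'm, 'y) mackey_scheme \<Rightarrow> ('g, 'u, 'n, 'z) mackey_scheme
    \<Rightarrow> (('g, 'u) gset \<Rightarrow> 'm \<Rightarrow> 'n) \<Rightarrow> bool" where
  "nat_transf G M N \<Theta> \<longleftrightarrow>
     (\<forall>S. is_gset G S \<longrightarrow> \<Theta> S \<in> hom (val M S) (val N S)) \<and>
     (\<forall>S T f. is_gset G S \<and> is_gset G T \<and> f \<in> gmaps G S T \<longrightarrow>
        (\<forall>x\<in>carrier (val M S). \<Theta> T (cov M S T f x) = cov N S T f (\<Theta> S x)) \<and>
        (\<forall>x\<in>carrier (val M T). \<Theta> S (con M S T f x) = con N S T f (\<Theta> T x)))"

definition sub_functor ::
  "('g, 'b) monoid_scheme \<Rightarrow> ('g, 'u, 'm) mackey \<Rightarrow> ('g, 'u, 'n) mackey \<Rightarrow> bool" where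
  "sub_functor G M N \<longleftrightarrow> (\<exists>\<Theta>. nat_transf G M N \<Theta> \<and>
     (\<forall>S. is_gset G S \<longrightarrow> inj_on (\<Theta> S) (carrier (val M S))))"

text \<open>\<open>quotient_functor G N M\<close>: \<open>N\<close> is a quotient functor of \<open>M\<close>.\<close>

definition quotient_functor ::
  "('g, 'b) monoid_scheme \<Rightarrow> ('g, 'u, 'n) mackey \<Rightarrow> ('g, 'u, 'm) mackey \<Rightarrow> bool" where
  "quotient_functor G N M \<longleftrightarrow> (\<exists>\<Theta>. nat_transf G M N \<Theta> \<and>
     (\<forall>S. is_gset G S \<longrightarrow> \<Theta> S ` carrier (val M S) = carrier (val N S)))"

definition sub_quotient ::
  "('g, 'b) monoid_scheme \<Rightarrow> ('g, 'u, 'm) mackey \<Rightarrow> ('g, 'u, 'm) mackey \<Rightarrow> bool" where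
  "sub_quotient G N M \<longleftrightarrow> (\<exists>(r::nat) L. L 0 = N \<and> L r = M \<and> (\<forall>i\<le>r. is_mackey G (L i)) \<and>
     (\<forall>i<r. sub_functor G (L i) (L (Suc i)) \<or> quotient_functor G (L i) (L (Suc i))))"

definition ext_hom ::
  "('a, 'c) monoid_scheme \<Rightarrow> ('b, 'd) monoid_scheme \<Rightarrow> ('a \<Rightarrow> 'b) set" where
  "ext_hom A B = hom A B \<inter> extensional (carrier A)"

definition full_lattice ::
  "('g, 'b) monoid_scheme \<Rightarrow> ('g, 'u, 'm) mackey \<Rightarrow> ('g, 'u, 'n) mackey \<Rightarrow> bool" where
  "full_lattice G M N \<longleftrightarrow> (\<exists>\<Theta>. nat_transf G M N \<Theta> \<and>
     (\<forall>S. is_gset G S \<longrightarrow>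
        inj_on (\<lambda>h. compose (carrier (val M S)) h (\<Theta> S)) (ext_hom (val N S) (val N S))))"


section \<open>Green rings and Green modules\<close>

definition bilinear_on ::
  "('a, 'x) monoid_scheme \<Rightarrow> ('b, 'y) monoid_scheme \<Rightarrow> ('c, 'z) monoid_scheme
    \<Rightarrow> ('a \<Rightarrow> 'b \<Rightarrow> 'c) \<Rightarrow> bool" where
  "bilinear_on A B C \<beta> \<longleftrightarrow>
     (\<forall>a\<in>carrier A. (\<lambda>b. \<beta> a b) \<in> hom B C) \<and> (\<forall>b\<in>carrier B. (\<lambda>a. \<beta> a b) \<in> hom A C)"

definition is_pairing ::
  "('g, 'b) monoid_scheme \<Rightarrow> ('g, 'u, 'm, 'x) mackey_scheme \<Rightarrow> ('g, 'u, 'n, 'y) mackey_scheme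
    \<Rightarrow> ('g, 'u, 'l, 'z) mackey_scheme \<Rightarrow> (('g, 'u) gset \<Rightarrow> 'm \<Rightarrow> 'n \<Rightarrow> 'l) \<Rightarrow> bool" where
  "is_pairing G M N L \<mu> \<longleftrightarrow>
     (\<forall>S. is_gset G S \<longrightarrow> bilinear_on (val M S) (val N S) (val L S) (\<mu> S)) \<and>
     (\<forall>S T f. is_gset G S \<and> is_gset G T \<and> f \<in> gmaps G S T \<longrightarrow>
        (\<forall>x\<in>carrier (val M T). \<forall>y\<in>carrier (val N T).
           con L S T f (\<mu> T x y) = \<mu> S (con M S T f x) (con N S T f y)) \<and>
        (\<forall>x\<in>carrier (val M T). \<forall>y\<in>carrier (val N S).
           \<mu> T x (cov N S T f y) = cov L S T f (\<mu> S (con M S T f x) y)) \<and>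
        (\<forall>x\<in>carrier (val M S). \<forall>y\<in>carrier (val N T).
           \<mu> T (cov M S T f x) y = cov L S T f (\<mu> S x (con N S T f y))))"

record ('g, 'u, 'm) green = "('g, 'u, 'm) mackey" +
  gmult :: "('g, 'u) gset \<Rightarrow> 'm \<Rightarrow> 'm \<Rightarrow> 'm"
  gone :: "('g, 'u) gset \<Rightarrow> 'm"

definition val_ring :: "('g, 'u, 'm) green \<Rightarrow> ('g, 'u) gset \<Rightarrow> 'm ring" where
  "val_ring R S = \<lparr>carrier = carrier (val R S), monoid.mult = gmult R S, monoid.one = gone R S,
     ring.zero = \<one>\<^bsub>val R S\<^esub>, ring.add = monoid.mult (val R S)\<rparr>"

definition is_green_ring :: "('g, 'b) monoid_scheme \<Rightarrow> ('g, 'u, 'm) green \<Rightarrow> bool" where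
  "is_green_ring G R \<longleftrightarrow>
     is_mackey G R \<and> is_pairing G R R R (gmult R) \<and>
     (\<forall>S. is_gset G S \<longrightarrow> ring (val_ring R S)) \<and>
     (\<forall>S T f. is_gset G S \<and> is_gset G T \<and> f \<in> gmaps G S T \<longrightarrow> con R S T f (gone R T) = gone R S)"

definition green_module ::
  "('g, 'b) monoid_scheme \<Rightarrow> ('g, 'u, 'r) green \<Rightarrow> ('g, 'u, 'm) mackey \<Rightarrow> bool" where
  "green_module G R M \<longleftrightarrow> (\<exists>\<mu>. is_pairing G R M M \<mu> \<and>
     (\<forall>S. is_gset G S \<longrightarrow> (\<forall>x\<in>carrier (val M S).
        \<mu> S (gone R S) x = x \<and>
        (\<forall>a\<in>carrier (val R S). \<forall>b\<in>carrier (val R S). \<mu> S (gmult R S a b) x = \<mu> S a (\<mu> S b x)))))"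


section \<open>The Grothendieck group of a commutative monoid\<close>

text \<open>The class of \<open>(a, b)\<close> is the formal difference of \<open>a\<close> and \<open>b\<close>.\<close>

definition groth_rel ::
  "('a, 'c) monoid_scheme \<Rightarrow> (('a \<times> 'a) \<times> ('a \<times> 'a)) set" where
  "groth_rel P = {((a, b), (c, d)).
     a \<in> carrier P \<and> b \<in> carrier P \<and> c \<in> carrier P \<and> d \<in> carrier P \<and>
     (\<exists>k\<in>carrier P. a \<otimes>\<^bsub>P\<^esub> d \<otimes>\<^bsub>P\<^esub> k = c \<otimes>\<^bsub>P\<^esub> b \<otimes>\<^bsub>P\<^esub> k)}"

definition groth :: "('a, 'c) monoid_scheme \<Rightarrow> ('a \<times> 'a) set monoid" where
  "groth P = \<lparr>carrier = (carrier P \<times> carrier P) // groth_rel P,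
     monoid.mult = (\<lambda>u v. groth_rel P ``
       {(a \<otimes>\<^bsub>P\<^esub> c, b \<otimes>\<^bsub>P\<^esub> d) | a b c d. (a, b) \<in> u \<and> (c, d) \<in> v}),
     one = groth_rel P `` {(\<one>\<^bsub>P\<^esub>, \<one>\<^bsub>P\<^esub>)}\<rparr>"

text \<open>The map into \<open>groth Q\<close> induced by a monoid homomorphism \<open>h\<close>.\<close>

definition groth_map ::
  "('b, 'd) monoid_scheme \<Rightarrow> ('a \<Rightarrow> 'b) \<Rightarrow> ('a \<times> 'a) set \<Rightarrow> ('b \<times> 'b) set" where
  "groth_map Q h u = groth_rel Q `` {(h a, h b) | a b. (a, b) \<in> u}"


section \<open>The Burnside ring and the Burnside quotient Green ring\<close>

definition gsets_over ::
  "('g, 'b) monoid_scheme \<Rightarrow> ('g, 'u) gset \<Rightarrow> (('g, 'u) gset \<times> ('u \<Rightarrow> 'u)) set" where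
  "gsets_over G S = {(X, f). is_gset G X \<and> f \<in> gmaps G X S}"

definition over_iso ::
  "('g, 'b) monoid_scheme \<Rightarrow> ('g, 'u) gset
    \<Rightarrow> ((('g, 'u) gset \<times> ('u \<Rightarrow> 'u)) \<times> (('g, 'u) gset \<times> ('u \<Rightarrow> 'u))) set" where
  "over_iso G S = {((X, f), (Y, g)). (X, f) \<in> gsets_over G S \<and> (Y, g) \<in> gsets_over G S \<and>
     (\<exists>h\<in>gmaps G X Y. bij_betw h (fst X) (fst Y) \<and> (\<forall>x\<in>fst X. g (h x) = f x))}"

type_synonym ('g, 'u) over_class = "(('g, 'u) gset \<times> ('u \<Rightarrow> 'u)) set"

text \<open>Isomorphism classes of finite \<open>G\<close>-sets over \<open>S\<close>, under disjoint union. The sum of two classes is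
  the class of all \<open>G\<close>-sets over \<open>S\<close> that are a disjoint union of members of the two classes; products
  and pullbacks below follow the same pattern.\<close>

definition burnside_monoid ::
  "('g, 'b) monoid_scheme \<Rightarrow> ('g, 'u) gset \<Rightarrow> ('g, 'u) over_class monoid" where
  "burnside_monoid G S = \<lparr>carrier = gsets_over G S // over_iso G S,
     monoid.mult = (\<lambda>a b. {(Z, h) \<in> gsets_over G S. \<exists>(X, f)\<in>a. \<exists>(Y, g)\<in>b. \<exists>i j.
        is_disj_union G Z X Y i j \<and> (\<forall>x\<in>fst X. h (i x) = f x) \<and> (\<forall>y\<in>fst Y. h (j y) = g y)}),
     one = {(X, f) \<in> gsets_over G S. fst X = {}}\<rparr>"

definition class_push ::
  "('g, 'b) monoid_scheme \<Rightarrow> ('g, 'u) gset \<Rightarrow> ('u \<Rightarrow> 'u)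
    \<Rightarrow> ('g, 'u) over_class \<Rightarrow> ('g, 'u) over_class" where
  "class_push G T \<phi> a = over_iso G T `` {(X, compose (fst X) \<phi> f) | X f. (X, f) \<in> a}"

definition class_pull ::
  "('g, 'b) monoid_scheme \<Rightarrow> ('g, 'u) gset \<Rightarrow> ('g, 'u) gset \<Rightarrow> ('u \<Rightarrow> 'u)
    \<Rightarrow> ('g, 'u) over_class \<Rightarrow> ('g, 'u) over_class" where
  "class_pull G S T \<phi> b = {(Z, h) \<in> gsets_over G S. \<exists>(Y, g)\<in>b. \<exists>q. is_pullback G Z S Y T h q \<phi> g}"

definition class_prod ::
  "('g, 'b) monoid_scheme \<Rightarrow> ('g, 'u) gset
    \<Rightarrow> ('g, 'u) over_class \<Rightarrow> ('g, 'u) over_class \<Rightarrow> ('g, 'u) over_class" where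
  "class_prod G S a b = {(Z, h) \<in> gsets_over G S. \<exists>(X, f)\<in>a. \<exists>(Y, g)\<in>b. \<exists>p q.
     is_pullback G Z X Y S p q f g \<and> h = compose (fst Z) f p}"

definition class_one ::
  "('g, 'b) monoid_scheme \<Rightarrow> ('g, 'u) gset \<Rightarrow> ('g, 'u) over_class" where
  "class_one G S = over_iso G S `` {(S, \<lambda>s\<in>fst S. s)}"

type_synonym ('g, 'u) burnside_elem = "(('g, 'u) over_class \<times> ('g, 'u) over_class) set"

definition burnside :: "('g, 'b) monoid_scheme \<Rightarrow> ('g, 'u, ('g, 'u) burnside_elem) green" where
  "burnside G = \<lparr>
     val = (\<lambda>S. groth (burnside_monoid G S)),
     cov = (\<lambda>S T \<phi>. groth_map (burnside_monoid G T) (class_push G T \<phi>)),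
     con = (\<lambda>S T \<phi>. groth_map (burnside_monoid G S) (class_pull G S T \<phi>)),
     gmult = (\<lambda>S u v. groth_rel (burnside_monoid G S) ``
       {(class_prod G S a c \<otimes>\<^bsub>burnside_monoid G S\<^esub> class_prod G S b d,
         class_prod G S a d \<otimes>\<^bsub>burnside_monoid G S\<^esub> class_prod G S b c)
        | a b c d. (a, b) \<in> u \<and> (c, d) \<in> v}),
     gone = (\<lambda>S. groth_rel (burnside_monoid G S) `` {(class_one G S, \<one>\<^bsub>burnside_monoid G S\<^esub>)})\<rparr>"

text \<open>The action of the Burnside ring on a Mackey functor; the arguments of \<^const>\<open>the_elem\<close> are
  singletons, since the values do not depend on the representatives.\<close>

definition class_act ::
  "('g, 'u, 'm) mackey \<Rightarrow> ('g, 'u) gset \<Rightarrow> ('g, 'u) over_class \<Rightarrow> 'm \<Rightarrow> 'm" where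
  "class_act M S a x = the_elem ((\<lambda>(X, f). cov M X S f (con M X S f x)) ` a)"

definition burnside_act ::
  "('g, 'u, 'm) mackey \<Rightarrow> ('g, 'u) gset \<Rightarrow> ('g, 'u) burnside_elem \<Rightarrow> 'm \<Rightarrow> 'm" where
  "burnside_act M S u x = the_elem
     ((\<lambda>(a, b). class_act M S a x \<otimes>\<^bsub>val M S\<^esub> inv\<^bsub>val M S\<^esub> class_act M S b x) ` u)"

definition burnside_ideal ::
  "('g, 'b) monoid_scheme \<Rightarrow> ('g, 'u, 'm) mackey \<Rightarrow> ('g, 'u) gset \<Rightarrow> ('g, 'u) burnside_elem set" where
  "burnside_ideal G M S = {a \<in> carrier (val (burnside G) S).
     (\<forall>T \<phi>. is_gset G T \<and> \<phi> \<in> gmaps G S T \<longrightarrow> (\<forall>y\<in>carrier (val M T).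
        burnside_act M T (cov (burnside G) S T \<phi> a) y = \<one>\<^bsub>val M T\<^esub>)) \<and>
     (\<forall>U \<psi>. is_gset G U \<and> \<psi> \<in> gmaps G U S \<longrightarrow> (\<forall>z\<in>carrier (val M U).
        burnside_act M U (con (burnside G) U S \<psi> a) z = \<one>\<^bsub>val M U\<^esub>))}"

definition green_quotient ::
  "('g, 'u, 'm) green \<Rightarrow> (('g, 'u) gset \<Rightarrow> 'm set) \<Rightarrow> ('g, 'u, 'm set) green" where
  "green_quotient R I = \<lparr>
     val = (\<lambda>S. val R S Mod I S),
     cov = (\<lambda>S T \<phi> C. \<Union>a\<in>C. I T #>\<^bsub>val R T\<^esub> cov R S T \<phi> a),
     con = (\<lambda>S T \<phi> C. \<Union>a\<in>C. I S #>\<^bsub>val R S\<^esub> con R S T \<phi> a),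
     gmult = (\<lambda>S C D. \<Union>a\<in>C. \<Union>b\<in>D. I S #>\<^bsub>val R S\<^esub> gmult R S a b),
     gone = (\<lambda>S. I S #>\<^bsub>val R S\<^esub> gone R S)\<rparr>"

definition burnside_quotient ::
  "('g, 'b) monoid_scheme \<Rightarrow> ('g, 'u, 'm) mackey \<Rightarrow> ('g, 'u, ('g, 'u) burnside_elem set) green" where
  "burnside_quotient G M = green_quotient (burnside G) (burnside_ideal G M)"


section \<open>Tensor products of abelian groups and the local ring at \<open>p\<close>\<close>

definition tensor_rels ::
  "('a, 'c) monoid_scheme \<Rightarrow> ('b, 'd) monoid_scheme \<Rightarrow> (('a \<times> 'b) \<Rightarrow>\<^sub>0 int) set" where
  "tensor_rels A B = generate (free_Abelian_group (carrier A \<times> carrier B))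
     ({frag_of (a \<otimes>\<^bsub>A\<^esub> a', b) - frag_of (a, b) - frag_of (a', b)
        | a a' b. a \<in> carrier A \<and> a' \<in> carrier A \<and> b \<in> carrier B} \<union>
      {frag_of (a, b \<otimes>\<^bsub>B\<^esub> b') - frag_of (a, b) - frag_of (a, b')
        | a b b'. a \<in> carrier A \<and> b \<in> carrier B \<and> b' \<in> carrier B})"

definition tensor ::
  "('a, 'c) monoid_scheme \<Rightarrow> ('b, 'd) monoid_scheme \<Rightarrow> (('a \<times> 'b) \<Rightarrow>\<^sub>0 int) set monoid" where
  "tensor A B = free_Abelian_group (carrier A \<times> carrier B) Mod tensor_rels A B"

text \<open>The map \<open>f \<otimes> g\<close> into \<open>tensor A' B'\<close>.\<close>

definition tensor_map ::
  "('a2, 'c) monoid_scheme \<Rightarrow> ('b2, 'd) monoid_scheme \<Rightarrow> ('a1 \<Rightarrow> 'a2) \<Rightarrow> ('b1 \<Rightarrow> 'b2)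
    \<Rightarrow> (('a1 \<times> 'b1) \<Rightarrow>\<^sub>0 int) set \<Rightarrow> (('a2 \<times> 'b2) \<Rightarrow>\<^sub>0 int) set" where
  "tensor_map A' B' f g C = (\<Union>c\<in>C. tensor_rels A' B'
     #>\<^bsub>free_Abelian_group (carrier A' \<times> carrier B')\<^esub> frag_extend (\<lambda>(a, b). frag_of (f a, g b)) c)"

text \<open>The additive group of the integers localized at the prime \<open>p\<close>.\<close>

definition int_localized :: "nat \<Rightarrow> rat monoid" where
  "int_localized p = \<lparr>carrier = {of_int a / of_int b | a b. \<not> int p dvd b},
     monoid.mult = (+), one = 0\<rparr>"


section \<open>Families of subgroups and Dress generating sets\<close>

definition conj_subgroup :: "('g, 'b) monoid_scheme \<Rightarrow> 'g \<Rightarrow> 'g set \<Rightarrow> 'g set" where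
  "conj_subgroup G g H = g <#\<^bsub>G\<^esub> H #>\<^bsub>G\<^esub> inv\<^bsub>G\<^esub> g"

definition is_family :: "('g, 'b) monoid_scheme \<Rightarrow> 'g set set \<Rightarrow> bool" where
  "is_family G F \<longleftrightarrow>
     (\<forall>H\<in>F. subgroup H G) \<and>
     (\<forall>H\<in>F. \<forall>g\<in>carrier G. conj_subgroup G g H \<in> F) \<and>
     (\<forall>H\<in>F. \<forall>K. subgroup K G \<and> K \<subseteq> H \<longrightarrow> K \<in> F)"

definition family_of :: "('g, 'b) monoid_scheme \<Rightarrow> ('g, 'u) gset \<Rightarrow> 'g set set" where
  "family_of G X = \<Inter> {F. is_family G F \<and> (\<forall>x\<in>fst X. stabilizer G (snd X) x \<in> F)}"

definition maximal_in :: "'g set set \<Rightarrow> 'g set set" where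
  "maximal_in F = {H \<in> F. \<forall>K\<in>F. H \<subseteq> K \<longrightarrow> K = H}"

text \<open>The disjoint union of the coset spaces \<open>G/H\<close> with \<open>H \<in> R\<close>, under left translation.\<close>

definition coset_sum :: "('g, 'b) monoid_scheme \<Rightarrow> 'g set set \<Rightarrow> ('g, 'g set \<times> 'g set) gset" where
  "coset_sum G R = (SIGMA H:R. lcosets\<^bsub>G\<^esub> H,
     \<lambda>g\<in>carrier G. \<lambda>(H, C)\<in>(SIGMA H:R. lcosets\<^bsub>G\<^esub> H). (H, g <#\<^bsub>G\<^esub> C))"

text \<open>\<open>R\<close> ranges over the systems of representatives of the conjugacy classes of maximal elements.
  The chosen \<open>G\<close>-set is unique up to isomorphism.\<close>

definition gset_of_family :: "('g, 'b) monoid_scheme \<Rightarrow> 'g set set \<Rightarrow> ('g, 'u) gset" where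
  "gset_of_family G F = (SOME Y. is_gset G Y \<and>
     (\<exists>R \<subseteq> maximal_in F.
        (\<forall>H\<in>maximal_in F. \<exists>!K. K \<in> R \<and> (\<exists>g\<in>carrier G. K = conj_subgroup G g H)) \<and>
        gset_iso G (coset_sum G R) Y))"

text \<open>The subgroup \<open>O\<^sup>p(H)\<close>.\<close>

definition p_residual :: "('g, 'b) monoid_scheme \<Rightarrow> nat \<Rightarrow> 'g set \<Rightarrow> 'g set" where
  "p_residual G p H =
     \<Inter> {N. N \<lhd> G\<lparr>carrier := H\<rparr> \<and> (\<exists>k. order (G\<lparr>carrier := H\<rparr> Mod N) = p ^ k)}"

definition hyper_family ::
  "('g, 'b) monoid_scheme \<Rightarrow> nat \<Rightarrow> 'g set set \<Rightarrow> 'g set set" where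
  "hyper_family G p F = {H. subgroup H G \<and> p_residual G p H \<in> F}"

definition hyper_gset :: "('g, 'b) monoid_scheme \<Rightarrow> nat \<Rightarrow> ('g, 'u) gset \<Rightarrow> ('g, 'u) gset" where
  "hyper_gset G p X = gset_of_family G (hyper_family G p (family_of G X))"

definition dress_generating_green ::
  "('g, 'b) monoid_scheme \<Rightarrow> ('g, 'u, 'r) green \<Rightarrow> ('g, 'u) gset \<Rightarrow> bool" where
  "dress_generating_green G R X \<longleftrightarrow> (\<forall>p::nat. prime p \<longrightarrow>
     (let Y = hyper_gset G p X; P = point_gset G; Zp = int_localized p in
        tensor_map (val R P) Zp (cov R Y P (to_point Y)) (\<lambda>z. z) ` carrier (tensor (val R Y) Zp)
          = carrier (tensor (val R P) Zp)))"

definition dress_generating ::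
  "('g, 'b) monoid_scheme \<Rightarrow> ('g, 'u, 'm) mackey \<Rightarrow> ('g, 'u) gset \<Rightarrow> bool" where
  "dress_generating G M X \<longleftrightarrow> dress_generating_green G (burnside_quotient G M) X"

end

theory Submission
  imports Defs "HOL-Library.Function_Algebras" "HOL-Algebra.Sylow" "HOL-Algebra.Zassenhaus"
begin

text \<open>
  Write \<open>A\<close> for the Burnside ring, \<open>I\<^sub>M\<close> for the ideal of elements annihilating \<open>M\<close>, \<open>pt\<close> for the point and \<open>Y\<close> for the
  \<open>G\<close>-set \<open>hyper\<^sub>p-X\<close>. Surjectivity after localizing at \<open>p\<close> means that every element of the target has a multiple
  prime to \<open>p\<close> in the image (\<open>tensor_map_surj_iff\<close>). Hence \<open>X\<close> is a Dress generating set for \<open>M\<close> if and only if for all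
  primes \<open>p\<close> every \<open>a\<close> in \<open>A(pt)\<close> has a multiple \<open>n a\<close>, with \<open>n\<close> prime to \<open>p\<close>, that is induced from \<open>A(Y)\<close> modulo
  \<open>I\<^sub>M(pt)\<close> (\<open>dress_generating_iff\<close>). This only gets easier when the ideal grows. The action of \<open>A\<close> commutes with natural
  transformations, so \<open>I\<^sub>M(pt)\<close> is contained in \<open>I\<^sub>N(pt)\<close> when \<open>N\<close> is a sub-functor or a quotient functor of \<open>M\<close>, or
  when \<open>M\<close> is a full lattice in \<open>N\<close>. This settles the second and third claims.

  The first claim combines two facts. Let \<open>k\<close> in \<open>A(pt)\<close> restrict to zero in \<open>A(Y)\<close>, and let \<open>m 1\<close> be induced from \<open>Y\<close> in
  the Green ring. Then multiplication by \<open>m\<close> on \<open>M(U)\<close> factors through induction from \<open>U \<times> Y\<close>, and Frobenius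
  reciprocity shows that \<open>m k\<close> annihilates \<open>M(U)\<close>; thus \<open>m k\<close> lies in \<open>I\<^sub>M(pt)\<close> (\<open>burnside_multiple_in_ideal\<close>). The
  other fact concerns the Burnside ring alone and is due to Dress: each \<open>a\<close> in \<open>A(pt)\<close> has a multiple \<open>n a\<close>, with \<open>n\<close>
  prime to \<open>p\<close>, that differs from an element induced from \<open>Y\<close> by an element restricting to zero on \<open>Y\<close>
  (\<open>burnside_hyper_induction\<close>).

  For the proof of the latter, elements of \<open>A\<close> are described by their marks, the numbers of fixed points of subgroups in
  the fibres; by Burnside's theorem (\<open>marks_determine\<close>) they determine the element. Restriction to \<open>Y\<close> sees the marks at
  the subgroups \<open>H\<close> that fix a point of \<open>Y\<close>. The marks of elements induced from \<open>Y\<close> form a ring of integer functions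
  of \<open>H\<close>, and such a ring contains a constant prime to \<open>p\<close> as soon as for each \<open>H\<close> it contains a function prime to \<open>p\<close>
  at \<open>H\<close> (\<open>ex_constant_unit_mod\<close>). The function for \<open>H\<close> is the mark of \<open>G/K\<close>, where \<open>K/Q\<close> is a Sylow \<open>p\<close>-subgroup of
  \<open>N(Q)/Q\<close> and \<open>Q\<close> is a \<open>p\<close>-perfect subgroup of \<open>H\<close> obtained from \<open>H\<close> by steps of \<open>p\<close>-power index
  (\<open>ex_hyper_subgroup_fixcard\<close>); here it matters that the family defining \<open>Y\<close> is a hyper family.

  Marks also do the bookkeeping. The isomorphism classes over \<open>S\<close> form a monoid of functions, on which disjoint union,
  composition and pullback are given by explicit formulas, and the laws of the Burnside Mackey functor become
  identities between functions.
\<close>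

section \<open>Surjectivity after localizing at a prime\<close>

text \<open>A homomorphism carrying \<open>N\<close> into \<open>N'\<close> induces a map of the quotients. Both \<^const>\<open>tensor_map\<close> and
  \<^const>\<open>green_quotient\<close> write the image of a coset as a union of cosets; all members of this union coincide.\<close>

lemma coset_map_eq:
  assumes N: "N \<lhd> G" and N': "subgroup N' H" and H: "group H" and h: "h \<in> hom G H"
    and sub: "h ` N \<subseteq> N'" and x: "x \<in> carrier G"
  shows "(\<Union>c\<in>N #>\<^bsub>G\<^esub> x. N' #>\<^bsub>H\<^esub> h c) = N' #>\<^bsub>H\<^esub> h x"
proof -
  interpret N: normal N G by fact
  interpret H: group H by fact
  interpret N': subgroup N' H by fact
  have hx: "h x \<in> carrier H" using h x by (auto simp: hom_def)
  have eq: "N' #>\<^bsub>H\<^esub> h (n \<otimes>\<^bsub>G\<^esub> x) = N' #>\<^bsub>H\<^esub> h x" if n: "n \<in> N" for n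
  proof -
    have "h n \<in> N'" using sub n by auto
    moreover have "h (n \<otimes>\<^bsub>G\<^esub> x) = h n \<otimes>\<^bsub>H\<^esub> h x" using h x n N.subset by (auto simp: hom_def)
    ultimately show ?thesis
      using hx by (metis H.coset_join2 H.coset_mult_assoc N' N'.mem_carrier N'.subset)
  qed
  have "N #>\<^bsub>G\<^esub> x \<noteq> {}" using N.rcos_self[OF x N.subgroup_axioms] by blast
  moreover have "N' #>\<^bsub>H\<^esub> h c = N' #>\<^bsub>H\<^esub> h x" if "c \<in> N #>\<^bsub>G\<^esub> x" for c
    using that eq by (auto simp: r_coset_def)
  ultimately show ?thesis by auto
qed

lemma coset_eq_iff:
  assumes "subgroup N G" "group G" "x \<in> carrier G" "y \<in> carrier G"
  shows "N #>\<^bsub>G\<^esub> x = N #>\<^bsub>G\<^esub> y \<longleftrightarrow> x \<otimes>\<^bsub>G\<^esub> inv\<^bsub>G\<^esub> y \<in> N"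
proof -
  interpret group G by fact
  interpret subgroup N G by fact
  show ?thesis
    by (metis assms(1,3,4) is_group rcos_module rcos_self repr_independence)
qed

lemma int_localizedI: "\<not> int p dvd b \<Longrightarrow> of_int a / of_int b \<in> carrier (int_localized p)"
  unfolding int_localized_def by (simp only: partial_object.simps mem_Collect_eq)
    (intro exI[of _ a] exI[of _ b] conjI refl)

lemma int_localized_denominator:
  assumes "z \<in> carrier (int_localized p)"
  obtains m where "\<not> p dvd m" "\<And>n. m dvd n \<Longrightarrow> of_nat n * z \<in> \<int>"
proof -
  obtain a b where z: "z = of_int a / of_int b" and b: "\<not> int p dvd b"
    using assms by (auto simp: int_localized_def)
  have b0: "b \<noteq> 0" using b by auto
  have "of_nat n * z \<in> \<int>" if n: "nat \<bar>b\<bar> dvd n" for n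
  proof -
    have "b dvd int n" using n by (metis abs_dvd_iff int_dvd_int_iff int_nat_eq abs_ge_zero)
    then obtain k where k: "int n = b * k" by (auto simp: dvd_def)
    have "(of_nat n :: rat) = of_int (b * k)" by (metis k of_int_of_nat_eq)
    then have "of_nat n * z = of_int (k * a)" using z b0 by (simp add: field_simps)
    then show ?thesis by (metis Ints_of_int)
  qed
  moreover have "\<not> p dvd nat \<bar>b\<bar>" using b by (simp add: nat_dvd_iff dvd_nat_abs_iff)
  ultimately show thesis using that by blast
qed

text \<open>Division by integers prime to \<open>p\<close> is what lets a factor \<open>n\<close> be absorbed into the second tensor factor.\<close>

lemma int_localized_scale:
  assumes "prime p" "z \<in> carrier (int_localized p)" "\<not> p dvd n"
  obtains w where "w \<in> carrier (int_localized p)" "z = of_nat n * w"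
proof -
  obtain a b where z: "z = of_int a / of_int b" and b: "\<not> int p dvd b"
    using assms by (auto simp: int_localized_def)
  have n0: "n \<noteq> 0" using assms(3) by (intro notI) simp
  have "\<not> int p dvd b * int n"
    using b assms by (simp add: prime_dvd_mult_iff)
  then have "of_int a / of_int (b * int n) \<in> carrier (int_localized p)"
    by (rule int_localizedI)
  moreover have "z = of_nat n * (of_int a / of_int (b * int n))" using z n0 by simp
  ultimately show thesis using that by blast
qed

lemma subgroup_tensor_rels:
  assumes "group A" "group B"
  shows "subgroup (tensor_rels A B) (free_Abelian_group (carrier A \<times> carrier B))"
proof -
  interpret A: group A by fact
  interpret B: group B by fact
  interpret F: comm_group "free_Abelian_group (carrier A \<times> carrier B)"
    by (rule abelian_free_Abelian_group)
  have *: "Poly_Mapping.keys (frag_of u - frag_of v - frag_of w) \<subseteq> {u, v, w}" for u v w :: "'a \<times> 'c"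
    using keys_diff[of "frag_of u - frag_of v" "frag_of w"] keys_diff[of "frag_of u" "frag_of v"] by auto
  show ?thesis unfolding tensor_rels_def
    by (rule F.generate_is_subgroup) (auto dest!: subsetD[OF *])
qed

lemma tensor_rels_left:
  assumes "a \<in> carrier A" "a' \<in> carrier A" "b \<in> carrier B"
  shows "frag_of (a \<otimes>\<^bsub>A\<^esub> a', b) - frag_of (a, b) - frag_of (a', b) \<in> tensor_rels A B"
  unfolding tensor_rels_def by (rule generate.incl) (use assms in blast)

lemma tensor_rels_right:
  assumes "a \<in> carrier A" "b \<in> carrier B" "b' \<in> carrier B"
  shows "frag_of (a, b \<otimes>\<^bsub>B\<^esub> b') - frag_of (a, b) - frag_of (a, b') \<in> tensor_rels A B"
  unfolding tensor_rels_def by (rule generate.incl) (use assms in blast)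

lemma tensor_rels_induct [consumes 3, case_names zero left right add minus]:
  assumes u: "u \<in> tensor_rels A B" and A: "group A" and B: "group B"
    and zero: "P 0"
    and left: "\<And>a a' b. a \<in> carrier A \<Longrightarrow> a' \<in> carrier A \<Longrightarrow> b \<in> carrier B \<Longrightarrow>
      P (frag_of (a \<otimes>\<^bsub>A\<^esub> a', b) - frag_of (a, b) - frag_of (a', b))"
    and right: "\<And>a b b'. a \<in> carrier A \<Longrightarrow> b \<in> carrier B \<Longrightarrow> b' \<in> carrier B \<Longrightarrow>
      P (frag_of (a, b \<otimes>\<^bsub>B\<^esub> b') - frag_of (a, b) - frag_of (a, b'))"
    and add: "\<And>x y. x \<in> tensor_rels A B \<Longrightarrow> y \<in> tensor_rels A B \<Longrightarrow> P x \<Longrightarrow> P y \<Longrightarrow> P (x + y)"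
    and minus: "\<And>x. x \<in> tensor_rels A B \<Longrightarrow> P x \<Longrightarrow> P (- x)"
  shows "P u"
proof -
  let ?F = "free_Abelian_group (carrier A \<times> carrier B)"
  let ?S = "{frag_of (a \<otimes>\<^bsub>A\<^esub> a', b) - frag_of (a, b) - frag_of (a', b)
        | a a' b. a \<in> carrier A \<and> a' \<in> carrier A \<and> b \<in> carrier B} \<union>
      {frag_of (a, b \<otimes>\<^bsub>B\<^esub> b') - frag_of (a, b) - frag_of (a, b')
        | a b b'. a \<in> carrier A \<and> b \<in> carrier B \<and> b' \<in> carrier B}"
  have eq: "tensor_rels A B = generate ?F ?S" by (rule tensor_rels_def)
  have gen: "P h" if "h \<in> ?S" for h
    using that left right by (elim UnE CollectE exE conjE) simp_all
  have "u \<in> generate ?F ?S" using u eq by simp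
  then show ?thesis
  proof (induction rule: generate.induct)
    case one show ?case using zero by simp
  next
    case (incl h) then show ?case by (rule gen)
  next
    case (inv h)
    have h: "h \<in> tensor_rels A B" unfolding eq by (rule generate.incl) (rule inv)
    then have "Poly_Mapping.keys h \<subseteq> carrier A \<times> carrier B"
      using subsetD[OF subgroup.subset[OF subgroup_tensor_rels[OF A B]]]
      by (simp only: carrier_free_Abelian_group_iff)
    then show ?case using minus[OF h gen[OF inv]] by simp
  next
    case (eng h1 h2)
    then show ?case using add[of h1 h2] by (simp add: eq)
  qed
qed

text \<open>Integers move across the tensor sign, because both sides agree with \<open>n\<close> times \<open>a \<otimes> b\<close> modulo the relations.\<close>

lemma tensor_pow:
  assumes A: "group A" and B: "group B" and a: "a \<in> carrier A" and b: "b \<in> carrier B"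
  shows "frag_of (a [^]\<^bsub>A\<^esub> (n::nat), b) - frag_of (a, b [^]\<^bsub>B\<^esub> n) \<in> tensor_rels A B"
proof -
  interpret A: group A by fact
  interpret B: group B by fact
  let ?F = "free_Abelian_group (carrier A \<times> carrier B)"
  let ?R = "tensor_rels A B"
  interpret R: subgroup ?R ?F by (rule subgroup_tensor_rels[OF A B])
  have keys: "Poly_Mapping.keys u \<subseteq> carrier A \<times> carrier B" if "u \<in> ?R" for u
    using subsetD[OF R.subset that] by (simp only: carrier_free_Abelian_group_iff)
  have add: "u + v \<in> ?R" if "u \<in> ?R" "v \<in> ?R" for u v using R.m_closed[OF that] by simp
  have neg: "- u \<in> ?R" if "u \<in> ?R" for u using R.m_inv_closed[OF that] keys[OF that] by simp
  have zero: "0 \<in> ?R" using R.one_closed by simp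
  have 1: "frag_of (a [^]\<^bsub>A\<^esub> n, b) - frag_cmul (int n) (frag_of (a, b)) \<in> ?R"
  proof (induction n)
    case 0
    show ?case using neg[OF tensor_rels_left[of "\<one>\<^bsub>A\<^esub>" A "\<one>\<^bsub>A\<^esub>" b B]] b by simp
  next
    case (Suc n)
    show ?case using add[OF tensor_rels_left[of "a [^]\<^bsub>A\<^esub> n" A a b B] Suc.IH] a b
      by (simp add: frag_cmul_distrib algebra_simps)
  qed
  have 2: "frag_of (a, b [^]\<^bsub>B\<^esub> n) - frag_cmul (int n) (frag_of (a, b)) \<in> ?R"
  proof (induction n)
    case 0
    show ?case using neg[OF tensor_rels_right[of a A "\<one>\<^bsub>B\<^esub>" B "\<one>\<^bsub>B\<^esub>"]] a by simp
  next
    case (Suc n)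
    show ?case using add[OF tensor_rels_right[of a A "b [^]\<^bsub>B\<^esub> n" B b] Suc.IH] a b
      by (simp add: frag_cmul_distrib algebra_simps)
  qed
  show ?thesis using add[OF 1 neg[OF 2]] by simp
qed

lemma mult_int_localized [simp]: "x \<otimes>\<^bsub>int_localized p\<^esub> y = x + y"
  and one_int_localized [simp]: "\<one>\<^bsub>int_localized p\<^esub> = 0"
  by (simp_all add: int_localized_def)

lemma nat_pow_rec: "x [^]\<^bsub>H\<^esub> (0::nat) = \<one>\<^bsub>H\<^esub>" "x [^]\<^bsub>H\<^esub> Suc n = (x [^]\<^bsub>H\<^esub> n) \<otimes>\<^bsub>H\<^esub> x"
  unfolding nat_pow_def by (simp_all only: nat.rec)

lemma int_localized_pow: "z [^]\<^bsub>int_localized p\<^esub> (n::nat) = of_nat n * z"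
proof (induction n)
  case 0
  show ?case by (simp only: nat_pow_rec) simp
next
  case (Suc n)
  have "z [^]\<^bsub>int_localized p\<^esub> (Suc n) = z [^]\<^bsub>int_localized p\<^esub> n + z" by (simp only: nat_pow_rec mult_int_localized)
  then show ?case unfolding Suc.IH of_nat_Suc by (simp only: distrib_right mult_1_left add.commute)
qed

lemma int_localized_of_int: "of_int a \<in> carrier (int_localized p)" if "prime p"
proof -
  have "\<not> int p dvd 1" using that not_prime_unit[of p] int_dvd_int_iff[of p 1] by (metis of_nat_1)
  then have "of_int a / of_int 1 \<in> carrier (int_localized p)" by (rule int_localizedI)
  then show ?thesis by simp
qed

lemma int_localized_group: "group (int_localized p)" if "prime p"
proof (rule groupI)
  fix x y z assume "x \<in> carrier (int_localized p)" "y \<in> carrier (int_localized p)"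
  then obtain a b c d where *: "x = of_int a / of_int b" "\<not> int p dvd b"
    "y = of_int c / of_int d" "\<not> int p dvd d"
    unfolding int_localized_def by auto
  then have "b \<noteq> 0" "d \<noteq> 0" by auto
  then have "x + y = of_int (a * d + c * b) / of_int (b * d)" using * by (simp add: field_simps)
  moreover have "\<not> int p dvd b * d" using * that by (simp add: prime_dvd_mult_iff)
  ultimately show "x \<otimes>\<^bsub>int_localized p\<^esub> y \<in> carrier (int_localized p)"
    using int_localizedI[of p "b * d" "a * d + c * b"] by simp
next
  show "\<one>\<^bsub>int_localized p\<^esub> \<in> carrier (int_localized p)"
  proof -
    have "(0::rat) \<in> carrier (int_localized p)" using int_localized_of_int[OF that, of 0] unfolding of_int_0 .
    then show ?thesis unfolding one_int_localized .
  qed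
next
  fix x assume "x \<in> carrier (int_localized p)"
  then obtain a b where *: "x = of_int a / of_int b" "\<not> int p dvd b" by (auto simp: int_localized_def)
  then have "of_int (-a) / of_int b \<in> carrier (int_localized p)" using int_localizedI by blast
  then show "\<exists>y\<in>carrier (int_localized p). y \<otimes>\<^bsub>int_localized p\<^esub> x = \<one>\<^bsub>int_localized p\<^esub>"
    using * by (intro bexI[where x = "of_int (-a) / of_int b"]) (simp_all)
qed (simp_all only: mult_int_localized one_int_localized add.assoc add_0_left)

text \<open>Tensoring with \<open>\<int>\<close> localized at \<open>p\<close> is exact and kills torsion prime to \<open>p\<close>, so surjectivity means that the
  cokernel of \<open>f\<close> is torsion prime to \<open>p\<close>. Concretely, if
  \<open>n b = f a\<close> with \<open>p\<close> not dividing \<open>n\<close>, then \<open>b \<otimes> z = f a \<otimes> (z / n)\<close>. Conversely, the maps \<open>b \<otimes> z \<mapsto> \<lfloor>M z\<rfloor> b\<close>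
  on the free group are not compatible with the relations, but each element of the relation subgroup is killed
  for all \<open>M\<close> divisible by a suitable number prime to \<open>p\<close>; applied to an expression of \<open>b \<otimes> 1\<close> as an image,
  such a map exhibits \<open>M b\<close> as an image.\<close>

theorem tensor_map_surj_iff:
  assumes A: "comm_group A" and B: "comm_group B" and f: "f \<in> hom A B" and p: "prime p"
  shows "tensor_map B (int_localized p) f (\<lambda>z. z) ` carrier (tensor A (int_localized p))
           = carrier (tensor B (int_localized p)) \<longleftrightarrow>
         (\<forall>b\<in>carrier B. \<exists>n::nat. \<not> p dvd n \<and> b [^]\<^bsub>B\<^esub> n \<in> f ` carrier A)"
    (is "?lhs \<longleftrightarrow> ?rhs")
proof -
  interpret A: comm_group A by fact
  interpret B: comm_group B by fact
  let ?Z = "int_localized p"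
  interpret Z: group ?Z by (rule int_localized_group[OF p])
  let ?FA = "free_Abelian_group (carrier A \<times> carrier ?Z)"
  let ?FB = "free_Abelian_group (carrier B \<times> carrier ?Z)"
  let ?RA = "tensor_rels A ?Z"
  let ?RB = "tensor_rels B ?Z"
  define F where "F = frag_extend (\<lambda>(a, z::rat). frag_of (f a, z))"
  interpret FA: comm_group ?FA by (rule abelian_free_Abelian_group)
  interpret FB: comm_group ?FB by (rule abelian_free_Abelian_group)
  interpret RA: subgroup ?RA ?FA by (rule subgroup_tensor_rels) unfold_locales
  interpret RB: subgroup ?RB ?FB by (rule subgroup_tensor_rels) unfold_locales
  have fc: "f a \<in> carrier B" if "a \<in> carrier A" for a using f that by (auto simp: hom_def)
  have fm: "f (a \<otimes>\<^bsub>A\<^esub> a') = f a \<otimes>\<^bsub>B\<^esub> f a'" if "a \<in> carrier A" "a' \<in> carrier A" for a a'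
    using f that by (auto simp: hom_def)
  have Fkeys: "Poly_Mapping.keys (F x) \<subseteq> carrier B \<times> carrier ?Z"
    if "Poly_Mapping.keys x \<subseteq> carrier A \<times> carrier ?Z" for x
  proof
    fix v assume "v \<in> Poly_Mapping.keys (F x)"
    then obtain u where u: "u \<in> Poly_Mapping.keys x"
      and v: "v \<in> Poly_Mapping.keys (case u of (a, z) \<Rightarrow> frag_of (f a, z))"
      using keys_frag_extend[of "\<lambda>(a, z). frag_of (f a, z)" x] unfolding F_def by blast
    obtain a z where az: "u = (a, z)" by (cases u)
    have "a \<in> carrier A" "z \<in> carrier ?Z" using u az that by auto
    then show "v \<in> carrier B \<times> carrier ?Z" using v az fc by simp
  qed
  have Fhom: "F \<in> hom ?FA ?FB"
    using Fkeys by (auto simp: hom_def F_def frag_extend_add)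
  have keysB: "Poly_Mapping.keys u \<subseteq> carrier B \<times> carrier ?Z" if "u \<in> ?RB" for u
    using subsetD[OF RB.subset that] by (simp only: carrier_free_Abelian_group_iff)
  have add: "u + v \<in> ?RB" if "u \<in> ?RB" "v \<in> ?RB" for u v using RB.m_closed[OF that] by simp
  have neg: "- u \<in> ?RB" if "u \<in> ?RB" for u using RB.m_inv_closed[OF that] keysB[OF that] by simp
  have zero: "0 \<in> ?RB" using RB.one_closed by simp
  have FR: "F ` ?RA \<subseteq> ?RB"
  proof (rule image_subsetI)
    fix u assume "u \<in> ?RA"
    then show "F u \<in> ?RB" using A.is_group Z.is_group
    proof (induction rule: tensor_rels_induct)
      case zero show ?case using \<open>0 \<in> ?RB\<close> by (simp add: F_def)
    next
      case (left a a' b)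
      then show ?case using tensor_rels_left[of "f a" B "f a'" b ?Z]
        by (simp add: F_def frag_extend_diff fm fc del: mult_int_localized)
    next
      case (right a b b')
      then show ?case using tensor_rels_right[of "f a" B b ?Z b']
        by (simp add: F_def frag_extend_diff fm fc del: mult_int_localized)
    next
      case (add x y)
      then show ?case using \<open>\<And>u v. u \<in> ?RB \<Longrightarrow> v \<in> ?RB \<Longrightarrow> u + v \<in> ?RB\<close>
        by (simp add: F_def frag_extend_add)
    next
      case (minus x)
      then show ?case using neg by (simp add: F_def frag_extend_minus)
    qed
  qed
  have normA: "?RA \<lhd> ?FA" by (rule FA.subgroup_imp_normal) unfold_locales
  have map: "tensor_map B ?Z f (\<lambda>z. z) (?RA #>\<^bsub>?FA\<^esub> x) = ?RB #>\<^bsub>?FB\<^esub> F x" if "x \<in> carrier ?FA" for x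
    using coset_map_eq[OF normA RB.subgroup_axioms FB.is_group Fhom FR that]
    unfolding tensor_map_def F_def .
  have img: "tensor_map B ?Z f (\<lambda>z. z) ` carrier (tensor A ?Z) = (\<lambda>x. ?RB #>\<^bsub>?FB\<^esub> F x) ` carrier ?FA"
    unfolding tensor_def carrier_FactGroup image_image by (rule image_cong[OF refl map])
  have cB: "carrier (tensor B ?Z) = (\<lambda>y. ?RB #>\<^bsub>?FB\<^esub> y) ` carrier ?FB"
    unfolding tensor_def by (rule carrier_FactGroup)
  have surj: "?lhs \<longleftrightarrow> (\<forall>y\<in>carrier ?FB. \<exists>x\<in>carrier ?FA. y - F x \<in> ?RB)" (is "_ \<longleftrightarrow> ?mid")
  proof -
    have eq: "?RB #>\<^bsub>?FB\<^esub> y = ?RB #>\<^bsub>?FB\<^esub> F x \<longleftrightarrow> y - F x \<in> ?RB"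
      if "y \<in> carrier ?FB" "x \<in> carrier ?FA" for x y
      using coset_eq_iff[OF RB.subgroup_axioms FB.is_group, of y "F x"] that Fkeys by simp
    have "(\<lambda>x. ?RB #>\<^bsub>?FB\<^esub> F x) ` carrier ?FA \<subseteq> (\<lambda>y. ?RB #>\<^bsub>?FB\<^esub> y) ` carrier ?FB"
      using Fhom by (auto simp: hom_def)
    then have "?lhs = (\<forall>y\<in>carrier ?FB. \<exists>x\<in>carrier ?FA. ?RB #>\<^bsub>?FB\<^esub> y = ?RB #>\<^bsub>?FB\<^esub> F x)"
      unfolding img cB set_eq_subset[of "(\<lambda>x. ?RB #>\<^bsub>?FB\<^esub> F x) ` carrier ?FA"] image_subset_iff[of "\<lambda>y. ?RB #>\<^bsub>?FB\<^esub> y"] image_iff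
      by - (intro iffI conjI, erule conjunct2, assumption+)
    also have "\<dots> = ?mid" by (intro ball_cong bex_cong refl eq)
    finally show ?thesis .
  qed
  show ?thesis
  proof
    assume ?lhs
    show ?rhs
    proof
      fix b assume b: "b \<in> carrier B"
      \<comment> \<open>\<open>L M\<close> sends \<open>c \<otimes> z\<close> to \<open>\<lfloor>M z\<rfloor>\<close> times \<open>c\<close>; the floor makes it total on the free group\<close>
      have "\<forall>M::nat. \<exists>L. L \<in> hom ?FB B \<and>
          (\<forall>x\<in>carrier B \<times> carrier ?Z. L (frag_of x) = (case x of (c, z) \<Rightarrow> c [^]\<^bsub>B\<^esub> \<lfloor>of_nat M * z\<rfloor>))"
      proof
        fix M :: nat
        show "\<exists>L. L \<in> hom ?FB B \<and>
          (\<forall>x\<in>carrier B \<times> carrier ?Z. L (frag_of x) = (case x of (c, z) \<Rightarrow> c [^]\<^bsub>B\<^esub> \<lfloor>of_nat M * z\<rfloor>))"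
          by (rule B.free_Abelian_group_universal[of "\<lambda>(c, z). c [^]\<^bsub>B\<^esub> \<lfloor>of_nat M * z\<rfloor>" "carrier B \<times> carrier ?Z"])
            (auto simp: image_subset_iff)
      qed
      then obtain L where Lhom: "\<And>M::nat. L M \<in> hom ?FB B"
        and Lof: "\<And>M c z. c \<in> carrier B \<Longrightarrow> z \<in> carrier ?Z \<Longrightarrow> L M (frag_of (c, z)) = c [^]\<^bsub>B\<^esub> \<lfloor>of_nat M * z\<rfloor>"
        by (metis (no_types, lifting) SigmaI case_prod_conv)
      interpret L: group_hom ?FB B "L M" for M
        by unfold_locales (rule Lhom)
      have Ladd: "L M (u + v) = L M u \<otimes>\<^bsub>B\<^esub> L M v"
        if "Poly_Mapping.keys u \<subseteq> carrier B \<times> carrier ?Z" "Poly_Mapping.keys v \<subseteq> carrier B \<times> carrier ?Z" for M u v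
        using L.hom_mult[of u v M] that by simp
      have Lneg: "L M (- u) = inv\<^bsub>B\<^esub> L M u"
        if "Poly_Mapping.keys u \<subseteq> carrier B \<times> carrier ?Z" for M u
        using L.hom_inv[of u M] that by simp
      have Ldiff: "L M (u - v) = L M u \<otimes>\<^bsub>B\<^esub> inv\<^bsub>B\<^esub> L M v"
        if "Poly_Mapping.keys u \<subseteq> carrier B \<times> carrier ?Z" "Poly_Mapping.keys v \<subseteq> carrier B \<times> carrier ?Z" for M u v
        using Ladd[of u "-v" M] Lneg[of v M] that by simp
      have Lc: "L M u \<in> carrier B" if "Poly_Mapping.keys u \<subseteq> carrier B \<times> carrier ?Z" for M u
        using L.hom_closed that by simp
      have keysd: "Poly_Mapping.keys (u - v) \<subseteq> carrier B \<times> carrier ?Z"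
        if "Poly_Mapping.keys u \<subseteq> carrier B \<times> carrier ?Z" "Poly_Mapping.keys v \<subseteq> carrier B \<times> carrier ?Z"
        for u v :: "('c \<times> rat) \<Rightarrow>\<^sub>0 int"
        using keys_diff[of u v] that by auto
      have Lrel: "L M (frag_of u - frag_of v - frag_of w) = \<one>\<^bsub>B\<^esub>"
        if "u \<in> carrier B \<times> carrier ?Z" "v \<in> carrier B \<times> carrier ?Z" "w \<in> carrier B \<times> carrier ?Z"
          and eq: "L M (frag_of u) = L M (frag_of v) \<otimes>\<^bsub>B\<^esub> L M (frag_of w)" for u v w M
      proof -
        let ?v = "L M (frag_of v)" and ?w = "L M (frag_of w)"
        have vw: "?v \<in> carrier B" "?w \<in> carrier B" using that by (simp_all add: Lc)
        have "L M (frag_of u - frag_of v - frag_of w) = (?w \<otimes>\<^bsub>B\<^esub> ?v) \<otimes>\<^bsub>B\<^esub> inv\<^bsub>B\<^esub> ?v \<otimes>\<^bsub>B\<^esub> inv\<^bsub>B\<^esub> ?w"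
          using that vw by (simp add: Ldiff keysd eq B.m_comm[OF vw])
        then show ?thesis using vw by (simp add: B.m_assoc)
      qed
      have p1: "\<not> p dvd 1" using p not_prime_unit[of p] by blast
      have rel: "\<exists>m. \<not> p dvd m \<and> (\<forall>M. m dvd M \<longrightarrow> L M u = \<one>\<^bsub>B\<^esub>)" if u: "u \<in> ?RB" for u
        using u B.is_group Z.is_group
      proof (induction rule: tensor_rels_induct)
        case zero
        have "L M (0 :: ('c \<times> rat) \<Rightarrow>\<^sub>0 int) = \<one>\<^bsub>B\<^esub>" for M using L.hom_one[of M] by simp
        then show ?case using p1 by blast
      next
        case (left a a' z)
        have "L M (frag_of (a \<otimes>\<^bsub>B\<^esub> a', z) - frag_of (a, z) - frag_of (a', z)) = \<one>\<^bsub>B\<^esub>" for M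
          by (rule Lrel) (use left in \<open>auto simp: Lof B.int_pow_mult_distrib B.m_comm\<close>)
        then show ?case using p1 by blast
      next
        case (right a z z')
        obtain m where m: "\<not> p dvd m" "\<And>n. m dvd n \<Longrightarrow> of_nat n * z \<in> \<int>"
          using int_localized_denominator[OF right(2)] by blast
        have "L M (frag_of (a, z \<otimes>\<^bsub>?Z\<^esub> z') - frag_of (a, z) - frag_of (a, z')) = \<one>\<^bsub>B\<^esub>" if M: "m dvd M" for M
        proof -
          obtain k where k: "of_nat M * z = of_int k" using m(2)[OF M] Ints_cases by blast
          have "of_nat M * (z \<otimes>\<^bsub>?Z\<^esub> z') = of_int k + of_nat M * z'"
            by (simp add: distrib_left k)
          then have "\<lfloor>of_nat M * (z \<otimes>\<^bsub>?Z\<^esub> z')\<rfloor> = \<lfloor>of_nat M * z\<rfloor> + \<lfloor>of_nat M * z'\<rfloor>"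
            unfolding k by simp
          moreover have "z \<otimes>\<^bsub>?Z\<^esub> z' \<in> carrier ?Z" using right by (rule_tac Z.m_closed)
          ultimately show ?thesis
            by (intro Lrel) (use right in \<open>auto simp: Lof B.int_pow_mult simp del: mult_int_localized\<close>)
        qed
        then show ?case using m(1) by blast
      next
        case (add x y)
        then obtain m1 m2 where m: "\<not> p dvd m1" "\<not> p dvd m2"
          "\<And>M. m1 dvd M \<Longrightarrow> L M x = \<one>\<^bsub>B\<^esub>" "\<And>M. m2 dvd M \<Longrightarrow> L M y = \<one>\<^bsub>B\<^esub>" by blast
        have "L M (x + y) = \<one>\<^bsub>B\<^esub>" if "m1 * m2 dvd M" for M
        proof -
          have "m1 dvd M" "m2 dvd M" using that by (metis dvd_mult_left dvd_mult_right)+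
          then show ?thesis using Ladd[OF keysB keysB, OF add.hyps] m by simp
        qed
        moreover have "\<not> p dvd m1 * m2" using m p by (simp add: prime_dvd_mult_iff)
        ultimately show ?case by blast
      next
        case (minus x)
        then show ?case using Lneg[OF keysB[OF minus.hyps]] by auto
      qed
      have one: "1 \<in> carrier ?Z" using int_localized_of_int[OF p, of 1] by simp
      have "frag_of (b, 1) \<in> carrier ?FB" using b one by simp
      then obtain x where x: "x \<in> carrier ?FA" and r: "frag_of (b, 1) - F x \<in> ?RB"
        using \<open>?lhs\<close> surj by blast
      obtain m where m: "\<not> p dvd m" "L m (frag_of (b, 1) - F x) = \<one>\<^bsub>B\<^esub>"
        using rel[OF r] dvd_refl by metis
      have Fx: "Poly_Mapping.keys (F x) \<subseteq> carrier B \<times> carrier ?Z" using Fkeys x by simp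
      have "L m (frag_of (b, 1)) = L m (F x)"
      proof -
        have b1: "Poly_Mapping.keys (frag_of (b, 1)) \<subseteq> carrier B \<times> carrier ?Z" using b one by simp
        have "L m (frag_of (b, 1)) \<otimes>\<^bsub>B\<^esub> inv\<^bsub>B\<^esub> L m (F x) = \<one>\<^bsub>B\<^esub>"
          using m(2) unfolding Ldiff[OF b1 Fx] .
        from B.inv_equality[OF this] show ?thesis using Lc[OF Fx] Lc[OF b1] by simp
      qed
      moreover have "L m (frag_of (b, 1)) = b [^]\<^bsub>B\<^esub> m"
        using b one by (simp add: Lof int_pow_int)
      moreover have "L m (F x) \<in> f ` carrier A"
      proof -
        have img: "subgroup (f ` carrier A) B"
          using group_hom.img_is_subgroup[of A B f] f A.is_group B.is_group
          by (simp add: group_hom_def group_hom_axioms_def)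
        have "Poly_Mapping.keys x \<subseteq> carrier A \<times> carrier ?Z" using x by simp
        then show ?thesis
        proof (induction x rule: free_Abelian_group_induct[consumes 1, case_names zero diff gen])
          case zero
          show ?case using subgroup.one_closed[OF img] L.hom_one[of m] by (simp add: F_def)
        next
          case (diff x y)
          then have "L m (F (x - y)) = L m (F x) \<otimes>\<^bsub>B\<^esub> inv\<^bsub>B\<^esub> L m (F y)"
            using Ldiff[OF Fkeys Fkeys] by (simp add: F_def frag_extend_diff)
          then show ?case
            using diff by (simp add: img subgroup.m_closed subgroup.m_inv_closed)
        next
          case (gen a)
          obtain c z where a: "a = (c, z)" "c \<in> carrier A" "z \<in> carrier ?Z" using gen by auto
          have "L m (F (frag_of a)) = f c [^]\<^bsub>B\<^esub> \<lfloor>of_nat m * z\<rfloor>"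
            using a by (simp add: F_def Lof fc)
          also have "\<dots> \<in> f ` carrier A"
            using a by (intro B.subgroup_int_pow_closed[OF img]) auto
          finally show ?case .
        qed
      qed
      ultimately show "\<exists>n. \<not> p dvd n \<and> b [^]\<^bsub>B\<^esub> n \<in> f ` carrier A" using m(1) by metis
    qed
  next
    assume rhs: ?rhs
    have "\<exists>x\<in>carrier ?FA. y - F x \<in> ?RB" if "y \<in> carrier ?FB" for y
    proof -
      have "Poly_Mapping.keys y \<subseteq> carrier B \<times> carrier ?Z" using that by simp
      then show ?thesis
      proof (induction y rule: free_Abelian_group_induct[consumes 1, case_names zero diff gen])
        case zero
        show ?case using \<open>0 \<in> ?RB\<close> by (intro bexI[of _ 0]) (auto simp: F_def)
      next
        case (diff x y)
        then obtain u v where uv: "u \<in> carrier ?FA" "v \<in> carrier ?FA" "x - F u \<in> ?RB" "y - F v \<in> ?RB"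
          by auto
        have "(x - y) - F (u - v) = (x - F u) + - (y - F v)" by (simp add: F_def frag_extend_diff)
        then have "(x - y) - F (u - v) \<in> ?RB" using uv \<open>\<And>u v. u \<in> ?RB \<Longrightarrow> v \<in> ?RB \<Longrightarrow> u + v \<in> ?RB\<close> neg by metis
        moreover have "u - v \<in> carrier ?FA" using uv keys_diff[of u v] by auto
        ultimately show ?case by blast
      next
        case (gen c)
        then obtain b z where c: "c = (b, z)" "b \<in> carrier B" "z \<in> carrier ?Z" by auto
        obtain n a where n: "\<not> p dvd n" "a \<in> carrier A" "b [^]\<^bsub>B\<^esub> n = f a" using rhs c(2) by blast
        obtain w where w: "w \<in> carrier ?Z" "z = of_nat n * w"
          using int_localized_scale[OF p c(3) n(1)] .
        have "frag_of (b [^]\<^bsub>B\<^esub> n, w) - frag_of (b, w [^]\<^bsub>?Z\<^esub> n) \<in> ?RB"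
          by (rule tensor_pow) (use c w in \<open>unfold_locales, auto\<close>)
        then have "- (frag_of (f a, w) - frag_of (b, z)) \<in> ?RB"
          using n w by (intro neg) (simp add: int_localized_pow)
        then have "frag_of c - F (frag_of (a, w)) \<in> ?RB" using c by (simp add: F_def)
        then show ?case using n w by (intro bexI[of _ "frag_of (a, w)"]) auto
      qed
    qed
    then show ?lhs using surj by blast
  qed
qed

section \<open>Finite G-sets\<close>

locale gset_theory = group G for G :: "('a, 'b) monoid_scheme" (structure)
begin

lemma gset_action:
  assumes "is_gset G S"
  shows gset_closed: "g \<in> carrier G \<Longrightarrow> x \<in> fst S \<Longrightarrow> snd S g x \<in> fst S"
    and gset_one: "x \<in> fst S \<Longrightarrow> snd S \<one> x = x"
    and gset_mult: "g \<in> carrier G \<Longrightarrow> h \<in> carrier G \<Longrightarrow> x \<in> fst S \<Longrightarrow> snd S (g \<otimes> h) x = snd S g (snd S h x)"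
    and gset_finite: "finite (fst S)"
proof -
  interpret A: group_action G "fst S" "snd S" using assms by (simp add: is_gset_def)
  show "g \<in> carrier G \<Longrightarrow> x \<in> fst S \<Longrightarrow> snd S g x \<in> fst S" by (rule A.element_image) simp_all
  show "x \<in> fst S \<Longrightarrow> snd S \<one> x = x" by (metis A.id_eq_one restrict_apply')
  show "g \<in> carrier G \<Longrightarrow> h \<in> carrier G \<Longrightarrow> x \<in> fst S \<Longrightarrow> snd S (g \<otimes> h) x = snd S g (snd S h x)"
    by (rule A.composition_rule)
  show "finite (fst S)" using assms by (simp add: is_gset_def)
qed

lemma gset_inv:
  assumes "is_gset G S" "g \<in> carrier G" "x \<in> fst S"
  shows "snd S (inv g) (snd S g x) = x" "snd S g (snd S (inv g) x) = x"
  using gset_mult[OF assms(1), of "inv g" g x] gset_mult[OF assms(1), of g "inv g" x] assms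
  by (simp_all add: gset_one)

text \<open>\<^const>\<open>is_gset\<close> asks for extensional actions; this is the extensional action given by an arbitrary function.\<close>

definition gset_of :: "'v set \<Rightarrow> ('a \<Rightarrow> 'v \<Rightarrow> 'v) \<Rightarrow> ('a, 'v) gset" where
  "gset_of A act = (A, \<lambda>g\<in>carrier G. \<lambda>x\<in>A. act g x)"

lemma fst_gset_of [simp]: "fst (gset_of A act) = A"
  and snd_gset_of [simp]: "g \<in> carrier G \<Longrightarrow> x \<in> A \<Longrightarrow> snd (gset_of A act) g x = act g x"
  by (simp_all add: gset_of_def)

lemma is_gset_of:
  assumes fin: "finite A"
    and cl: "\<And>g x. g \<in> carrier G \<Longrightarrow> x \<in> A \<Longrightarrow> act g x \<in> A"
    and one: "\<And>x. x \<in> A \<Longrightarrow> act \<one> x = x"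
    and mult: "\<And>g h x. g \<in> carrier G \<Longrightarrow> h \<in> carrier G \<Longrightarrow> x \<in> A \<Longrightarrow> act (g \<otimes> h) x = act g (act h x)"
  shows "is_gset G (gset_of A act)"
proof -
  let ?\<phi> = "\<lambda>g\<in>carrier G. \<lambda>x\<in>A. act g x"
  have bij: "?\<phi> g \<in> Bij A" if g: "g \<in> carrier G" for g
  proof -
    have "act (inv g) (act g x) = x" "act g (act (inv g) x) = x" if "x \<in> A" for x
      using mult[of "inv g" g x] mult[of g "inv g" x] g that one by simp_all
    then have "bij_betw (\<lambda>x\<in>A. act g x) A A"
      by (intro bij_betw_byWitness[where f' = "act (inv g)"]) (use g cl in auto)
    then show ?thesis using g by (simp add: Bij_def)
  qed
  have "?\<phi> \<in> hom G (BijGroup A)"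
  proof (rule homI)
    fix g h assume gh: "g \<in> carrier G" "h \<in> carrier G"
    have "(\<lambda>x\<in>A. act (g \<otimes> h) x) = compose A (\<lambda>x\<in>A. act g x) (\<lambda>x\<in>A. act h x)"
      by (rule ext) (simp add: compose_def restrict_def gh mult cl)
    then show "?\<phi> (g \<otimes> h) = ?\<phi> g \<otimes>\<^bsub>BijGroup A\<^esub> ?\<phi> h"
      using gh bij[OF gh(1)] bij[OF gh(2)] by (simp add: BijGroup_def)
  qed (use bij in \<open>simp add: BijGroup_def\<close>)
  then have "group_action G A ?\<phi>"
    by (simp add: group_action_def group_hom_def group_hom_axioms_def is_group group_BijGroup)
  then show ?thesis using fin by (simp add: is_gset_def gset_of_def)
qed

lemma gmapsD:
  assumes "f \<in> gmaps G S T"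
  shows "x \<in> fst S \<Longrightarrow> f x \<in> fst T" "f \<in> extensional (fst S)"
    "g \<in> carrier G \<Longrightarrow> x \<in> fst S \<Longrightarrow> f (snd S g x) = snd T g (f x)"
  using assms by (auto simp: gmaps_def PiE_def)

lemma restrict_gmaps:
  assumes "\<And>x. x \<in> fst S \<Longrightarrow> f x \<in> fst T" "is_gset G S"
    "\<And>g x. g \<in> carrier G \<Longrightarrow> x \<in> fst S \<Longrightarrow> f (snd S g x) = snd T g (f x)"
  shows "restrict f (fst S) \<in> gmaps G S T"
  using assms gset_closed[OF assms(2)] by (auto simp: gmaps_def)

lemma gmaps_id: "is_gset G S \<Longrightarrow> (\<lambda>x\<in>fst S. x) \<in> gmaps G S S"
  by (rule restrict_gmaps) auto

lemma gmaps_compose: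
  assumes "f \<in> gmaps G S T" "g \<in> gmaps G T U" "is_gset G S"
  shows "compose (fst S) g f \<in> gmaps G S U"
  unfolding compose_def by (rule restrict_gmaps) (use assms gmapsD in metis)+

lemma gmaps_inv:
  assumes h: "h \<in> gmaps G X Y" and X: "is_gset G X" and Y: "is_gset G Y" and b: "bij_betw h (fst X) (fst Y)"
  shows "restrict (inv_into (fst X) h) (fst Y) \<in> gmaps G Y X"
proof (rule restrict_gmaps[OF _ Y])
  show "inv_into (fst X) h y \<in> fst X" if "y \<in> fst Y" for y
    using b that by (metis bij_betw_def inv_into_into)
  fix g y assume g: "g \<in> carrier G" and y: "y \<in> fst Y"
  then obtain x where x: "x \<in> fst X" "y = h x" using b by (auto simp: bij_betw_def)
  have "inv_into (fst X) h (h x') = x'" if "x' \<in> fst X" for x'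
    using b that by (metis bij_betw_inv_into_left)
  then show "inv_into (fst X) h (snd Y g y) = snd X g (inv_into (fst X) h y)"
    using x g gmapsD(3)[OF h g x(1)] gset_closed[OF X g x(1)] by metis
qed

definition fixed_by :: "('a, 'v) gset \<Rightarrow> 'a set \<Rightarrow> 'v \<Rightarrow> bool" where
  "fixed_by X H x \<longleftrightarrow> (\<forall>h\<in>H \<inter> carrier G. snd X h x = x)"

lemma fixed_by_image: "f \<in> gmaps G X Y \<Longrightarrow> x \<in> fst X \<Longrightarrow> fixed_by X H x \<Longrightarrow> fixed_by Y H (f x)"
  unfolding fixed_by_def using gmapsD(3) by fastforce

text \<open>These numbers are the marks of a \<open>G\<close>-set over a base. The second argument may be any set and elements outside
  \<open>G\<close> are ignored, so that equalities of marks are plain equalities of functions, free of side conditions.\<close>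

definition marks :: "('a, 'v) gset \<Rightarrow> ('v \<Rightarrow> 'w) \<Rightarrow> 'a set \<Rightarrow> 'w \<Rightarrow> nat" where
  "marks X f H s = card {x \<in> fst X. f x = s \<and> fixed_by X H x}"

lemma marks_bij:
  assumes b: "bij_betw h (fst X) (fst Y)"
    and "\<And>x. x \<in> fst X \<Longrightarrow> g (h x) = f x"
    and "\<And>x. x \<in> fst X \<Longrightarrow> fixed_by Y H (h x) \<longleftrightarrow> fixed_by X H x"
  shows "marks X f H s = marks Y g H s"
proof -
  have "bij_betw h {x \<in> fst X. f x = s \<and> fixed_by X H x} {y \<in> fst Y. g y = s \<and> fixed_by Y H y}"
    unfolding bij_betw_def
  proof
    show "inj_on h {x \<in> fst X. f x = s \<and> fixed_by X H x}"
      using b by (auto simp: bij_betw_def intro: inj_on_subset)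
    show "h ` {x \<in> fst X. f x = s \<and> fixed_by X H x} = {y \<in> fst Y. g y = s \<and> fixed_by Y H y}"
      unfolding bij_betw_imp_surj_on[OF b, symmetric] by (auto simp: assms(2,3))
  qed
  then show ?thesis unfolding marks_def by (rule bij_betw_same_card)
qed

lemma fixed_by_inj:
  assumes "h \<in> gmaps G X Y" "inj_on h (fst X)" "is_gset G X" "x \<in> fst X"
  shows "fixed_by Y H (h x) \<longleftrightarrow> fixed_by X H x"
  unfolding fixed_by_def using assms gmapsD[OF assms(1)] gset_closed[OF assms(3)]
  by (metis Int_iff inj_on_eq_iff)

lemma marks_iso:
  assumes "h \<in> gmaps G X Y" "bij_betw h (fst X) (fst Y)" "is_gset G X"
    and "\<And>x. x \<in> fst X \<Longrightarrow> g (h x) = f x"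
  shows "marks X f = marks Y g"
proof (intro ext)
  fix H s
  show "marks X f H s = marks Y g H s"
    using assms(2,4) fixed_by_inj[OF assms(1) _ assms(3)] bij_betw_imp_inj_on[OF assms(2)]
    by (intro marks_bij) blast+
qed

subsection \<open>Invariant subsets and orbits\<close>

definition sub_gset :: "('a, 'v) gset \<Rightarrow> 'v set \<Rightarrow> ('a, 'v) gset" where
  "sub_gset X A = gset_of A (snd X)"

lemma is_gset_sub:
  assumes "is_gset G X" "A \<subseteq> fst X" "\<And>g x. g \<in> carrier G \<Longrightarrow> x \<in> A \<Longrightarrow> snd X g x \<in> A"
  shows "is_gset G (sub_gset X A)"
  unfolding sub_gset_def
proof (rule is_gset_of)
  show "finite A" using assms gset_finite finite_subset by blast
qed (use assms gset_one[OF assms(1)] gset_mult[OF assms(1)] in auto)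

lemma fixed_by_sub: "x \<in> A \<Longrightarrow> fixed_by (sub_gset X A) H x \<longleftrightarrow> fixed_by X H x"
  by (auto simp: fixed_by_def sub_gset_def)

lemma marks_split:
  assumes "is_gset G X" "A \<subseteq> fst X"
  shows "marks X f H s = marks (sub_gset X A) f H s + marks (sub_gset X (fst X - A)) f H s"
proof -
  have "{x \<in> fst X. f x = s \<and> fixed_by X H x} =
    {x \<in> A. f x = s \<and> fixed_by X H x} \<union> {x \<in> fst X - A. f x = s \<and> fixed_by X H x}"
    using assms by auto
  moreover have "card \<dots> = card {x \<in> A. f x = s \<and> fixed_by X H x} + card {x \<in> fst X - A. f x = s \<and> fixed_by X H x}"
    using gset_finite[OF assms(1)] assms(2) by (intro card_Un_disjoint) (auto intro: finite_subset)
  moreover have "{x \<in> A. f x = s \<and> fixed_by X H x} = {x \<in> A. f x = s \<and> fixed_by (sub_gset X A) H x}"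
    "{x \<in> fst X - A. f x = s \<and> fixed_by X H x} = {x \<in> fst X - A. f x = s \<and> fixed_by (sub_gset X (fst X - A)) H x}"
    by (auto simp: fixed_by_sub)
  ultimately show ?thesis unfolding marks_def by (simp add: sub_gset_def)
qed

definition gorbit :: "('a, 'v) gset \<Rightarrow> 'v \<Rightarrow> 'v set" where
  "gorbit X x = (\<lambda>g. snd X g x) ` carrier G"

lemma gorbit_invariant:
  assumes X: "is_gset G X" and x: "x \<in> fst X"
  shows "gorbit X x \<subseteq> fst X" "x \<in> gorbit X x"
    "g \<in> carrier G \<Longrightarrow> u \<in> gorbit X x \<Longrightarrow> snd X g u \<in> gorbit X x"
    "g \<in> carrier G \<Longrightarrow> u \<in> fst X - gorbit X x \<Longrightarrow> snd X g u \<in> fst X - gorbit X x"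
proof -
  show "gorbit X x \<subseteq> fst X" unfolding gorbit_def using gset_closed[OF X _ x] by auto
  show "x \<in> gorbit X x" unfolding gorbit_def using gset_one[OF X x] by (metis image_eqI one_closed)
  show *: "g \<in> carrier G \<Longrightarrow> u \<in> gorbit X x \<Longrightarrow> snd X g u \<in> gorbit X x" for g u
    unfolding gorbit_def by (auto simp: gset_mult[OF X _ _ x, symmetric])
  show "g \<in> carrier G \<Longrightarrow> u \<in> fst X - gorbit X x \<Longrightarrow> snd X g u \<in> fst X - gorbit X x"
    using *[of "inv g" "snd X g u"] gset_inv(1)[OF X, of g u] gset_closed[OF X, of g u] by auto
qed

lemma orbit_map:
  assumes X: "is_gset G X" and Y: "is_gset G Y" and x: "x \<in> fst X" and y: "y \<in> fst Y"
    and stab: "\<And>g. g \<in> carrier G \<Longrightarrow> snd X g x = x \<Longrightarrow> snd Y g y = y"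
  obtains h where "\<And>g. g \<in> carrier G \<Longrightarrow> h (snd X g x) = snd Y g y"
proof -
  define h where "h u = snd Y (SOME g. g \<in> carrier G \<and> u = snd X g x) y" for u
  have "h (snd X b x) = snd Y b y" if b: "b \<in> carrier G" for b
  proof -
    have "\<exists>a. a \<in> carrier G \<and> snd X b x = snd X a x" using b by blast
    from someI_ex[OF this] obtain a where a: "a \<in> carrier G" "snd X b x = snd X a x"
      and h: "h (snd X b x) = snd Y a y" unfolding h_def by blast
    have "snd X (inv b \<otimes> a) x = x"
      using gset_mult[OF X _ a(1) x, of "inv b"] gset_inv(1)[OF X b x] a(2) b by simp
    then have "snd Y (inv b \<otimes> a) y = y" using stab a(1) b by simp
    then have "snd Y b (snd Y (inv b) (snd Y a y)) = snd Y b y"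
      using gset_mult[OF Y _ a(1) y, of "inv b"] b by simp
    then show ?thesis using gset_inv(2)[OF Y b gset_closed[OF Y a(1) y]] h by simp
  qed
  then show thesis by (rule that)
qed

lemma orbit_iso:
  assumes X: "is_gset G X" and Y: "is_gset G Y" and x: "x \<in> fst X" and y: "y \<in> fst Y"
    and stab: "\<And>g. g \<in> carrier G \<Longrightarrow> snd X g x = x \<longleftrightarrow> snd Y g y = y"
  obtains h where "\<And>g. g \<in> carrier G \<Longrightarrow> h (snd X g x) = snd Y g y" "bij_betw h (gorbit X x) (gorbit Y y)"
proof -
  obtain h where h: "\<And>g. g \<in> carrier G \<Longrightarrow> h (snd X g x) = snd Y g y"
    using orbit_map[OF X Y x y] stab by blast
  obtain k where k: "\<And>g. g \<in> carrier G \<Longrightarrow> k (snd Y g y) = snd X g x"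
    using orbit_map[OF Y X y x] stab by blast
  have "bij_betw h (gorbit X x) (gorbit Y y)"
    by (rule bij_betw_byWitness[where f' = k]) (auto simp: gorbit_def h k)
  with h show thesis by (rule that)
qed

end

context gset_theory
begin

subsection \<open>Marks determine a G-set over a base\<close>

lemma marks_pos_iff:
  assumes "is_gset G X"
  shows "0 < marks X f H s \<longleftrightarrow> (\<exists>x\<in>fst X. f x = s \<and> fixed_by X H x)"
  unfolding marks_def using gset_finite[OF assms] by (auto simp: card_gt_0_iff)

text \<open>Burnside's theorem. Take a point \<open>x\<close> of \<open>X\<close> with the largest stabilizer. Comparing marks at this stabilizer gives a
  point \<open>y\<close> of \<open>Y\<close> over the same base point and fixed by at least as much; comparing marks at the stabilizer of \<open>y\<close>
  leads back to \<open>X\<close>, where maximality forces the two stabilizers to agree. The orbits of \<open>x\<close> and \<open>y\<close> are then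
  isomorphic over the base. Removing them leaves equal marks, and induction applies.\<close>

theorem marks_determine:
  fixes X :: "('a, 'v) gset" and Y :: "('a, 'w) gset"
  assumes finite_carrier: "finite (carrier G)"
    and "is_gset G X" "is_gset G Y"
    and "\<And>a x. a \<in> carrier G \<Longrightarrow> x \<in> fst X \<Longrightarrow> f (snd X a x) = act a (f x)"
    and "\<And>a y. a \<in> carrier G \<Longrightarrow> y \<in> fst Y \<Longrightarrow> g (snd Y a y) = act a (g y)"
    and "\<And>H s. marks X f H s = marks Y g H s"
  shows "\<exists>h\<in>gmaps G X Y. bij_betw h (fst X) (fst Y) \<and> (\<forall>x\<in>fst X. g (h x) = f x)"
  using assms(2-)
proof (induction "card (fst X)" arbitrary: X Y rule: less_induct)
  case less
  note X = less.prems(1) and Y = less.prems(2) and f = less.prems(3) and g = less.prems(4)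
    and marks = less.prems(5)
  show ?case
  proof (cases "fst X = {}")
    case True
    have "fst Y = {}"
    proof (rule ccontr)
      assume "fst Y \<noteq> {}"
      then obtain y where "y \<in> fst Y" by blast
      then have "0 < marks Y g {} (g y)" unfolding marks_pos_iff[OF Y] by (auto simp: fixed_by_def)
      then have "0 < marks X f {} (g y)" using marks by simp
      then show False unfolding marks_pos_iff[OF X] using True by simp
    qed
    then show ?thesis using True
      by (intro bexI[of _ "\<lambda>x. undefined"]) (auto simp: gmaps_def bij_betw_def)
  next
    case False
    define stab where "stab x = {a \<in> carrier G. snd X a x = x}" for x
    define stab' where "stab' y = {a \<in> carrier G. snd Y a y = y}" for y
    have finX: "finite (fst X)" by (rule gset_finite[OF X])
    have "Max ((\<lambda>x. card (stab x)) ` fst X) \<in> (\<lambda>x. card (stab x)) ` fst X"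
      using finX False by (intro Max_in) auto
    then obtain x where x: "x \<in> fst X" and "Max ((\<lambda>x. card (stab x)) ` fst X) = card (stab x)" by auto
    then have max: "card (stab u) \<le> card (stab x)" if "u \<in> fst X" for u
      using that finX by (metis (no_types, lifting) Max_ge finite_imageI image_eqI)
    have "0 < marks X f (stab x) (f x)"
      unfolding marks_pos_iff[OF X] using x by (auto simp: fixed_by_def stab_def)
    then have "0 < marks Y g (stab x) (f x)" using marks by simp
    then obtain y where y: "y \<in> fst Y" "g y = f x" and "fixed_by Y (stab x) y"
      unfolding marks_pos_iff[OF Y] by blast
    then have sub1: "stab x \<subseteq> stab' y" by (auto simp: fixed_by_def stab_def stab'_def)
    have "0 < marks Y g (stab' y) (f x)"
      unfolding marks_pos_iff[OF Y] using y by (auto simp: fixed_by_def stab'_def)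
    then have "0 < marks X f (stab' y) (f x)" using marks by simp
    then obtain u where u: "u \<in> fst X" and "fixed_by X (stab' y) u"
      unfolding marks_pos_iff[OF X] by blast
    then have sub2: "stab' y \<subseteq> stab u" by (auto simp: fixed_by_def stab_def stab'_def)
    have fin: "finite (stab u)" using finite_carrier by (simp add: stab_def)
    have "stab x = stab u" using card_seteq[OF fin] sub1 sub2 max[OF u] by blast
    then have stabeq: "stab x = stab' y" using sub1 sub2 by blast
    obtain h0 where h0: "\<And>a. a \<in> carrier G \<Longrightarrow> h0 (snd X a x) = snd Y a y"
      and bij0: "bij_betw h0 (gorbit X x) (gorbit Y y)"
      using orbit_iso[OF X Y x y(1)] stabeq unfolding stab_def stab'_def by blast
    let ?O = "gorbit X x" and ?P = "gorbit Y y"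
    note O = gorbit_invariant[OF X x] and P = gorbit_invariant[OF Y y(1)]
    have h0g: "g (h0 v) = f v" if "v \<in> ?O" for v
      using that h0 f[OF _ x] g[OF _ y(1)] y(2) by (auto simp: gorbit_def)
    have h0e: "h0 (snd X a v) = snd Y a (h0 v)" if "v \<in> ?O" "a \<in> carrier G" for v a
    proof -
      obtain b where b: "b \<in> carrier G" "v = snd X b x" using \<open>v \<in> ?O\<close> by (auto simp: gorbit_def)
      then have "h0 (snd X a v) = h0 (snd X (a \<otimes> b) x)" using gset_mult[OF X _ _ x] that by simp
      then show ?thesis using b that h0 gset_mult[OF Y _ _ y(1)] by simp
    qed
    let ?X0 = "sub_gset X ?O" and ?Y0 = "sub_gset Y ?P"
    let ?X1 = "sub_gset X (fst X - ?O)" and ?Y1 = "sub_gset Y (fst Y - ?P)"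
    have X0: "is_gset G ?X0" by (rule is_gset_sub[OF X O(1) O(3)])
    have X1: "is_gset G ?X1" by (rule is_gset_sub[OF X Diff_subset O(4)])
    have Y1: "is_gset G ?Y1" by (rule is_gset_sub[OF Y Diff_subset P(4)])
    have h0img: "h0 v \<in> ?P" if "v \<in> ?O" for v using bij0 that by (auto simp: bij_betw_def)
    have "restrict h0 (fst ?X0) \<in> gmaps G ?X0 ?Y0"
      by (rule restrict_gmaps[OF _ X0]) (use h0img h0e in \<open>auto simp: sub_gset_def\<close>)
    moreover have "bij_betw (restrict h0 (fst ?X0)) (fst ?X0) (fst ?Y0)"
      using bij0 by (simp add: sub_gset_def)
    ultimately have "marks ?X0 f = marks ?Y0 g"
      by (rule marks_iso[OF _ _ X0]) (use h0g in \<open>auto simp: sub_gset_def\<close>)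
    then have "marks ?X1 f H s = marks ?Y1 g H s" for H s
      using marks[of H s] marks_split[OF X O(1), of f H s] marks_split[OF Y P(1), of g H s] by simp
    moreover have "card (fst ?X1) < card (fst X)"
      unfolding sub_gset_def fst_gset_of using finX O(2) x by (intro psubset_card_mono) auto
    moreover have "f (snd ?X1 a v) = act a (f v)" if "a \<in> carrier G" "v \<in> fst ?X1" for a v
      using f that by (simp add: sub_gset_def)
    moreover have "g (snd ?Y1 a v) = act a (g v)" if "a \<in> carrier G" "v \<in> fst ?Y1" for a v
      using g that by (simp add: sub_gset_def)
    ultimately obtain h1 where h1: "h1 \<in> gmaps G ?X1 ?Y1" "bij_betw h1 (fst ?X1) (fst ?Y1)"
      "\<And>v. v \<in> fst ?X1 \<Longrightarrow> g (h1 v) = f v"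
      using less.hyps[OF _ X1 Y1] by blast
    define h where "h v = (if v \<in> ?O then h0 v else h1 v)" for v
    have "bij_betw h ?O ?P" using bij0 by (rule bij_betw_cong[THEN iffD1, rotated]) (simp add: h_def)
    moreover have "bij_betw h (fst X - ?O) (fst Y - ?P)"
      using h1(2) unfolding sub_gset_def fst_gset_of
      by (rule bij_betw_cong[THEN iffD1, rotated]) (simp add: h_def)
    ultimately have "bij_betw h (?O \<union> (fst X - ?O)) (?P \<union> (fst Y - ?P))"
      by (rule bij_betw_combine) auto
    then have bij: "bij_betw h (fst X) (fst Y)"
      using O(1) P(1) by (simp add: Un_absorb1)
    have "restrict h (fst X) \<in> gmaps G X Y"
    proof (rule restrict_gmaps[OF _ X])
      show "h v \<in> fst Y" if "v \<in> fst X" for v using bij that by (auto simp: bij_betw_def)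
      fix a v assume a: "a \<in> carrier G" and v: "v \<in> fst X"
      show "h (snd X a v) = snd Y a (h v)"
      proof (cases "v \<in> ?O")
        case True
        then show ?thesis using O(3) h0e a by (simp add: h_def)
      next
        case False
        then have v1: "v \<in> fst ?X1" using v by (simp add: sub_gset_def)
        then have "h1 (snd X a v) = snd Y a (h1 v)"
          using gmapsD(3)[OF h1(1) a v1] gmapsD(1)[OF h1(1) v1] a by (simp add: sub_gset_def)
        then show ?thesis using O(4)[OF a, of v] False v by (simp add: h_def)
      qed
    qed
    moreover have "bij_betw (restrict h (fst X)) (fst X) (fst Y)" using bij by simp
    moreover have "g (restrict h (fst X) v) = f v" if "v \<in> fst X" for v
      using that h0g h1(3)[of v] by (simp add: h_def sub_gset_def)
    ultimately show ?thesis by blast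
  qed
qed

subsection \<open>Disjoint unions\<close>

lemma marks_disj_union:
  assumes U: "is_disj_union G Z X Y i j"
    and f: "\<And>x. x \<in> fst X \<Longrightarrow> h (i x) = f x" and g: "\<And>y. y \<in> fst Y \<Longrightarrow> h (j y) = g y"
  shows "marks Z h H s = marks X f H s + marks Y g H s"
proof -
  have Z: "is_gset G Z" and X: "is_gset G X" and Y: "is_gset G Y"
    and i: "i \<in> gmaps G X Z" "inj_on i (fst X)" and j: "j \<in> gmaps G Y Z" "inj_on j (fst Y)"
    and disj: "i ` fst X \<inter> j ` fst Y = {}" and cov: "i ` fst X \<union> j ` fst Y = fst Z"
    using U by (auto simp: is_disj_union_def)
  have "{z \<in> fst Z. h z = s \<and> fixed_by Z H z} =
    i ` {x \<in> fst X. f x = s \<and> fixed_by X H x} \<union> j ` {y \<in> fst Y. g y = s \<and> fixed_by Y H y}"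
    unfolding cov[symmetric]
    by (auto simp: f g fixed_by_inj[OF i X] fixed_by_inj[OF j Y])
  moreover have "card \<dots> = card (i ` {x \<in> fst X. f x = s \<and> fixed_by X H x}) + card (j ` {y \<in> fst Y. g y = s \<and> fixed_by Y H y})"
    using gset_finite[OF X] gset_finite[OF Y] disj by (intro card_Un_disjoint) auto
  moreover have "card (i ` {x \<in> fst X. f x = s \<and> fixed_by X H x}) = card {x \<in> fst X. f x = s \<and> fixed_by X H x}"
    by (rule card_image) (rule inj_on_subset[OF i(2)], auto)
  moreover have "card (j ` {x \<in> fst Y. g x = s \<and> fixed_by Y H x}) = card {x \<in> fst Y. g x = s \<and> fixed_by Y H x}"
    by (rule card_image) (rule inj_on_subset[OF j(2)], auto)
  ultimately show ?thesis by (simp add: marks_def)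
qed

lemma disj_union_iso:
  assumes "is_disj_union G Z X Y i j" "k \<in> gmaps G Z W" "bij_betw k (fst Z) (fst W)" "is_gset G W"
  shows "is_disj_union G W X Y (compose (fst X) k i) (compose (fst Y) k j)"
proof -
  have Z: "is_gset G Z" and X: "is_gset G X" and Y: "is_gset G Y"
    and i: "i \<in> gmaps G X Z" "inj_on i (fst X)" and j: "j \<in> gmaps G Y Z" "inj_on j (fst Y)"
    and disj: "i ` fst X \<inter> j ` fst Y = {}" and cov: "i ` fst X \<union> j ` fst Y = fst Z"
    using assms(1) by (auto simp: is_disj_union_def)
  have k: "inj_on k (fst Z)" "k ` fst Z = fst W" using assms(3) by (auto simp: bij_betw_def)
  have ii: "i ` fst X \<subseteq> fst Z" and jj: "j ` fst Y \<subseteq> fst Z" using cov by auto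
  have imi: "compose (fst X) k i ` fst X = k ` i ` fst X" and imj: "compose (fst Y) k j ` fst Y = k ` j ` fst Y"
    by (auto simp: compose_def image_def)
  have "inj_on (compose (fst X) k i) (fst X)"
    using comp_inj_on[OF i(2) inj_on_subset[OF k(1) ii]] by (simp add: inj_on_def compose_def)
  moreover have "inj_on (compose (fst Y) k j) (fst Y)"
    using comp_inj_on[OF j(2) inj_on_subset[OF k(1) jj]] by (simp add: inj_on_def compose_def)
  moreover have "k ` i ` fst X \<inter> k ` j ` fst Y = {}"
    using inj_on_image_Int[OF k(1) ii jj] disj by simp
  moreover have "k ` i ` fst X \<union> k ` j ` fst Y = fst W" using k(2) cov by (metis image_Un)
  ultimately show ?thesis unfolding is_disj_union_def imi imj
    using assms(4) X Y gmaps_compose[OF i(1) assms(2) X] gmaps_compose[OF j(1) assms(2) Y] by simp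
qed

subsection \<open>Pullbacks\<close>

lemma fixed_by_pullback:
  assumes "is_pullback G Z X Y T p q f g" "z \<in> fst Z"
  shows "fixed_by Z H z \<longleftrightarrow> fixed_by X H (p z) \<and> fixed_by Y H (q z)"
proof -
  have Z: "is_gset G Z" and p: "p \<in> gmaps G Z X" and q: "q \<in> gmaps G Z Y"
    and inj: "inj_on (\<lambda>s. (p s, q s)) (fst Z)"
    using assms(1) by (auto simp: is_pullback_def bij_betw_def)
  have "snd Z h z = z \<longleftrightarrow> snd X h (p z) = p z \<and> snd Y h (q z) = q z" if h: "h \<in> carrier G" for h
    using inj_on_eq_iff[OF inj gset_closed[OF Z h assms(2)] assms(2)]
      gmapsD(3)[OF p h assms(2)] gmapsD(3)[OF q h assms(2)] by simp
  then show ?thesis unfolding fixed_by_def by blast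
qed

text \<open>The part of the pullback lying over \<open>s\<close> and fixed by \<open>H\<close> is the part of \<open>Y\<close> lying over \<open>f s\<close> and fixed by \<open>H\<close>,
  provided that \<open>H\<close> fixes \<open>s\<close>.\<close>

lemma marks_pullback:
  assumes P: "is_pullback G Z X Y T p q f g"
  shows "marks Z p H s = (if s \<in> fst X \<and> fixed_by X H s then marks Y g H (f s) else 0)"
proof -
  have p: "p \<in> gmaps G Z X" and q: "q \<in> gmaps G Z Y"
    and inj: "inj_on (\<lambda>z. (p z, q z)) (fst Z)"
    and img: "(\<lambda>z. (p z, q z)) ` fst Z = {(a, b). a \<in> fst X \<and> b \<in> fst Y \<and> f a = g b}"
    using P by (auto simp: is_pullback_def bij_betw_def)
  note fixZ = fixed_by_pullback[OF P]
  show ?thesis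
  proof (cases "s \<in> fst X \<and> fixed_by X H s")
    case True
    have "bij_betw q {z \<in> fst Z. p z = s \<and> fixed_by Z H z} {y \<in> fst Y. g y = f s \<and> fixed_by Y H y}"
      unfolding bij_betw_def
    proof
      show "inj_on q {z \<in> fst Z. p z = s \<and> fixed_by Z H z}"
        using inj by (auto simp: inj_on_def)
      show "q ` {z \<in> fst Z. p z = s \<and> fixed_by Z H z} = {y \<in> fst Y. g y = f s \<and> fixed_by Y H y}" (is "?L = ?R")
      proof
        show "?L \<subseteq> ?R"
        proof
          fix y assume "y \<in> ?L"
          then obtain z where z: "z \<in> fst Z" "p z = s" "fixed_by Z H z" "y = q z" by auto
          have "(p z, q z) \<in> {(a, b). a \<in> fst X \<and> b \<in> fst Y \<and> f a = g b}"
            unfolding img[symmetric] using z(1) by (rule imageI)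
          then show "y \<in> ?R" using z fixZ[OF z(1)] by auto
        qed
        show "?R \<subseteq> ?L"
        proof
          fix y assume y: "y \<in> ?R"
          then have "(s, y) \<in> (\<lambda>z. (p z, q z)) ` fst Z" unfolding img using True by auto
          then obtain z where z: "z \<in> fst Z" "p z = s" "q z = y" by auto
          then have "fixed_by Z H z" using fixZ[OF z(1)] True y by auto
          then show "y \<in> ?L" using z by auto
        qed
      qed
    qed
    then show ?thesis using True unfolding marks_def by (simp add: bij_betw_same_card)
  next
    case False
    have "{z \<in> fst Z. p z = s \<and> fixed_by Z H z} = {}"
      using False fixZ gmapsD(1)[OF p] by blast
    then have "marks Z p H s = 0" unfolding marks_def by (simp only: card.empty)
    then show ?thesis by (simp only: False if_False)
  qed
qed

lemma pullback_sym:
  assumes "is_pullback G Z X Y T p q f g"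
  shows "is_pullback G Z Y X T q p g f"
proof -
  have b: "bij_betw (\<lambda>s. (p s, q s)) (fst Z) {(a, b). a \<in> fst X \<and> b \<in> fst Y \<and> f a = g b}"
    using assms by (simp add: is_pullback_def)
  have "bij_betw prod.swap {(a, b). a \<in> fst X \<and> b \<in> fst Y \<and> f a = g b} {(b, a). b \<in> fst Y \<and> a \<in> fst X \<and> g b = f a}"
    by (rule bij_betw_byWitness[where f' = prod.swap]) auto
  from bij_betw_trans[OF b this] have "bij_betw (\<lambda>s. (q s, p s)) (fst Z) {(b, a). b \<in> fst Y \<and> a \<in> fst X \<and> g b = f a}"
    by (simp add: comp_def)
  then show ?thesis using assms by (simp add: is_pullback_def)
qed

lemma pullback_iso:
  assumes P: "is_pullback G Z X Y T p q f g" and W: "is_gset G W"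
    and k: "k \<in> gmaps G W Z" "bij_betw k (fst W) (fst Z)"
  shows "is_pullback G W X Y T (compose (fst W) p k) (compose (fst W) q k) f g"
proof -
  have p: "p \<in> gmaps G Z X" and q: "q \<in> gmaps G Z Y"
    and b: "bij_betw (\<lambda>s. (p s, q s)) (fst Z) {(a, b). a \<in> fst X \<and> b \<in> fst Y \<and> f a = g b}"
    using P by (simp_all add: is_pullback_def)
  have "bij_betw (\<lambda>s. (compose (fst W) p k s, compose (fst W) q k s)) (fst W) {(a, b). a \<in> fst X \<and> b \<in> fst Y \<and> f a = g b}"
    using bij_betw_trans[OF k(2) b] by (rule bij_betw_cong[THEN iffD1, rotated]) (simp add: compose_def)
  then show ?thesis using P W gmaps_compose[OF k(1) p W] gmaps_compose[OF k(1) q W]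
    by (simp add: is_pullback_def)
qed

lemma marks_compose:
  assumes X: "is_gset G X" and S: "finite (fst S)" and f: "f \<in> gmaps G X S"
  shows "marks X (compose (fst X) \<phi> f) H t = (\<Sum>s | s \<in> fst S \<and> \<phi> s = t. marks X f H s)"
proof -
  have "{x \<in> fst X. compose (fst X) \<phi> f x = t \<and> fixed_by X H x} =
    (\<Union>s\<in>{s \<in> fst S. \<phi> s = t}. {x \<in> fst X. f x = s \<and> fixed_by X H x})"
    using gmapsD(1)[OF f] by (auto simp: compose_def)
  moreover have "card \<dots> = (\<Sum>s\<in>{s \<in> fst S. \<phi> s = t}. card {x \<in> fst X. f x = s \<and> fixed_by X H x})"
    using S gset_finite[OF X] by (intro card_UN_disjoint) auto
  ultimately show ?thesis by (simp add: marks_def)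
qed

end

subsection \<open>G-sets with points in an infinite type\<close>

locale gsets = gset_theory G for G :: "('g, 'b) monoid_scheme" (structure) +
  fixes points :: "'u itself"
  assumes finite_carrier: "finite (carrier G)" and infinite_points: "infinite (UNIV :: 'u set)"
begin

text \<open>The infinite type \<open>'u\<close> has room for a copy of every finite set. Constructions such as disjoint unions, fibre products
  and coset spaces are carried out in auxiliary types and moved to \<open>'u\<close> by this lemma.\<close>

lemma transport:
  assumes A: "is_gset G X"
  obtains Y :: "('g, 'u) gset" and e where "is_gset G Y" "e \<in> gmaps G X Y" "bij_betw e (fst X) (fst Y)"
proof -
  obtain B :: "'u set" where B: "finite B" "card B = card (fst X)"
    using infinite_arbitrarily_large[OF infinite_points] by blast
  obtain e where e: "bij_betw e (fst X) B"
    using finite_same_card_bij[OF gset_finite[OF A] B(1)] B(2) by auto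
  define d where "d = inv_into (fst X) e"
  have d: "d b \<in> fst X" "e (d b) = b" if "b \<in> B" for b
    unfolding d_def using e that by (auto simp: bij_betw_def inv_into_into f_inv_into_f)
  have de: "d (e x) = x" if "x \<in> fst X" for x unfolding d_def using e that by (simp add: bij_betw_inv_into_left)
  have eB: "e x \<in> B" if "x \<in> fst X" for x using e that by (auto simp: bij_betw_def)
  let ?Y = "gset_of B (\<lambda>g b. e (snd X g (d b)))"
  have "is_gset G ?Y"
    by (rule is_gset_of) (simp_all add: B d eB de gset_closed[OF A] gset_one[OF A] gset_mult[OF A])
  moreover have "restrict e (fst X) \<in> gmaps G X ?Y"
    by (rule restrict_gmaps[OF _ A]) (simp_all add: eB de)
  moreover have "bij_betw (restrict e (fst X)) (fst X) (fst ?Y)" using e by simp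
  ultimately show thesis by (rule that)
qed

lemma ex_disj_union:
  fixes X Y :: "('g, 'u) gset"
  assumes X: "is_gset G X" and Y: "is_gset G Y"
  obtains Z i j where "is_disj_union G Z X Y i j"
proof -
  let ?W = "gset_of (fst X <+> fst Y) (\<lambda>g. map_sum (snd X g) (snd Y g))"
  have W: "is_gset G ?W"
    by (rule is_gset_of) (auto simp: gset_finite[OF X] gset_finite[OF Y] gset_closed[OF X] gset_closed[OF Y]
      gset_one[OF X] gset_one[OF Y] gset_mult[OF X] gset_mult[OF Y])
  obtain Z :: "('g, 'u) gset" and e where Z: "is_gset G Z" and e: "e \<in> gmaps G ?W Z" and b: "bij_betw e (fst ?W) (fst Z)"
    using transport[OF W] by blast
  have inj: "inj_on e (fst X <+> fst Y)" and im: "e ` (fst X <+> fst Y) = fst Z"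
    using b by (auto simp: bij_betw_def)
  let ?i = "\<lambda>x\<in>fst X. e (Inl x)" and ?j = "\<lambda>y\<in>fst Y. e (Inr y)"
  have e_act: "e (map_sum (snd X g) (snd Y g) w) = snd Z g (e w)" if "g \<in> carrier G" "w \<in> fst X <+> fst Y" for g w
    using gmapsD(3)[OF e that(1)] that by simp
  have "?i \<in> gmaps G X Z"
    by (rule restrict_gmaps[OF _ X]) (use im e_act[of _ "Inl _"] in auto)
  moreover have "?j \<in> gmaps G Y Z"
    by (rule restrict_gmaps[OF _ Y]) (use im e_act[of _ "Inr _"] in auto)
  moreover have "inj_on ?i (fst X)" "inj_on ?j (fst Y)"
    using inj by (auto simp: inj_on_def)
  moreover have "?i ` fst X \<inter> ?j ` fst Y = {}" using inj by (auto simp: inj_on_def)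
  moreover have "?i ` fst X \<union> ?j ` fst Y = fst Z" unfolding im[symmetric] by (auto simp: image_iff)
  ultimately show thesis using X Y Z by (intro that[of Z ?i ?j]) (simp add: is_disj_union_def)
qed

lemma disj_union_map:
  fixes X Y :: "('g, 'u) gset"
  assumes U: "is_disj_union G Z X Y i j" and f: "f \<in> gmaps G X S" and g: "g \<in> gmaps G Y S"
  obtains h where "h \<in> gmaps G Z S" "\<And>x. x \<in> fst X \<Longrightarrow> h (i x) = f x" "\<And>y. y \<in> fst Y \<Longrightarrow> h (j y) = g y"
proof -
  have Z: "is_gset G Z" and X: "is_gset G X" and Y: "is_gset G Y"
    and i: "i \<in> gmaps G X Z" "inj_on i (fst X)" and j: "j \<in> gmaps G Y Z" "inj_on j (fst Y)"
    and disj: "i ` fst X \<inter> j ` fst Y = {}" and cov: "i ` fst X \<union> j ` fst Y = fst Z"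
    using U by (auto simp: is_disj_union_def)
  define h where "h z = (if z \<in> i ` fst X then f (inv_into (fst X) i z) else g (inv_into (fst Y) j z))" for z
  have hi: "h (i x) = f x" if "x \<in> fst X" for x using that i(2) by (simp add: h_def)
  have hj: "h (j y) = g y" if "y \<in> fst Y" for y
  proof -
    have "j y \<notin> i ` fst X" using that disj by auto
    then show ?thesis using that j(2) by (simp add: h_def)
  qed
  have "restrict h (fst Z) \<in> gmaps G Z S"
  proof (rule restrict_gmaps[OF _ Z])
    show "h z \<in> fst S" if "z \<in> fst Z" for z
      using that unfolding cov[symmetric] by (auto simp: hi hj gmapsD(1)[OF f] gmapsD(1)[OF g])
    fix a z assume a: "a \<in> carrier G" and "z \<in> fst Z"
    then consider x where "x \<in> fst X" "z = i x" | y where "y \<in> fst Y" "z = j y" using cov by blast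
    then show "h (snd Z a z) = snd S a (h z)"
    proof cases
      case 1
      then show ?thesis
        using gmapsD(3)[OF i(1) a] gmapsD(3)[OF f a] gset_closed[OF X a] by (metis hi)
    next
      case 2
      then show ?thesis
        using gmapsD(3)[OF j(1) a] gmapsD(3)[OF g a] gset_closed[OF Y a] by (metis hj)
    qed
  qed
  moreover have "i x \<in> fst Z" if "x \<in> fst X" for x using that cov by blast
  moreover have "j x \<in> fst Z" if "x \<in> fst Y" for x using that cov by blast
  ultimately show thesis by (intro that[of "restrict h (fst Z)"]) (simp_all add: hi hj)
qed

lemma ex_pullback:
  fixes X Y T :: "('g, 'u) gset"
  assumes X: "is_gset G X" and Y: "is_gset G Y" and T: "is_gset G T"
    and f: "f \<in> gmaps G X T" and g: "g \<in> gmaps G Y T"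
  obtains Z p q where "is_pullback G Z X Y T p q f g"
proof -
  let ?A = "{(a, b). a \<in> fst X \<and> b \<in> fst Y \<and> f a = g b}"
  let ?W = "gset_of ?A (\<lambda>c. map_prod (snd X c) (snd Y c))"
  have "finite ?A"
    by (rule finite_subset[of _ "fst X \<times> fst Y"]) (auto simp: gset_finite[OF X] gset_finite[OF Y])
  then have W: "is_gset G ?W"
    by (rule is_gset_of) (auto simp: gset_closed[OF X] gset_closed[OF Y]
      gset_one[OF X] gset_one[OF Y] gset_mult[OF X] gset_mult[OF Y] gmapsD(3)[OF f] gmapsD(3)[OF g])
  obtain Z :: "('g, 'u) gset" and e where Z: "is_gset G Z" and e: "e \<in> gmaps G ?W Z" and b: "bij_betw e (fst ?W) (fst Z)"
    using transport[OF W] by blast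
  define d where "d = restrict (inv_into (fst ?W) e) (fst Z)"
  have d: "d \<in> gmaps G Z ?W" unfolding d_def by (rule gmaps_inv[OF e W Z b])
  have db: "bij_betw d (fst Z) ?A"
    using bij_betw_inv_into[OF b] by (simp add: d_def)
  have dA: "d z \<in> ?A" if "z \<in> fst Z" for z by (rule bspec[OF bij_betwE[OF db] that])
  have de: "d (snd Z a z) = map_prod (snd X a) (snd Y a) (d z)" if "a \<in> carrier G" "z \<in> fst Z" for a z
    using gmapsD(3)[OF d that] dA[OF that(2)] that by simp
  let ?p = "\<lambda>z\<in>fst Z. fst (d z)" and ?q = "\<lambda>z\<in>fst Z. snd (d z)"
  have "?p \<in> gmaps G Z X" by (rule restrict_gmaps[OF _ Z]) (use dA de in \<open>fastforce+\<close>)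
  moreover have "?q \<in> gmaps G Z Y" by (rule restrict_gmaps[OF _ Z]) (use dA de in \<open>fastforce+\<close>)
  moreover have "bij_betw (\<lambda>z. (?p z, ?q z)) (fst Z) ?A"
    using db by (rule bij_betw_cong[THEN iffD1, rotated]) simp
  ultimately show thesis using X Y Z T f g by (intro that[of Z ?p ?q]) (simp add: is_pullback_def)
qed

end

section \<open>The Grothendieck group of a commutative monoid\<close>

definition groth_class :: "('a, 'c) monoid_scheme \<Rightarrow> 'a \<Rightarrow> 'a \<Rightarrow> ('a \<times> 'a) set" where
  "groth_class P a b = groth_rel P `` {(a, b)}"

text \<open>The operations of \<^const>\<open>groth\<close> and \<^const>\<open>groth_map\<close> are images of sets of pairs under the equivalence relation;
  this is the form in which they are seen to be independent of representatives.\<close>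

lemma groth_rel_Image_const:
  assumes "D \<noteq> {}" "\<And>x y. (x, y) \<in> D \<Longrightarrow> groth_class P x y = K"
  shows "groth_rel P `` D = K"
proof -
  have "groth_rel P `` D = (\<Union>z\<in>D. groth_rel P `` {z})" by (rule Image_eq_UN)
  also have "\<dots> = (\<Union>z\<in>D. K)"
    by (rule SUP_cong[OF refl]) (use assms(2) in \<open>auto simp: groth_class_def split_paired_all\<close>)
  finally show ?thesis using assms(1) by simp
qed

context comm_monoid
begin

lemma groth_rel_iff:
  "((a, b), (c, d)) \<in> groth_rel G \<longleftrightarrow> a \<in> carrier G \<and> b \<in> carrier G \<and> c \<in> carrier G \<and> d \<in> carrier G \<and>
    (\<exists>k\<in>carrier G. a \<otimes> d \<otimes> k = c \<otimes> b \<otimes> k)"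
  by (simp add: groth_rel_def)

lemma equiv_groth_rel: "equiv (carrier G \<times> carrier G) (groth_rel G)"
proof (rule equivI)
  show "groth_rel G \<subseteq> (carrier G \<times> carrier G) \<times> carrier G \<times> carrier G" by (auto simp: groth_rel_def)
  show "refl_on (carrier G \<times> carrier G) (groth_rel G)"
    by (rule refl_onI) (auto simp: groth_rel_def)
  show "sym (groth_rel G)"
    by (rule symI) (auto simp: groth_rel_def, metis)
  show "trans (groth_rel G)"
  proof (rule transI)
    fix x y z assume xy: "(x, y) \<in> groth_rel G" and yz: "(y, z) \<in> groth_rel G"
    obtain a b c d e f where xyz: "x = (a, b)" "y = (c, d)" "z = (e, f)" by (cases x, cases y, cases z)
    obtain k l where cl: "a \<in> carrier G" "b \<in> carrier G" "c \<in> carrier G" "d \<in> carrier G" "e \<in> carrier G" "f \<in> carrier G"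
      "k \<in> carrier G" "l \<in> carrier G"
      and 1: "a \<otimes> d \<otimes> k = c \<otimes> b \<otimes> k" and 2: "c \<otimes> f \<otimes> l = e \<otimes> d \<otimes> l"
      using xy yz unfolding xyz groth_rel_iff by blast
    have "a \<otimes> f \<otimes> (d \<otimes> k \<otimes> l) = (a \<otimes> d \<otimes> k) \<otimes> (f \<otimes> l)" using cl by (simp add: m_ac)
    also have "\<dots> = (c \<otimes> f \<otimes> l) \<otimes> (b \<otimes> k)" unfolding 1 using cl by (simp add: m_ac)
    also have "\<dots> = e \<otimes> b \<otimes> (d \<otimes> k \<otimes> l)" unfolding 2 using cl by (simp add: m_ac)
    finally show "(x, z) \<in> groth_rel G"
      unfolding xyz groth_rel_iff using cl by (intro conjI bexI[of _ "d \<otimes> k \<otimes> l"]) simp_all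
  qed
qed

lemma mem_groth_class: "(c, d) \<in> groth_class G a b \<longleftrightarrow> ((a, b), (c, d)) \<in> groth_rel G"
  by (simp add: groth_class_def)

lemma groth_class_self: "a \<in> carrier G \<Longrightarrow> b \<in> carrier G \<Longrightarrow> (a, b) \<in> groth_class G a b"
  by (auto simp: mem_groth_class groth_rel_iff)

lemma groth_class_eq_iff:
  assumes "a \<in> carrier G" "b \<in> carrier G" "c \<in> carrier G" "d \<in> carrier G"
  shows "groth_class G a b = groth_class G c d \<longleftrightarrow> (\<exists>k\<in>carrier G. a \<otimes> d \<otimes> k = c \<otimes> b \<otimes> k)"
proof -
  have "groth_class G a b = groth_class G c d \<longleftrightarrow> ((a, b), (c, d)) \<in> groth_rel G"
    unfolding groth_class_def by (rule eq_equiv_class_iff[OF equiv_groth_rel]) (use assms in auto)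
  then show ?thesis using assms by (simp add: groth_rel_iff)
qed

lemma groth_class_eqI: "((a, b), (c, d)) \<in> groth_rel G \<Longrightarrow> groth_class G a b = groth_class G c d"
  unfolding groth_class_def by (rule equiv_class_eq[OF equiv_groth_rel])

lemma carrier_groth: "carrier (groth G) = {groth_class G a b | a b. a \<in> carrier G \<and> b \<in> carrier G}"
  by (auto simp: groth_def quotient_def groth_class_def)

lemma one_groth: "\<one>\<^bsub>groth G\<^esub> = groth_class G \<one> \<one>"
  by (simp add: groth_def groth_class_def)

lemma mult_groth:
  assumes cl: "a \<in> carrier G" "b \<in> carrier G" "c \<in> carrier G" "d \<in> carrier G"
  shows "groth_class G a b \<otimes>\<^bsub>groth G\<^esub> groth_class G c d = groth_class G (a \<otimes> c) (b \<otimes> d)"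
proof -
  have "groth_class G (a' \<otimes> c') (b' \<otimes> d') = groth_class G (a \<otimes> c) (b \<otimes> d)"
    if ab: "(a', b') \<in> groth_class G a b" and cd: "(c', d') \<in> groth_class G c d" for a' b' c' d'
  proof -
    from ab obtain k where k: "a' \<in> carrier G" "b' \<in> carrier G" "k \<in> carrier G" and 1: "a \<otimes> b' \<otimes> k = a' \<otimes> b \<otimes> k"
      by (auto simp: mem_groth_class groth_rel_iff)
    from cd obtain l where l: "c' \<in> carrier G" "d' \<in> carrier G" "l \<in> carrier G" and 2: "c \<otimes> d' \<otimes> l = c' \<otimes> d \<otimes> l"
      by (auto simp: mem_groth_class groth_rel_iff)
    have "(a' \<otimes> c') \<otimes> (b \<otimes> d) \<otimes> (k \<otimes> l) = (a' \<otimes> b \<otimes> k) \<otimes> (c' \<otimes> d \<otimes> l)" using cl k l by (simp add: m_ac)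
    also have "\<dots> = (a \<otimes> c) \<otimes> (b' \<otimes> d') \<otimes> (k \<otimes> l)" unfolding 1[symmetric] 2[symmetric] using cl k l by (simp add: m_ac)
    finally show ?thesis using cl k l by (subst groth_class_eq_iff) auto
  qed
  then have "groth_rel G `` {(a' \<otimes> c', b' \<otimes> d') | a' c' b' d'. (a', b') \<in> groth_class G a b \<and> (c', d') \<in> groth_class G c d}
      = groth_class G (a \<otimes> c) (b \<otimes> d)"
    using groth_class_self[OF cl(1,2)] groth_class_self[OF cl(3,4)]
    by (intro groth_rel_Image_const) blast+
  moreover have "{(a' \<otimes> c', b' \<otimes> d') | a' c' b' d'. (a', b') \<in> groth_class G a b \<and> (c', d') \<in> groth_class G c d} =
    {(a' \<otimes> c', b' \<otimes> d') | a' b' c' d'. (a', b') \<in> groth_class G a b \<and> (c', d') \<in> groth_class G c d}" by blast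
  ultimately show ?thesis by (simp add: groth_def)
qed

lemma comm_group_groth: "comm_group (groth G)"
proof (rule comm_groupI)
  fix x assume "x \<in> carrier (groth G)"
  then obtain a b where x: "x = groth_class G a b" "a \<in> carrier G" "b \<in> carrier G" by (auto simp: carrier_groth)
  then have "groth_class G b a \<otimes>\<^bsub>groth G\<^esub> x = \<one>\<^bsub>groth G\<^esub>"
    by (simp add: mult_groth one_groth groth_class_eq_iff m_comm) (metis one_closed)
  then show "\<exists>y\<in>carrier (groth G). y \<otimes>\<^bsub>groth G\<^esub> x = \<one>\<^bsub>groth G\<^esub>"
    using x by (auto simp: carrier_groth)
qed (auto simp: carrier_groth mult_groth one_groth m_ac, blast+)

lemma groth_map_class:
  assumes h: "h \<in> hom G Q" and Q: "comm_monoid Q" and ab: "a \<in> carrier G" "b \<in> carrier G"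
  shows "groth_map Q h (groth_class G a b) = groth_class Q (h a) (h b)"
proof -
  interpret Q: comm_monoid Q by fact
  have "groth_class Q (h c) (h d) = groth_class Q (h a) (h b)" if "(c, d) \<in> groth_class G a b" for c d
  proof -
    from that obtain k where k: "c \<in> carrier G" "d \<in> carrier G" "k \<in> carrier G" and 1: "a \<otimes> d \<otimes> k = c \<otimes> b \<otimes> k"
      by (auto simp: mem_groth_class groth_rel_iff)
    have "h (a \<otimes> d \<otimes> k) = h (c \<otimes> b \<otimes> k)" using 1 by simp
    then have "h a \<otimes>\<^bsub>Q\<^esub> h d \<otimes>\<^bsub>Q\<^esub> h k = h c \<otimes>\<^bsub>Q\<^esub> h b \<otimes>\<^bsub>Q\<^esub> h k"
      using h k ab by (simp add: hom_mult)
    then show ?thesis using k ab hom_in_carrier[OF h] by (subst Q.groth_class_eq_iff) (auto intro!: bexI[of _ "h k"])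
  qed
  then show ?thesis unfolding groth_map_def using groth_class_self[OF ab]
    by (intro groth_rel_Image_const) blast+
qed

end

section \<open>The Burnside ring through marks\<close>

context gsets
begin

lemma gsets_over_iff: "(X, f) \<in> gsets_over G S \<longleftrightarrow> is_gset G X \<and> f \<in> gmaps G X S"
  by (simp add: gsets_over_def)

text \<open>By \<open>marks_determine\<close> an isomorphism class over \<open>S\<close> is the same as its function of marks. Naming classes by
  functions turns every identity between sums, pullbacks and compositions of \<open>G\<close>-sets into one between functions.\<close>

definition mark_class :: "('g, 'u) gset \<Rightarrow> ('g set \<Rightarrow> 'u \<Rightarrow> nat) \<Rightarrow> ('g, 'u) over_class" where
  "mark_class S v = {(X, f). (X, f) \<in> gsets_over G S \<and> marks X f = v}"

definition realizable :: "('g, 'u) gset \<Rightarrow> ('g set \<Rightarrow> 'u \<Rightarrow> nat) \<Rightarrow> bool" where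
  "realizable S v \<longleftrightarrow> (\<exists>X f. (X, f) \<in> gsets_over G S \<and> marks X f = v)"

lemma marks_eq_imp_iso:
  fixes X Y :: "('g, 'u) gset"
  assumes "(X, f) \<in> gsets_over G S" "(Y, g) \<in> gsets_over G S" "marks X f = marks Y g"
  obtains h where "h \<in> gmaps G X Y" "bij_betw h (fst X) (fst Y)" "\<And>x. x \<in> fst X \<Longrightarrow> g (h x) = f x"
proof -
  have "\<exists>h\<in>gmaps G X Y. bij_betw h (fst X) (fst Y) \<and> (\<forall>x\<in>fst X. g (h x) = f x)"
  proof (rule marks_determine[where act = "snd S"])
    have f: "f \<in> gmaps G X S" and g: "g \<in> gmaps G Y S" using assms by (auto simp: gsets_over_iff)
    show "f (snd X a x) = snd S a (f x)" if "a \<in> carrier G" "x \<in> fst X" for a x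
      by (rule gmapsD(3)[OF f that])
    show "g (snd Y a y) = snd S a (g y)" if "a \<in> carrier G" "y \<in> fst Y" for a y
      by (rule gmapsD(3)[OF g that])
  qed (use assms finite_carrier in \<open>auto simp: gsets_over_iff\<close>)
  then show thesis using that by blast
qed

lemma over_iso_iff:
  fixes X Y :: "('g, 'u) gset"
  shows "((X, f), (Y, g)) \<in> over_iso G S \<longleftrightarrow>
    (X, f) \<in> gsets_over G S \<and> (Y, g) \<in> gsets_over G S \<and> marks X f = marks Y g" (is "?l \<longleftrightarrow> ?r")
proof
  assume ?l
  then obtain h where XY: "(X, f) \<in> gsets_over G S" "(Y, g) \<in> gsets_over G S"
    and h: "h \<in> gmaps G X Y" "bij_betw h (fst X) (fst Y)" "\<forall>x\<in>fst X. g (h x) = f x"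
    by (auto simp: over_iso_def)
  have X: "is_gset G X" using XY(1) by (simp add: gsets_over_iff)
  have "marks X f = marks Y g" by (rule marks_iso[OF h(1,2) X]) (use h(3) in blast)
  then show ?r using XY by blast
next
  assume r: ?r
  then obtain h where "h \<in> gmaps G X Y" "bij_betw h (fst X) (fst Y)" "\<And>x. x \<in> fst X \<Longrightarrow> g (h x) = f x"
    using marks_eq_imp_iso by blast
  then show ?l using r by (auto simp: over_iso_def)
qed

lemma over_iso_class:
  assumes "(X, f) \<in> gsets_over G S"
  shows "over_iso G S `` {(X, f)} = mark_class S (marks X f)"
  using assms by (auto simp: mark_class_def over_iso_iff)

lemma mark_class_eq_iff:
  assumes "realizable S v"
  shows "mark_class S v = mark_class S w \<longleftrightarrow> v = w"
  using assms by (auto simp: mark_class_def realizable_def set_eq_iff)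

lemma realizable_obtain:
  assumes "realizable S v"
  obtains X f where "(X, f) \<in> mark_class S v" "is_gset G X" "f \<in> gmaps G X S" "marks X f = v"
  using assms by (auto simp: realizable_def mark_class_def gsets_over_iff)

lemma carrier_burnside_monoid:
  fixes S :: "('g, 'u) gset"
  shows "carrier (burnside_monoid G S) = {mark_class S v | v. realizable S v}"
proof -
  have "carrier (burnside_monoid G S) = (\<lambda>z. over_iso G S `` {z}) ` gsets_over G S"
    by (auto simp: burnside_monoid_def quotient_def)
  also have "\<dots> = (\<lambda>(X, f). mark_class S (marks X f)) ` gsets_over G S"
    by (rule image_cong[OF refl]) (metis (no_types, lifting) case_prod_conv over_iso_class surj_pair)
  also have "\<dots> = {mark_class S v | v. realizable S v}"
    unfolding realizable_def by (auto simp: image_iff)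
  finally show ?thesis .
qed

lemma realizable_support:
  assumes "realizable S v" "\<not> (s \<in> fst S \<and> fixed_by S H s)"
  shows "v H s = 0"
proof -
  obtain X f where "(X, f) \<in> mark_class S v" and X: "is_gset G X" and f: "f \<in> gmaps G X S" and v: "marks X f = v"
    using assms(1) by (rule realizable_obtain)
  have "\<not> (\<exists>x\<in>fst X. f x = s \<and> fixed_by X H x)"
    using assms(2) gmapsD(1)[OF f] fixed_by_image[OF f] by blast
  then have "\<not> 0 < marks X f H s" unfolding marks_pos_iff[OF X] .
  then show ?thesis using v by simp
qed

lemma realizable_plus:
  assumes "realizable S v" "realizable S w"
  shows "realizable S (v + w)"
proof -
  obtain X f where "(X, f) \<in> mark_class S v" and X: "is_gset G X" and f: "f \<in> gmaps G X S" and v: "marks X f = v"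
    using assms(1) by (rule realizable_obtain)
  obtain Y g where "(Y, g) \<in> mark_class S w" and Y: "is_gset G Y" and g: "g \<in> gmaps G Y S" and w: "marks Y g = w"
    using assms(2) by (rule realizable_obtain)
  obtain Z i j where U: "is_disj_union G Z X Y i j" using ex_disj_union[OF X Y] .
  obtain h where h: "h \<in> gmaps G Z S" "\<And>x. x \<in> fst X \<Longrightarrow> h (i x) = f x" "\<And>y. y \<in> fst Y \<Longrightarrow> h (j y) = g y"
    using disj_union_map[OF U f g] by blast
  have "marks Z h = v + w" using marks_disj_union[OF U h(2,3)] v w by (auto simp: fun_eq_iff)
  moreover have "(Z, h) \<in> gsets_over G S" using U h(1) by (simp add: is_disj_union_def gsets_over_iff)
  ultimately show ?thesis unfolding realizable_def by blast
qed

text \<open>Marks of disjoint unions add up. Conversely a \<open>G\<close>-set with marks \<open>v + w\<close> is isomorphic to some disjoint union of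
  members of the two classes, hence is itself one.\<close>

lemma mult_burnside_monoid:
  assumes "realizable S v" "realizable S w"
  shows "mark_class S v \<otimes>\<^bsub>burnside_monoid G S\<^esub> mark_class S w = mark_class S (v + w)"
proof -
  have "(Z, h) \<in> mark_class S (v + w) \<longleftrightarrow> (Z, h) \<in> gsets_over G S \<and>
      (\<exists>(X, f)\<in>mark_class S v. \<exists>(Y, g)\<in>mark_class S w. \<exists>i j.
        is_disj_union G Z X Y i j \<and> (\<forall>x\<in>fst X. h (i x) = f x) \<and> (\<forall>y\<in>fst Y. h (j y) = g y))"
    (is "?l \<longleftrightarrow> ?r") for Z h
  proof
    assume ?l
    then have Z: "(Z, h) \<in> gsets_over G S" and m: "marks Z h = v + w" by (auto simp: mark_class_def)
    obtain X f where Xf: "(X, f) \<in> mark_class S v" and X: "is_gset G X" and f: "f \<in> gmaps G X S" and v: "marks X f = v"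
      using assms(1) by (rule realizable_obtain)
    obtain Y g where Yg: "(Y, g) \<in> mark_class S w" and Y: "is_gset G Y" and g: "g \<in> gmaps G Y S" and w: "marks Y g = w"
      using assms(2) by (rule realizable_obtain)
    obtain W i j where U: "is_disj_union G W X Y i j" using ex_disj_union[OF X Y] .
    obtain k where k: "k \<in> gmaps G W S" "\<And>x. x \<in> fst X \<Longrightarrow> k (i x) = f x" "\<And>y. y \<in> fst Y \<Longrightarrow> k (j y) = g y"
      using disj_union_map[OF U f g] by blast
    have "marks W k = v + w" using marks_disj_union[OF U k(2,3)] v w by (auto simp: fun_eq_iff)
    moreover have W: "(W, k) \<in> gsets_over G S" using U k(1) by (simp add: is_disj_union_def gsets_over_iff)
    ultimately obtain e where e: "e \<in> gmaps G W Z" "bij_betw e (fst W) (fst Z)" "\<And>x. x \<in> fst W \<Longrightarrow> h (e x) = k x"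
      using marks_eq_imp_iso[OF W Z] m by metis
    have "is_disj_union G Z X Y (compose (fst X) e i) (compose (fst Y) e j)"
      by (rule disj_union_iso[OF U e(1,2)]) (use Z in \<open>simp add: gsets_over_iff\<close>)
    note D = this
    have iW: "i x \<in> fst W" if "x \<in> fst X" for x using U that by (auto simp: is_disj_union_def)
    have jW: "j y \<in> fst W" if "y \<in> fst Y" for y using U that by (auto simp: is_disj_union_def)
    have "\<forall>x\<in>fst X. h (compose (fst X) e i x) = f x" "\<forall>y\<in>fst Y. h (compose (fst Y) e j y) = g y"
      by (simp_all add: compose_def e(3) iW jW k(2,3))
    then show ?r using Z Xf Yg D by blast
  next
    assume ?r
    then obtain X f Y g i j where *: "(X, f) \<in> mark_class S v" "(Y, g) \<in> mark_class S w" "is_disj_union G Z X Y i j"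
      "\<And>x. x \<in> fst X \<Longrightarrow> h (i x) = f x" "\<And>y. y \<in> fst Y \<Longrightarrow> h (j y) = g y" and Z: "(Z, h) \<in> gsets_over G S" by blast
    have "marks Z h = v + w" using marks_disj_union[OF *(3-5)] *(1,2) by (auto simp: fun_eq_iff mark_class_def)
    then show ?l using Z by (simp add: mark_class_def)
  qed
  note mem = this
  show ?thesis
  proof (rule Set.set_eqI)
    fix z :: "('g, 'u) gset \<times> ('u \<Rightarrow> 'u)"
    obtain Z h where z: "z = (Z, h)" by (cases z)
    show "z \<in> mark_class S v \<otimes>\<^bsub>burnside_monoid G S\<^esub> mark_class S w \<longleftrightarrow> z \<in> mark_class S (v + w)"
      unfolding z mem by (simp add: burnside_monoid_def)
  qed
qed

definition empty_gset :: "('g, 'u) gset" where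
  "empty_gset = gset_of {} (\<lambda>g x. x)"

lemma is_gset_empty: "is_gset G empty_gset"
  unfolding empty_gset_def by (rule is_gset_of) auto

lemma marks_eq_0_iff:
  assumes "is_gset G X"
  shows "marks X f = 0 \<longleftrightarrow> fst X = {}"
proof
  assume "marks X f = 0"
  then have "\<not> 0 < marks X f {} s" for s by simp
  then show "fst X = {}" unfolding marks_pos_iff[OF assms] by (auto simp: fixed_by_def)
qed (auto simp: marks_def fun_eq_iff)

lemma one_burnside_monoid:
  fixes S :: "('g, 'u) gset"
  shows "\<one>\<^bsub>burnside_monoid G S\<^esub> = mark_class S 0"
  by (auto simp: burnside_monoid_def mark_class_def gsets_over_iff marks_eq_0_iff)

lemma realizable_0: "realizable S 0"
proof -
  have "(empty_gset, \<lambda>x. undefined) \<in> gsets_over G S"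
    using is_gset_empty by (auto simp: gsets_over_iff gmaps_def empty_gset_def)
  then show ?thesis unfolding realizable_def using marks_eq_0_iff[OF is_gset_empty]
    by (metis empty_gset_def fst_gset_of)
qed

lemma mark_class_closed: "realizable S v \<Longrightarrow> mark_class S v \<in> carrier (burnside_monoid G S)"
  by (auto simp: carrier_burnside_monoid)

lemma burnside_monoid_cases:
  fixes S :: "('g, 'u) gset"
  assumes "a \<in> carrier (burnside_monoid G S)"
  obtains v where "a = mark_class S v" "realizable S v"
  using assms by (auto simp: carrier_burnside_monoid)

lemma comm_monoid_burnside: "comm_monoid (burnside_monoid G (S :: ('g, 'u) gset))"
  by (rule comm_monoidI)
    (auto elim!: burnside_monoid_cases simp: mark_class_closed one_burnside_monoid mult_burnside_monoid realizable_plus realizable_0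
      ac_simps)

text \<open>The effect on marks of composition with \<open>\<phi>\<close>, by \<open>marks_compose\<close>.\<close>

definition mark_push :: "('g, 'u) gset \<Rightarrow> ('u \<Rightarrow> 'u) \<Rightarrow> ('g set \<Rightarrow> 'u \<Rightarrow> 'n::comm_monoid_add) \<Rightarrow> 'g set \<Rightarrow> 'u \<Rightarrow> 'n" where
  "mark_push S \<phi> v H t = (\<Sum>s | s \<in> fst S \<and> \<phi> s = t. v H s)"

text \<open>The effect on marks of pullback along \<open>\<psi>\<close>, by \<open>marks_pullback\<close>.\<close>

definition mark_pull :: "('g, 'u) gset \<Rightarrow> ('u \<Rightarrow> 'u) \<Rightarrow> ('g set \<Rightarrow> 'u \<Rightarrow> 'n::zero) \<Rightarrow> 'g set \<Rightarrow> 'u \<Rightarrow> 'n" where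
  "mark_pull S \<psi> v H s = (if s \<in> fst S \<and> fixed_by S H s then v H (\<psi> s) else 0)"

lemma class_push_mark_class:
  assumes S: "is_gset G S" and phi: "\<phi> \<in> gmaps G S T" and v: "realizable S v"
  shows "class_push G T \<phi> (mark_class S v) = mark_class T (mark_push S \<phi> v)" "realizable T (mark_push S \<phi> v)"
proof -
  have *: "(X, compose (fst X) \<phi> f) \<in> gsets_over G T \<and> marks X (compose (fst X) \<phi> f) = mark_push S \<phi> v"
    if "(X, f) \<in> mark_class S v" for X f
  proof -
    have X: "is_gset G X" and f: "f \<in> gmaps G X S" and v: "marks X f = v"
      using that by (auto simp: mark_class_def gsets_over_iff)
    show ?thesis using gmaps_compose[OF f phi X] X marks_compose[OF X gset_finite[OF S] f] v
      by (auto simp: gsets_over_iff mark_push_def fun_eq_iff)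
  qed
  obtain X f where Xf: "(X, f) \<in> mark_class S v" using v by (auto simp: realizable_def mark_class_def)
  have "class_push G T \<phi> (mark_class S v) = (\<Union>(X, f)\<in>mark_class S v. over_iso G T `` {(X, compose (fst X) \<phi> f)})"
    unfolding class_push_def by blast
  also have "\<dots> = (\<Union>(X, f)\<in>mark_class S v. mark_class T (mark_push S \<phi> v))"
  proof (rule SUP_cong[OF refl], clarify)
    fix X f assume "(X, f) \<in> mark_class S v"
    from *[OF this] show "over_iso G T `` {(X, compose (fst X) \<phi> f)} = mark_class T (mark_push S \<phi> v)"
      using over_iso_class by metis
  qed
  also have "\<dots> = mark_class T (mark_push S \<phi> v)" using Xf by auto
  finally show "class_push G T \<phi> (mark_class S v) = mark_class T (mark_push S \<phi> v)" .
  show "realizable T (mark_push S \<phi> v)" using *[OF Xf] unfolding realizable_def by blast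
qed

text \<open>A \<open>G\<close>-set over \<open>S\<close> with the marks of a pullback is isomorphic to that pullback and therefore is a pullback, too.\<close>

lemma class_pull_mark_class:
  assumes S: "is_gset G S" and T: "is_gset G T" and psi: "\<psi> \<in> gmaps G S T" and v: "realizable T v"
  shows "class_pull G S T \<psi> (mark_class T v) = mark_class S (mark_pull S \<psi> v)" "realizable S (mark_pull S \<psi> v)"
proof -
  have *: "(Z, h) \<in> gsets_over G S \<and> marks Z h = mark_pull S \<psi> v"
    if "(Y, g) \<in> mark_class T v" "is_pullback G Z S Y T h q \<psi> g" for Y g Z h q
    using that marks_pullback[OF that(2)]
    by (auto simp: gsets_over_iff is_pullback_def mark_pull_def mark_class_def fun_eq_iff)
  obtain Y g where Yg: "(Y, g) \<in> mark_class T v" "is_gset G Y" "g \<in> gmaps G Y T" "marks Y g = v" using v by (rule realizable_obtain)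
  obtain W p q where W: "is_pullback G W S Y T p q \<psi> g" using ex_pullback[OF S Yg(2) T psi Yg(3)] .
  note Wp = *[OF Yg(1) W]
  have "(Z, h) \<in> class_pull G S T \<psi> (mark_class T v) \<longleftrightarrow> (Z, h) \<in> mark_class S (mark_pull S \<psi> v)" (is "?l \<longleftrightarrow> ?r") for Z h
  proof
    assume ?l
    then obtain Y' g' q' where "(Y', g') \<in> mark_class T v" "is_pullback G Z S Y' T h q' \<psi> g'"
      by (auto simp: class_pull_def)
    from *[OF this] show ?r by (simp add: mark_class_def)
  next
    assume ?r
    then have Z: "(Z, h) \<in> gsets_over G S" and "marks Z h = mark_pull S \<psi> v" by (auto simp: mark_class_def)
    then obtain k where k: "k \<in> gmaps G Z W" "bij_betw k (fst Z) (fst W)" "\<And>z. z \<in> fst Z \<Longrightarrow> p (k z) = h z"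
      using marks_eq_imp_iso[OF Z conjunct1[OF Wp]] Wp by metis
    have "compose (fst Z) p k = h"
      using k(3) gmapsD(2)[of h Z S] Z by (auto simp: compose_def gsets_over_iff fun_eq_iff extensional_def)
    then have "is_pullback G Z S Y T h (compose (fst Z) q k) \<psi> g"
      using pullback_iso[OF W _ k(1,2)] Z by (simp add: gsets_over_iff)
    then show ?l using Z Yg(1) unfolding class_pull_def by blast
  qed
  then show "class_pull G S T \<psi> (mark_class T v) = mark_class S (mark_pull S \<psi> v)"
    by (metis (no_types, lifting) Set.set_eqI surj_pair)
  show "realizable S (mark_pull S \<psi> v)" using Wp unfolding realizable_def by blast
qed

lemma mark_push_plus: "mark_push S \<phi> (v + w) = mark_push S \<phi> v + mark_push S \<phi> w"
  by (auto simp: mark_push_def fun_eq_iff sum.distrib)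

lemma mark_pull_plus: "mark_pull S \<psi> (v + w) = mark_pull S \<psi> v + mark_pull S \<psi> (w :: _ \<Rightarrow> _ \<Rightarrow> 'n::monoid_add)"
  by (auto simp: mark_pull_def fun_eq_iff)

lemma class_push_hom:
  fixes S T :: "('g, 'u) gset"
  assumes "is_gset G S" "\<phi> \<in> gmaps G S T"
  shows "class_push G T \<phi> \<in> hom (burnside_monoid G S) (burnside_monoid G T)"
  using class_push_mark_class[OF assms]
  by (auto elim!: burnside_monoid_cases simp: hom_def mark_class_closed mult_burnside_monoid realizable_plus mark_push_plus)

lemma class_pull_hom:
  fixes S T :: "('g, 'u) gset"
  assumes "is_gset G S" "is_gset G T" "\<psi> \<in> gmaps G S T"
  shows "class_pull G S T \<psi> \<in> hom (burnside_monoid G T) (burnside_monoid G S)"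
  using class_pull_mark_class[OF assms]
  by (auto elim!: burnside_monoid_cases simp: hom_def mark_class_closed mult_burnside_monoid realizable_plus mark_pull_plus)

definition burnside_diff :: "('g, 'u) gset \<Rightarrow> ('g set \<Rightarrow> 'u \<Rightarrow> nat) \<Rightarrow> ('g set \<Rightarrow> 'u \<Rightarrow> nat) \<Rightarrow> ('g, 'u) burnside_elem" where
  "burnside_diff S v w = groth_class (burnside_monoid G S) (mark_class S v) (mark_class S w)"

lemma val_burnside: "val (burnside G) S = groth (burnside_monoid G S)"
  by (simp add: burnside_def)

lemma comm_group_burnside: "comm_group (val (burnside G) (S :: ('g, 'u) gset))"
  unfolding val_burnside by (rule comm_monoid.comm_group_groth[OF comm_monoid_burnside])

lemma burnside_diff_closed:
  assumes "realizable S v" "realizable S w"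
  shows "burnside_diff S v w \<in> carrier (val (burnside G) S)"
  unfolding val_burnside burnside_diff_def comm_monoid.carrier_groth[OF comm_monoid_burnside]
  using mark_class_closed[OF assms(1)] mark_class_closed[OF assms(2)] by blast

lemma burnside_cases:
  fixes S :: "('g, 'u) gset"
  assumes "u \<in> carrier (val (burnside G) S)"
  obtains v w where "realizable S v" "realizable S w" "u = burnside_diff S v w"
  using assms
  by (auto simp: val_burnside burnside_diff_def comm_monoid.carrier_groth[OF comm_monoid_burnside]
      elim!: burnside_monoid_cases)

lemma burnside_diff_eq_iff:
  assumes "realizable S v" "realizable S w" "realizable S v'" "realizable S w'"
  shows "burnside_diff S v w = burnside_diff S v' w' \<longleftrightarrow> v + w' = v' + w"
proof -
  interpret comm_monoid "burnside_monoid G S" by (rule comm_monoid_burnside)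
  have "burnside_diff S v w = burnside_diff S v' w' \<longleftrightarrow>
    (\<exists>k. realizable S k \<and> mark_class S (v + w' + k) = mark_class S (v' + w + k))"
    unfolding burnside_diff_def
    by (subst groth_class_eq_iff)
      (auto simp: mark_class_closed assms mult_burnside_monoid realizable_plus carrier_burnside_monoid)
  also have "\<dots> \<longleftrightarrow> v + w' = v' + w"
    using mark_class_eq_iff realizable_plus assms realizable_0 by (metis add_right_cancel)
  finally show ?thesis .
qed

lemma mult_burnside_diff:
  assumes "realizable S v" "realizable S w" "realizable S v'" "realizable S w'"
  shows "burnside_diff S v w \<otimes>\<^bsub>val (burnside G) S\<^esub> burnside_diff S v' w' = burnside_diff S (v + v') (w + w')"
  unfolding burnside_diff_def val_burnside
  by (simp add: comm_monoid.mult_groth[OF comm_monoid_burnside] mark_class_closed assms mult_burnside_monoid)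

lemma cov_burnside_diff:
  fixes S T :: "('g, 'u) gset"
  assumes "is_gset G S" "\<phi> \<in> gmaps G S T" "realizable S v" "realizable S w"
  shows "cov (burnside G) S T \<phi> (burnside_diff S v w) = burnside_diff T (mark_push S \<phi> v) (mark_push S \<phi> w)"
  unfolding burnside_diff_def
  by (simp add: burnside_def comm_monoid.groth_map_class[OF comm_monoid_burnside class_push_hom[OF assms(1,2)] comm_monoid_burnside]
      mark_class_closed assms class_push_mark_class)

lemma con_burnside_diff:
  fixes S T :: "('g, 'u) gset"
  assumes "is_gset G S" "is_gset G T" "\<psi> \<in> gmaps G S T" "realizable T v" "realizable T w"
  shows "con (burnside G) S T \<psi> (burnside_diff T v w) = burnside_diff S (mark_pull S \<psi> v) (mark_pull S \<psi> w)"
  unfolding burnside_diff_def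
  by (simp add: burnside_def comm_monoid.groth_map_class[OF comm_monoid_burnside class_pull_hom[OF assms(1-3)] comm_monoid_burnside]
      mark_class_closed assms class_pull_mark_class)

text \<open>Integer marks of a formal difference of classes; \<open>bmarks_diff\<close> shows that all representatives give the same value.\<close>

definition bmarks :: "('g, 'u) gset \<Rightarrow> ('g, 'u) burnside_elem \<Rightarrow> 'g set \<Rightarrow> 'u \<Rightarrow> int" where
  "bmarks S u = (THE d. \<exists>v w. realizable S v \<and> realizable S w \<and> u = burnside_diff S v w \<and>
     d = (\<lambda>H s. int (v H s) - int (w H s)))"

lemma bmarks_diff:
  assumes "realizable S v" "realizable S w"
  shows "bmarks S (burnside_diff S v w) = (\<lambda>H s. int (v H s) - int (w H s))"
  unfolding bmarks_def
proof (rule the_equality)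
  fix d assume "\<exists>v' w'. realizable S v' \<and> realizable S w' \<and> burnside_diff S v w = burnside_diff S v' w' \<and>
     d = (\<lambda>H s. int (v' H s) - int (w' H s))"
  then obtain v' w' where *: "v + w' = v' + w" "d = (\<lambda>H s. int (v' H s) - int (w' H s))"
    using assms by (auto simp: burnside_diff_eq_iff)
  have "v H s + w' H s = v' H s + w H s" for H s using fun_cong[OF fun_cong[OF *(1)], of H s] by simp
  then have "int (v H s) + int (w' H s) = int (v' H s) + int (w H s)" for H s by (metis of_nat_add)
  then show "d = (\<lambda>H s. int (v H s) - int (w H s))"
    unfolding *(2) by (auto simp: fun_eq_iff algebra_simps)
qed (use assms in blast)

lemma bmarks_inj:
  assumes "u \<in> carrier (val (burnside G) S)" "u' \<in> carrier (val (burnside G) S)" "bmarks S u = bmarks S u'"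
  shows "u = u'"
proof -
  obtain v w where u: "realizable S v" "realizable S w" "u = burnside_diff S v w" using assms(1) by (rule burnside_cases)
  obtain v' w' where u': "realizable S v'" "realizable S w'" "u' = burnside_diff S v' w'" using assms(2) by (rule burnside_cases)
  have "int (v H s) - int (w H s) = int (v' H s) - int (w' H s)" for H s
    using assms(3) unfolding u(3) u'(3) bmarks_diff[OF u(1,2)] bmarks_diff[OF u'(1,2)] by metis
  then have "int (v H s + w' H s) = int (v' H s + w H s)" for H s by (simp add: algebra_simps)
  then have "v + w' = v' + w" by (auto simp: fun_eq_iff simp del: of_nat_add)
  then show ?thesis using u u' by (simp add: burnside_diff_eq_iff)
qed

lemma bmarks_mult:
  assumes "u \<in> carrier (val (burnside G) S)" "u' \<in> carrier (val (burnside G) S)"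
  shows "bmarks S (u \<otimes>\<^bsub>val (burnside G) S\<^esub> u') H s = bmarks S u H s + bmarks S u' H s"
proof -
  obtain v w where u: "realizable S v" "realizable S w" "u = burnside_diff S v w" using assms(1) by (rule burnside_cases)
  obtain v' w' where u': "realizable S v'" "realizable S w'" "u' = burnside_diff S v' w'" using assms(2) by (rule burnside_cases)
  show ?thesis using u(1,2) u'(1,2) unfolding u(3) u'(3)
    by (simp add: mult_burnside_diff bmarks_diff realizable_plus)
qed

lemma bmarks_one: "bmarks S \<one>\<^bsub>val (burnside G) S\<^esub> H s = 0"
proof -
  interpret comm_group "val (burnside G) S" by (rule comm_group_burnside)
  show ?thesis using bmarks_mult[of "\<one>\<^bsub>val (burnside G) S\<^esub>" S "\<one>\<^bsub>val (burnside G) S\<^esub>" H s] by simp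
qed

lemma bmarks_inv:
  assumes "u \<in> carrier (val (burnside G) S)"
  shows "bmarks S (inv\<^bsub>val (burnside G) S\<^esub> u) H s = - bmarks S u H s"
proof -
  interpret comm_group "val (burnside G) S" by (rule comm_group_burnside)
  show ?thesis using bmarks_mult[of "inv\<^bsub>val (burnside G) S\<^esub> u" S u H s] assms bmarks_one by simp
qed

lemma bmarks_pow:
  assumes "u \<in> carrier (val (burnside G) S)"
  shows "bmarks S (u [^]\<^bsub>val (burnside G) S\<^esub> (n::nat)) H s = int n * bmarks S u H s"
proof -
  interpret comm_group "val (burnside G) S" by (rule comm_group_burnside)
  show ?thesis by (induction n) (simp_all add: bmarks_one bmarks_mult assms algebra_simps)
qed

lemma bmarks_support:
  assumes "u \<in> carrier (val (burnside G) S)" "\<not> (s \<in> fst S \<and> fixed_by S H s)"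
  shows "bmarks S u H s = 0"
proof -
  obtain v w where u: "realizable S v" "realizable S w" "u = burnside_diff S v w" using assms(1) by (rule burnside_cases)
  show ?thesis unfolding u(3) bmarks_diff[OF u(1,2)]
    using realizable_support[OF u(1) assms(2)] realizable_support[OF u(2) assms(2)] by simp
qed

lemma cov_burnside:
  assumes S: "is_gset G S" and phi: "\<phi> \<in> gmaps G S T" and u: "u \<in> carrier (val (burnside G) S)"
  shows cov_burnside_closed: "cov (burnside G) S T \<phi> u \<in> carrier (val (burnside G) T)"
    and bmarks_cov: "bmarks T (cov (burnside G) S T \<phi> u) = mark_push S \<phi> (bmarks S u)"
proof -
  obtain v w where u: "realizable S v" "realizable S w" "u = burnside_diff S v w" using assms(3) by (rule burnside_cases)
  show "cov (burnside G) S T \<phi> u \<in> carrier (val (burnside G) T)"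
    unfolding u(3) cov_burnside_diff[OF S phi u(1,2)]
    using class_push_mark_class(2)[OF S phi] u by (intro burnside_diff_closed) auto
  show "bmarks T (cov (burnside G) S T \<phi> u) = mark_push S \<phi> (bmarks S u)"
    unfolding u(3) cov_burnside_diff[OF S phi u(1,2)] bmarks_diff[OF u(1,2)]
    using class_push_mark_class(2)[OF S phi] u
    by (subst bmarks_diff) (auto simp: mark_push_def fun_eq_iff sum_subtractf)
qed

lemma con_burnside:
  assumes S: "is_gset G S" and T: "is_gset G T" and psi: "\<psi> \<in> gmaps G S T" and u: "u \<in> carrier (val (burnside G) T)"
  shows con_burnside_closed: "con (burnside G) S T \<psi> u \<in> carrier (val (burnside G) S)"
    and bmarks_con: "bmarks S (con (burnside G) S T \<psi> u) = mark_pull S \<psi> (bmarks T u)"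
proof -
  obtain v w where u: "realizable T v" "realizable T w" "u = burnside_diff T v w" using assms(4) by (rule burnside_cases)
  show "con (burnside G) S T \<psi> u \<in> carrier (val (burnside G) S)"
    unfolding u(3) con_burnside_diff[OF S T psi u(1,2)]
    using class_pull_mark_class(2)[OF S T psi] u by (intro burnside_diff_closed) auto
  show "bmarks S (con (burnside G) S T \<psi> u) = mark_pull S \<psi> (bmarks T u)"
    unfolding u(3) con_burnside_diff[OF S T psi u(1,2)] bmarks_diff[OF u(1,2)]
    using class_pull_mark_class(2)[OF S T psi] u
    by (subst bmarks_diff) (auto simp: mark_pull_def fun_eq_iff)
qed

lemma cov_burnside_hom:
  fixes S T :: "('g, 'u) gset"
  assumes S: "is_gset G S" and phi: "\<phi> \<in> gmaps G S T"
  shows "cov (burnside G) S T \<phi> \<in> hom (val (burnside G) S) (val (burnside G) T)"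
proof (rule homI)
  interpret A: comm_group "val (burnside G) S" by (rule comm_group_burnside)
  interpret B: comm_group "val (burnside G) T" by (rule comm_group_burnside)
  fix u u' assume u: "u \<in> carrier (val (burnside G) S)" "u' \<in> carrier (val (burnside G) S)"
  note c = cov_burnside[OF S phi]
  show "cov (burnside G) S T \<phi> (u \<otimes>\<^bsub>val (burnside G) S\<^esub> u') =
    cov (burnside G) S T \<phi> u \<otimes>\<^bsub>val (burnside G) T\<^esub> cov (burnside G) S T \<phi> u'"
    by (rule bmarks_inj[of _ T])
      (auto simp: c u A.m_closed B.m_closed fun_eq_iff bmarks_mult mark_push_def sum.distrib)
qed (rule cov_burnside_closed[OF S phi])

lemma con_burnside_hom:
  fixes S T :: "('g, 'u) gset"
  assumes S: "is_gset G S" and T: "is_gset G T" and psi: "\<psi> \<in> gmaps G S T"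
  shows "con (burnside G) S T \<psi> \<in> hom (val (burnside G) T) (val (burnside G) S)"
proof (rule homI)
  interpret A: comm_group "val (burnside G) S" by (rule comm_group_burnside)
  interpret B: comm_group "val (burnside G) T" by (rule comm_group_burnside)
  fix u u' assume u: "u \<in> carrier (val (burnside G) T)" "u' \<in> carrier (val (burnside G) T)"
  note c = con_burnside[OF S T psi]
  show "con (burnside G) S T \<psi> (u \<otimes>\<^bsub>val (burnside G) T\<^esub> u') =
    con (burnside G) S T \<psi> u \<otimes>\<^bsub>val (burnside G) S\<^esub> con (burnside G) S T \<psi> u'"
    by (rule bmarks_inj[of _ S])
      (auto simp: c u A.m_closed B.m_closed fun_eq_iff bmarks_mult mark_pull_def)
qed (rule con_burnside_closed[OF S T psi])

lemma con_burnside_id: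
  fixes S :: "('g, 'u) gset"
  assumes S: "is_gset G S" and u: "u \<in> carrier (val (burnside G) S)"
  shows "con (burnside G) S S (\<lambda>s\<in>fst S. s) u = u"
  by (rule bmarks_inj[OF con_burnside_closed[OF S S gmaps_id[OF S] u] u])
    (auto simp: bmarks_con[OF S S gmaps_id[OF S] u] mark_pull_def fun_eq_iff bmarks_support[OF u])

lemma con_burnside_comp:
  fixes S T U :: "('g, 'u) gset"
  assumes S: "is_gset G S" and T: "is_gset G T" and U: "is_gset G U"
    and f: "f \<in> gmaps G S T" and g: "g \<in> gmaps G T U" and u: "u \<in> carrier (val (burnside G) U)"
  shows "con (burnside G) S U (compose (fst S) g f) u = con (burnside G) S T f (con (burnside G) T U g u)"
proof -
  note gf = gmaps_compose[OF f g S]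
  note gu = con_burnside_closed[OF T U g u]
  show ?thesis
  proof (rule bmarks_inj[OF con_burnside_closed[OF S U gf u] con_burnside_closed[OF S T f gu]])
    show "bmarks S (con (burnside G) S U (compose (fst S) g f) u) = bmarks S (con (burnside G) S T f (con (burnside G) T U g u))"
      unfolding bmarks_con[OF S U gf u] bmarks_con[OF S T f gu] bmarks_con[OF T U g u]
      using gmapsD(1)[OF f] fixed_by_image[OF f] by (auto simp: mark_pull_def fun_eq_iff compose_def)
  qed
qed

text \<open>The base change formula (M1) for the Burnside ring. On marks it says that \<open>q\<close> maps the fibre of \<open>p\<close> over \<open>x\<close>
  bijectively to the fibre of \<open>\<phi>\<close> over \<open>\<psi> x\<close>; points of the latter that \<open>H\<close> does not fix contribute nothing.\<close>

lemma con_cov_burnside: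
  fixes P U S T :: "('g, 'u) gset"
  assumes P: "is_pullback G P U S T p q \<psi> \<phi>" and u: "u \<in> carrier (val (burnside G) S)"
  shows "con (burnside G) U T \<psi> (cov (burnside G) S T \<phi> u) = cov (burnside G) P U p (con (burnside G) P S q u)"
proof -
  have gs: "is_gset G P" "is_gset G U" "is_gset G S" "is_gset G T"
    and mp: "p \<in> gmaps G P U" "q \<in> gmaps G P S" "\<psi> \<in> gmaps G U T" "\<phi> \<in> gmaps G S T"
    and bij: "bij_betw (\<lambda>s. (p s, q s)) (fst P) {(a, b). a \<in> fst U \<and> b \<in> fst S \<and> \<psi> a = \<phi> b}"
    using P by (simp_all add: is_pullback_def)
  note c1 = cov_burnside_closed[OF gs(3) mp(4) u] and c2 = con_burnside_closed[OF gs(1,3) mp(2) u]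
  show ?thesis
  proof (rule bmarks_inj[OF con_burnside_closed[OF gs(2,4) mp(3) c1] cov_burnside_closed[OF gs(1) mp(1) c2]], intro ext)
    fix H x
    have L: "bmarks U (con (burnside G) U T \<psi> (cov (burnside G) S T \<phi> u)) H x =
      (if x \<in> fst U \<and> fixed_by U H x then \<Sum>s | s \<in> fst S \<and> \<phi> s = \<psi> x. bmarks S u H s else 0)"
      unfolding bmarks_con[OF gs(2,4) mp(3) c1] bmarks_cov[OF gs(3) mp(4) u] mark_pull_def mark_push_def ..
    have R: "bmarks U (cov (burnside G) P U p (con (burnside G) P S q u)) H x =
      (\<Sum>z | z \<in> fst P \<and> p z = x. if z \<in> fst P \<and> fixed_by P H z then bmarks S u H (q z) else 0)"
      unfolding bmarks_cov[OF gs(1) mp(1) c2] bmarks_con[OF gs(1,3) mp(2) u] mark_pull_def mark_push_def ..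
    show "bmarks U (con (burnside G) U T \<psi> (cov (burnside G) S T \<phi> u)) H x =
      bmarks U (cov (burnside G) P U p (con (burnside G) P S q u)) H x"
    proof (cases "x \<in> fst U \<and> fixed_by U H x")
      case True
      have "bij_betw q {z. z \<in> fst P \<and> p z = x} {s. s \<in> fst S \<and> \<phi> s = \<psi> x}"
        unfolding bij_betw_def
      proof
        have inj: "inj_on (\<lambda>s. (p s, q s)) (fst P)" using bij by (simp add: bij_betw_def)
        show "inj_on q {z. z \<in> fst P \<and> p z = x}"
          using inj by (auto simp: inj_on_def)
        show "q ` {z. z \<in> fst P \<and> p z = x} = {s. s \<in> fst S \<and> \<phi> s = \<psi> x}"
        proof (intro equalityI subsetI)
          fix s assume "s \<in> q ` {z. z \<in> fst P \<and> p z = x}"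
          then obtain z where z: "z \<in> fst P" "p z = x" "s = q z" by auto
          then show "s \<in> {s. s \<in> fst S \<and> \<phi> s = \<psi> x}"
            using bspec[OF bij_betwE[OF bij] z(1)] by auto
        next
          fix s assume "s \<in> {s. s \<in> fst S \<and> \<phi> s = \<psi> x}"
          then have "(x, s) \<in> (\<lambda>s. (p s, q s)) ` fst P"
            unfolding bij_betw_imp_surj_on[OF bij] using True by auto
          then show "s \<in> q ` {z. z \<in> fst P \<and> p z = x}" by auto
        qed
      qed
      then have "(\<Sum>s | s \<in> fst S \<and> \<phi> s = \<psi> x. bmarks S u H s) = (\<Sum>z | z \<in> fst P \<and> p z = x. bmarks S u H (q z))"
        by (rule sum.reindex_bij_betw[symmetric])
      also have "\<dots> = (\<Sum>z | z \<in> fst P \<and> p z = x. if z \<in> fst P \<and> fixed_by P H z then bmarks S u H (q z) else 0)"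
        using fixed_by_pullback[OF P, of _ H] bmarks_support[OF u] True by (intro sum.cong) auto
      finally show ?thesis unfolding L R using True by simp
    next
      case False
      have "(\<Sum>z | z \<in> fst P \<and> p z = x. if z \<in> fst P \<and> fixed_by P H z then bmarks S u H (q z) else 0) = 0"
        using fixed_by_pullback[OF P, of _ H] gmapsD(1)[OF mp(1)] False by (intro sum.neutral) auto
      then show ?thesis unfolding L R using False by (simp only: if_False)
    qed
  qed
qed

end

section \<open>The action of the Burnside ring on a Mackey functor\<close>

lemma (in comm_group) cross_mult_imp_quotient_eq:
  assumes eq: "a \<otimes> d = c \<otimes> b" and cl: "a \<in> carrier G" "b \<in> carrier G" "c \<in> carrier G" "d \<in> carrier G"
  shows "c \<otimes> inv d = a \<otimes> inv b"
proof -
  have "c \<otimes> inv d = c \<otimes> (b \<otimes> inv b) \<otimes> inv d" using cl by simp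
  also have "\<dots> = (c \<otimes> b) \<otimes> (inv b \<otimes> inv d)" using cl by (simp only: m_assoc m_closed inv_closed)
  also have "\<dots> = (a \<otimes> d) \<otimes> (inv d \<otimes> inv b)" using cl eq m_comm[of "inv b" "inv d"] by simp
  also have "\<dots> = a \<otimes> (d \<otimes> inv d) \<otimes> inv b" using cl by (simp only: m_assoc m_closed inv_closed)
  finally show ?thesis using cl by simp
qed

locale mackey_functor = gsets G points
  for G :: "('g, 'b) monoid_scheme" (structure) and points :: "'u itself" +
  fixes M :: "('g, 'u, 'm) mackey"
  assumes is_mackey: "is_mackey G M"
begin

lemma is_bifunctor: "is_bifunctor G M"
  using is_mackey by (simp add: is_mackey_def)

lemma comm_group_val: "is_gset G S \<Longrightarrow> comm_group (val M S)"
  using is_bifunctor[unfolded is_bifunctor_def, THEN conjunct1] by blast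

lemma
  assumes "is_gset G S" "is_gset G T" "f \<in> gmaps G S T"
  shows cov_hom: "cov M S T f \<in> hom (val M S) (val M T)"
    and con_hom: "con M S T f \<in> hom (val M T) (val M S)"
  using is_bifunctor[unfolded is_bifunctor_def, THEN conjunct2, THEN conjunct1] assms by blast+

lemma
  assumes "is_gset G S" "is_gset G T" "f \<in> gmaps G S T"
  shows cov_closed: "x \<in> carrier (val M S) \<Longrightarrow> cov M S T f x \<in> carrier (val M T)"
    and con_closed: "y \<in> carrier (val M T) \<Longrightarrow> con M S T f y \<in> carrier (val M S)"
  using hom_in_carrier[OF cov_hom[OF assms]] hom_in_carrier[OF con_hom[OF assms]] by auto

lemma
  assumes "is_gset G S" "is_gset G T" "f \<in> gmaps G S T"
  shows cov_group_hom: "group_hom (val M S) (val M T) (cov M S T f)"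
    and con_group_hom: "group_hom (val M T) (val M S) (con M S T f)"
  using cov_hom[OF assms] con_hom[OF assms] comm_group_val[OF assms(1)] comm_group_val[OF assms(2)]
  by (auto simp: group_hom_def group_hom_axioms_def comm_group_def)

lemma
  assumes "is_gset G S" "x \<in> carrier (val M S)"
  shows cov_id: "cov M S S (\<lambda>s\<in>fst S. s) x = x" and con_id: "con M S S (\<lambda>s\<in>fst S. s) x = x"
  using is_bifunctor[unfolded is_bifunctor_def, THEN conjunct2, THEN conjunct2, THEN conjunct1] assms by blast+

lemma
  assumes "is_gset G S" "is_gset G T" "is_gset G U" "f \<in> gmaps G S T" "g \<in> gmaps G T U"
  shows cov_comp: "x \<in> carrier (val M S) \<Longrightarrow> cov M S U (compose (fst S) g f) x = cov M T U g (cov M S T f x)"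
    and con_comp: "y \<in> carrier (val M U) \<Longrightarrow> con M S U (compose (fst S) g f) y = con M S T f (con M T U g y)"
  using is_bifunctor[unfolded is_bifunctor_def, THEN conjunct2, THEN conjunct2, THEN conjunct2] assms by blast+

lemma con_cov:
  assumes "is_pullback G S S1 S2 T p q f g" "x \<in> carrier (val M S2)"
  shows "con M S1 T f (cov M S2 T g x) = cov M S S1 p (con M S S2 q x)"
  using is_mackey[unfolded is_mackey_def, THEN conjunct2, THEN conjunct1] assms by blast

lemma con_disj_union_inj:
  assumes "is_disj_union G S S1 S2 i j"
  shows "inj_on (\<lambda>x. (con M S1 S i x, con M S2 S j x)) (carrier (val M S))"
proof -
  have "(\<lambda>x. (con M S1 S i x, con M S2 S j x)) \<in> iso (val M S) (val M S1 \<times>\<times> val M S2)"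
    using is_mackey[unfolded is_mackey_def, THEN conjunct2, THEN conjunct2, THEN conjunct1] assms by blast
  then show ?thesis by (simp add: iso_def bij_betw_def)
qed

lemma val_empty: "is_gset G S \<Longrightarrow> fst S = {} \<Longrightarrow> x \<in> carrier (val M S) \<Longrightarrow> x = \<one>\<^bsub>val M S\<^esub>"
  using is_mackey[unfolded is_mackey_def, THEN conjunct2, THEN conjunct2, THEN conjunct2] by blast

text \<open>For an injective map the square with identities as projections is a pullback.\<close>

lemma con_cov_inj:
  assumes X: "is_gset G X" and Y: "is_gset G Y" and h: "h \<in> gmaps G X Y" and inj: "inj_on h (fst X)"
    and x: "x \<in> carrier (val M X)"
  shows "con M X Y h (cov M X Y h x) = x"
proof -
  have "is_pullback G X X X Y (\<lambda>s\<in>fst X. s) (\<lambda>s\<in>fst X. s) h h"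
    unfolding is_pullback_def bij_betw_def
    using X Y h gmaps_id[OF X] inj by (auto simp: inj_on_def image_iff)
  from con_cov[OF this x] show ?thesis using X x by (simp add: cov_id con_id)
qed

lemma cov_con_bij:
  assumes X: "is_gset G X" and Y: "is_gset G Y" and h: "h \<in> gmaps G X Y" and bij: "bij_betw h (fst X) (fst Y)"
    and y: "y \<in> carrier (val M Y)"
  shows "cov M X Y h (con M X Y h y) = y"
proof -
  have "(\<lambda>s. (h s, h s)) ` fst X = {(a, b). a \<in> fst Y \<and> b \<in> fst Y \<and> (\<lambda>s\<in>fst Y. s) a = (\<lambda>s\<in>fst Y. s) b}"
    unfolding bij_betw_imp_surj_on[OF bij, symmetric] by auto
  moreover have "inj_on (\<lambda>s. (h s, h s)) (fst X)" using bij by (auto simp: bij_betw_def inj_on_def)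
  ultimately have "is_pullback G X Y Y Y h h (\<lambda>s\<in>fst Y. s) (\<lambda>s\<in>fst Y. s)"
    unfolding is_pullback_def bij_betw_def
    using X Y h gmaps_id[OF Y] by simp
  from con_cov[OF this y] show ?thesis using Y y by (simp add: cov_id con_id)
qed

text \<open>The pullback of two maps with disjoint images is empty, and a Mackey functor vanishes on the empty \<open>G\<close>-set.\<close>

lemma con_cov_disjoint:
  assumes U: "is_disj_union G Z X Y i j" and y: "y \<in> carrier (val M Y)"
  shows "con M X Z i (cov M Y Z j y) = \<one>\<^bsub>val M X\<^esub>"
proof -
  have gs: "is_gset G Z" "is_gset G X" "is_gset G Y" and i: "i \<in> gmaps G X Z" and j: "j \<in> gmaps G Y Z"
    and disj: "i ` fst X \<inter> j ` fst Y = {}"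
    using U by (auto simp: is_disj_union_def)
  let ?e = "\<lambda>x. undefined :: 'u"
  have e: "?e \<in> gmaps G empty_gset X" "?e \<in> gmaps G empty_gset Y"
    by (auto simp: gmaps_def empty_gset_def)
  have "is_pullback G empty_gset X Y Z ?e ?e i j"
    unfolding is_pullback_def bij_betw_def
    using gs is_gset_empty i j e disj by (auto simp: empty_gset_def)
  from con_cov[OF this y]
  have "con M X Z i (cov M Y Z j y) = cov M empty_gset X ?e (con M empty_gset Y ?e y)" .
  also have "con M empty_gset Y ?e y = \<one>\<^bsub>val M empty_gset\<^esub>"
    by (rule val_empty[OF is_gset_empty _ con_closed[OF is_gset_empty gs(3) e(2) y]]) (simp add: empty_gset_def)
  also have "cov M empty_gset X ?e \<one>\<^bsub>val M empty_gset\<^esub> = \<one>\<^bsub>val M X\<^esub>"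
    by (rule group_hom.hom_one[OF cov_group_hom[OF is_gset_empty gs(2) e(1)]])
  finally show ?thesis .
qed

lemma disj_union_sym: "is_disj_union G Z X Y i j \<Longrightarrow> is_disj_union G Z Y X j i"
  by (auto simp: is_disj_union_def)

text \<open>Both sides have the same restrictions to the two summands, which suffices by additivity.\<close>

lemma disj_union_decomp:
  assumes U: "is_disj_union G Z X Y i j" and z: "z \<in> carrier (val M Z)"
  shows "z = cov M X Z i (con M X Z i z) \<otimes>\<^bsub>val M Z\<^esub> cov M Y Z j (con M Y Z j z)"
proof -
  have gs: "is_gset G Z" "is_gset G X" "is_gset G Y" and i: "i \<in> gmaps G X Z" "inj_on i (fst X)"
    and j: "j \<in> gmaps G Y Z" "inj_on j (fst Y)"
    using U by (auto simp: is_disj_union_def)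
  interpret Z: comm_group "val M Z" by (rule comm_group_val[OF gs(1)])
  interpret X: comm_group "val M X" by (rule comm_group_val[OF gs(2)])
  interpret Y: comm_group "val M Y" by (rule comm_group_val[OF gs(3)])
  note ci = con_closed[OF gs(2,1) i(1) z] and cj = con_closed[OF gs(3,1) j(1) z]
  note cci = cov_closed[OF gs(2,1) i(1) ci] and ccj = cov_closed[OF gs(3,1) j(1) cj]
  let ?w = "cov M X Z i (con M X Z i z) \<otimes>\<^bsub>val M Z\<^esub> cov M Y Z j (con M Y Z j z)"
  have "con M X Z i ?w = con M X Z i z"
    by (simp add: group_hom.hom_mult[OF con_group_hom[OF gs(2,1) i(1)]] cci ccj
        con_cov_inj[OF gs(2,1) i ci] con_cov_disjoint[OF U cj] ci)
  moreover have "con M Y Z j ?w = con M Y Z j z"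
    by (simp add: group_hom.hom_mult[OF con_group_hom[OF gs(3,1) j(1)]] cci ccj
        con_cov_inj[OF gs(3,1) j cj] con_cov_disjoint[OF disj_union_sym[OF U] ci] cj)
  ultimately show ?thesis
    using inj_onD[OF con_disj_union_inj[OF U], of z ?w] z cci ccj by simp
qed

definition over_act :: "('g, 'u) gset \<Rightarrow> ('g, 'u) gset \<Rightarrow> ('u \<Rightarrow> 'u) \<Rightarrow> 'm \<Rightarrow> 'm" where
  "over_act S X f x = cov M X S f (con M X S f x)"

lemma over_act_hom:
  assumes "is_gset G X" "is_gset G S" "f \<in> gmaps G X S"
  shows "over_act S X f \<in> hom (val M S) (val M S)"
  using con_hom[OF assms] cov_hom[OF assms] by (auto simp: hom_def Pi_iff over_act_def)

lemma over_act_iso: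
  assumes gs: "is_gset G X" "is_gset G Y" "is_gset G S" and f: "f \<in> gmaps G X S" and g: "g \<in> gmaps G Y S"
    and h: "h \<in> gmaps G X Y" "bij_betw h (fst X) (fst Y)" "\<And>x. x \<in> fst X \<Longrightarrow> g (h x) = f x"
    and x: "x \<in> carrier (val M S)"
  shows "over_act S X f x = over_act S Y g x"
proof -
  have f_eq: "f = compose (fst X) g h"
    using gmapsD(2)[OF f] h(3) by (auto simp: compose_def extensional_def fun_eq_iff)
  note gx = con_closed[OF gs(2,3) g x]
  have "over_act S X f x = cov M Y S g (cov M X Y h (con M X Y h (con M Y S g x)))"
    unfolding over_act_def f_eq con_comp[OF gs h(1) g x]
    by (rule cov_comp[OF gs h(1) g con_closed[OF gs(1,2) h(1) gx]])
  then show ?thesis unfolding cov_con_bij[OF gs(1,2) h(1,2) gx] over_act_def .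
qed

text \<open>By \<open>disj_union_decomp\<close>, applied to the restriction of \<open>x\<close> to the union, and functoriality.\<close>

lemma over_act_disj_union:
  assumes S: "is_gset G S" and U: "is_disj_union G Z X Y i j" and h: "h \<in> gmaps G Z S"
    and f: "f \<in> gmaps G X S" "\<And>x. x \<in> fst X \<Longrightarrow> h (i x) = f x"
    and g: "g \<in> gmaps G Y S" "\<And>y. y \<in> fst Y \<Longrightarrow> h (j y) = g y"
    and x: "x \<in> carrier (val M S)"
  shows "over_act S Z h x = over_act S X f x \<otimes>\<^bsub>val M S\<^esub> over_act S Y g x"
proof -
  have gs: "is_gset G Z" "is_gset G X" "is_gset G Y" and i: "i \<in> gmaps G X Z" and j: "j \<in> gmaps G Y Z"
    using U by (auto simp: is_disj_union_def)
  have f_eq: "f = compose (fst X) h i"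
    using gmapsD(2)[OF f(1)] f(2) by (auto simp: compose_def extensional_def fun_eq_iff)
  have g_eq: "g = compose (fst Y) h j"
    using gmapsD(2)[OF g(1)] g(2) by (auto simp: compose_def extensional_def fun_eq_iff)
  let ?z = "con M Z S h x"
  note z = con_closed[OF gs(1) S h x]
  note ci = con_closed[OF gs(2,1) i z] and cj = con_closed[OF gs(3,1) j z]
  have "over_act S Z h x = cov M Z S h (cov M X Z i (con M X Z i ?z) \<otimes>\<^bsub>val M Z\<^esub> cov M Y Z j (con M Y Z j ?z))"
    unfolding over_act_def using disj_union_decomp[OF U z] by simp
  also have "\<dots> = cov M Z S h (cov M X Z i (con M X Z i ?z)) \<otimes>\<^bsub>val M S\<^esub> cov M Z S h (cov M Y Z j (con M Y Z j ?z))"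
    by (rule group_hom.hom_mult[OF cov_group_hom[OF gs(1) S h] cov_closed[OF gs(2,1) i ci] cov_closed[OF gs(3,1) j cj]])
  also have "cov M Z S h (cov M X Z i (con M X Z i ?z)) = over_act S X f x"
    unfolding over_act_def f_eq con_comp[OF gs(2,1) S i h x] cov_comp[OF gs(2,1) S i h ci] ..
  also have "cov M Z S h (cov M Y Z j (con M Y Z j ?z)) = over_act S Y g x"
    unfolding over_act_def g_eq con_comp[OF gs(3,1) S j h x] cov_comp[OF gs(3,1) S j h cj] ..
  finally show ?thesis .
qed

text \<open>Isomorphic \<open>G\<close>-sets over \<open>S\<close> act alike, so the set of values in \<^const>\<open>class_act\<close> is indeed a singleton.\<close>

lemma class_act_eq:
  assumes S: "is_gset G S" and Xf: "(X, f) \<in> mark_class S v" and x: "x \<in> carrier (val M S)"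
  shows "class_act M S (mark_class S v) x = over_act S X f x"
proof -
  have "over_act S Y g x = over_act S X f x" if Yg: "(Y, g) \<in> mark_class S v" for Y g
  proof -
    have *: "(Y, g) \<in> gsets_over G S" "(X, f) \<in> gsets_over G S" "marks Y g = marks X f"
      using Xf Yg by (auto simp: mark_class_def)
    obtain h where "h \<in> gmaps G Y X" "bij_betw h (fst Y) (fst X)" "\<And>y. y \<in> fst Y \<Longrightarrow> f (h y) = g y"
      using marks_eq_imp_iso[OF *] by blast
    with * S x show ?thesis by (intro over_act_iso) (auto simp: gsets_over_iff)
  qed
  then have "(\<lambda>(X, f). cov M X S f (con M X S f x)) ` mark_class S v = {over_act S X f x}"
    using Xf by (force simp: over_act_def)
  then show ?thesis unfolding class_act_def by simp
qed

lemma class_act_hom: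
  assumes S: "is_gset G S" and v: "realizable S v"
  shows "class_act M S (mark_class S v) \<in> hom (val M S) (val M S)"
proof -
  obtain X f where X: "(X, f) \<in> mark_class S v" "is_gset G X" "f \<in> gmaps G X S" "marks X f = v"
    using v by (rule realizable_obtain)
  interpret comm_group "val M S" by (rule comm_group_val[OF S])
  show ?thesis using over_act_hom[OF X(2) S X(3)] by (auto simp: hom_def class_act_eq[OF S X(1)] Pi_iff)
qed

lemma class_act_closed:
  assumes "is_gset G S" "realizable S v" "x \<in> carrier (val M S)"
  shows "class_act M S (mark_class S v) x \<in> carrier (val M S)"
  by (rule hom_in_carrier[OF class_act_hom[OF assms(1,2)] assms(3)])

lemma class_act_plus:
  assumes S: "is_gset G S" and v: "realizable S v" and w: "realizable S w" and x: "x \<in> carrier (val M S)"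
  shows "class_act M S (mark_class S (v + w)) x = class_act M S (mark_class S v) x \<otimes>\<^bsub>val M S\<^esub> class_act M S (mark_class S w) x"
proof -
  obtain X f where X: "(X, f) \<in> mark_class S v" "is_gset G X" "f \<in> gmaps G X S" "marks X f = v"
    using v by (rule realizable_obtain)
  obtain Y g where Y: "(Y, g) \<in> mark_class S w" "is_gset G Y" "g \<in> gmaps G Y S" "marks Y g = w"
    using w by (rule realizable_obtain)
  obtain Z i j where U: "is_disj_union G Z X Y i j" using ex_disj_union[OF X(2) Y(2)] .
  obtain h where h: "h \<in> gmaps G Z S" "\<And>x. x \<in> fst X \<Longrightarrow> h (i x) = f x" "\<And>y. y \<in> fst Y \<Longrightarrow> h (j y) = g y"
    using disj_union_map[OF U X(3) Y(3)] by blast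
  have "marks Z h = v + w" using marks_disj_union[OF U h(2,3)] X(4) Y(4) by (auto simp: fun_eq_iff)
  then have Z: "(Z, h) \<in> mark_class S (v + w)"
    using U h(1) by (simp add: is_disj_union_def gsets_over_iff mark_class_def)
  show ?thesis unfolding class_act_eq[OF S X(1) x] class_act_eq[OF S Y(1) x] class_act_eq[OF S Z x]
    by (rule over_act_disj_union[OF S U h(1) X(3) h(2) Y(3) h(3) x])
qed

text \<open>Additivity of \<^const>\<open>class_act\<close> makes the value independent of the representing pair, so that the set of values in
  \<^const>\<open>burnside_act\<close> is a singleton.\<close>

lemma burnside_act_diff:
  assumes S: "is_gset G S" and v: "realizable S v" and w: "realizable S w" and x: "x \<in> carrier (val M S)"
  shows "burnside_act M S (burnside_diff S v w) x =
    class_act M S (mark_class S v) x \<otimes>\<^bsub>val M S\<^esub> inv\<^bsub>val M S\<^esub> class_act M S (mark_class S w) x"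
proof -
  interpret V: comm_group "val M S" by (rule comm_group_val[OF S])
  let ?c = "\<lambda>v. class_act M S (mark_class S v) x"
  let ?F = "\<lambda>(a, b). class_act M S a x \<otimes>\<^bsub>val M S\<^esub> inv\<^bsub>val M S\<^esub> class_act M S b x"
  note cl = class_act_closed[OF S _ x]
  have self: "(mark_class S v, mark_class S w) \<in> burnside_diff S v w"
    unfolding burnside_diff_def using v w
    by (intro comm_monoid.groth_class_self[OF comm_monoid_burnside] mark_class_closed)
  have "?F ab = ?F (mark_class S v, mark_class S w)" if ab: "ab \<in> burnside_diff S v w" for ab
  proof -
    obtain a b where ab_eq: "ab = (a, b)" by (cases ab)
    have rel: "((mark_class S v, mark_class S w), (a, b)) \<in> groth_rel (burnside_monoid G S)"
      using ab unfolding ab_eq burnside_diff_def comm_monoid.mem_groth_class[OF comm_monoid_burnside] .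
    then have "a \<in> carrier (burnside_monoid G S)" "b \<in> carrier (burnside_monoid G S)"
      by (simp_all add: comm_monoid.groth_rel_iff[OF comm_monoid_burnside])
    then obtain v' w' where v': "realizable S v'" "a = mark_class S v'" and w': "realizable S w'" "b = mark_class S w'"
      by (metis burnside_monoid_cases)
    have "burnside_diff S v w = burnside_diff S v' w'"
      using comm_monoid.groth_class_eqI[OF comm_monoid_burnside rel] v' w' by (simp add: burnside_diff_def)
    then have "v + w' = v' + w" using v w v' w' by (simp add: burnside_diff_eq_iff)
    then have "?c v \<otimes>\<^bsub>val M S\<^esub> ?c w' = ?c v' \<otimes>\<^bsub>val M S\<^esub> ?c w"
      using class_act_plus[OF S _ _ x] v w v' w' by metis
    then have "?c v' \<otimes>\<^bsub>val M S\<^esub> inv\<^bsub>val M S\<^esub> ?c w' = ?c v \<otimes>\<^bsub>val M S\<^esub> inv\<^bsub>val M S\<^esub> ?c w"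
      using cl[OF v] cl[OF w] cl[OF v'(1)] cl[OF w'(1)] by (rule V.cross_mult_imp_quotient_eq)
    then show ?thesis using v' w' ab_eq by simp
  qed
  then have "?F ` burnside_diff S v w = {?F (mark_class S v, mark_class S w)}"
    using self by blast
  then show ?thesis unfolding burnside_act_def by simp
qed

lemma burnside_act_closed:
  assumes S: "is_gset G S" and u: "u \<in> carrier (val (burnside G) S)" and x: "x \<in> carrier (val M S)"
  shows "burnside_act M S u x \<in> carrier (val M S)"
proof -
  interpret V: comm_group "val M S" by (rule comm_group_val[OF S])
  obtain v w where u: "realizable S v" "realizable S w" "u = burnside_diff S v w" using u by (rule burnside_cases)
  show ?thesis using class_act_closed[OF S _ x] u by (simp add: burnside_act_diff[OF S _ _ x])
qed

lemma burnside_act_mult: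
  assumes S: "is_gset G S" and u: "u \<in> carrier (val (burnside G) S)" and u': "u' \<in> carrier (val (burnside G) S)"
    and x: "x \<in> carrier (val M S)"
  shows "burnside_act M S (u \<otimes>\<^bsub>val (burnside G) S\<^esub> u') x = burnside_act M S u x \<otimes>\<^bsub>val M S\<^esub> burnside_act M S u' x"
proof -
  interpret V: comm_group "val M S" by (rule comm_group_val[OF S])
  obtain v w where u: "realizable S v" "realizable S w" "u = burnside_diff S v w" using u by (rule burnside_cases)
  obtain v' w' where u': "realizable S v'" "realizable S w'" "u' = burnside_diff S v' w'" using u' by (rule burnside_cases)
  show ?thesis using class_act_closed[OF S _ x] u(1,2) u'(1,2) unfolding u(3) u'(3)
    by (simp add: burnside_act_diff[OF S _ _ x] mult_burnside_diff realizable_plus class_act_plus[OF S _ _ x] V.m_ac V.inv_mult)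
qed

lemma burnside_act_hom_left:
  assumes S: "is_gset G S" and x: "x \<in> carrier (val M S)"
  shows "group_hom (val (burnside G) S) (val M S) (\<lambda>u. burnside_act M S u x)"
  using comm_group_burnside[of S] comm_group_val[OF S] burnside_act_closed[OF S _ x] burnside_act_mult[OF S _ _ x]
  by (auto simp: group_hom_def group_hom_axioms_def comm_group_def hom_def)

lemma burnside_act_hom:
  assumes S: "is_gset G S" and u: "u \<in> carrier (val (burnside G) S)"
  shows "group_hom (val M S) (val M S) (burnside_act M S u)"
proof -
  interpret V: comm_group "val M S" by (rule comm_group_val[OF S])
  obtain v w where uu: "realizable S v" "realizable S w" "u = burnside_diff S v w" using u by (rule burnside_cases)
  have "burnside_act M S u \<in> hom (val M S) (val M S)"
  proof (rule homI)
    fix x y assume xy: "x \<in> carrier (val M S)" "y \<in> carrier (val M S)"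
    show "burnside_act M S u (x \<otimes>\<^bsub>val M S\<^esub> y) = burnside_act M S u x \<otimes>\<^bsub>val M S\<^esub> burnside_act M S u y"
      using xy class_act_closed[OF S uu(1)] class_act_closed[OF S uu(2)]
        hom_mult[OF class_act_hom[OF S uu(1)]] hom_mult[OF class_act_hom[OF S uu(2)]]
      unfolding uu(3)
      by (simp add: burnside_act_diff[OF S uu(1,2)] V.m_ac V.inv_mult)
  qed (rule burnside_act_closed[OF S u])
  then show ?thesis by unfold_locales
qed

text \<open>Immediate from functoriality: acting by \<open>X \<rightarrow> S \<rightarrow> T\<close> passes through \<open>S\<close> in both directions.\<close>

lemma burnside_act_push:
  assumes S: "is_gset G S" and T: "is_gset G T" and phi: "\<phi> \<in> gmaps G S T"
    and u: "u \<in> carrier (val (burnside G) S)" and y: "y \<in> carrier (val M T)"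
  shows "burnside_act M T (cov (burnside G) S T \<phi> u) y = cov M S T \<phi> (burnside_act M S u (con M S T \<phi> y))"
proof -
  obtain v w where u: "realizable S v" "realizable S w" "u = burnside_diff S v w" using u by (rule burnside_cases)
  interpret C: group_hom "val M S" "val M T" "cov M S T \<phi>" by (rule cov_group_hom[OF S T phi])
  note z = con_closed[OF S T phi y]
  have *: "class_act M T (mark_class T (mark_push S \<phi> v)) y = cov M S T \<phi> (class_act M S (mark_class S v) (con M S T \<phi> y))"
    if v: "realizable S v" for v
  proof -
    obtain X f where X: "(X, f) \<in> mark_class S v" "is_gset G X" "f \<in> gmaps G X S" "marks X f = v"
      using v by (rule realizable_obtain)
    note phif = gmaps_compose[OF X(3) phi X(2)]
    have mem: "(X, compose (fst X) \<phi> f) \<in> mark_class T (mark_push S \<phi> v)"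
      using phif X marks_compose[OF X(2) gset_finite[OF S] X(3), of \<phi>]
      by (auto simp: mark_class_def gsets_over_iff mark_push_def fun_eq_iff)
    show ?thesis
      unfolding class_act_eq[OF T mem y] class_act_eq[OF S X(1) z] over_act_def
        con_comp[OF X(2) S T X(3) phi y] cov_comp[OF X(2) S T X(3) phi con_closed[OF X(2) S X(3) z]] ..
  qed
  show ?thesis
    unfolding u(3) cov_burnside_diff[OF S phi u(1,2)] burnside_act_diff[OF S u(1,2) z]
      burnside_act_diff[OF T class_push_mark_class(2)[OF S phi u(1)] class_push_mark_class(2)[OF S phi u(2)] y] *[OF u(1)] *[OF u(2)]
    using class_act_closed[OF S u(1) z] class_act_closed[OF S u(2) z] by simp
qed

text \<open>Frobenius reciprocity. If \<open>X\<close> lies over \<open>T\<close> and \<open>P\<close> is its pullback to \<open>S\<close>, then, by (M1), restricting \<open>\<phi>\<^sub>* x\<close> to \<open>X\<close>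
  amounts to restricting \<open>x\<close> to \<open>P\<close> and inducing to \<open>X\<close>; inducing further to \<open>T\<close> may as well be done through \<open>S\<close>.\<close>

lemma burnside_act_cov:
  assumes S: "is_gset G S" and T: "is_gset G T" and phi: "\<phi> \<in> gmaps G S T"
    and u: "u \<in> carrier (val (burnside G) T)" and x: "x \<in> carrier (val M S)"
  shows "burnside_act M T u (cov M S T \<phi> x) = cov M S T \<phi> (burnside_act M S (con (burnside G) S T \<phi> u) x)"
proof -
  obtain v w where u: "realizable T v" "realizable T w" "u = burnside_diff T v w" using u by (rule burnside_cases)
  interpret C: group_hom "val M S" "val M T" "cov M S T \<phi>" by (rule cov_group_hom[OF S T phi])
  note z = cov_closed[OF S T phi x]
  have *: "class_act M T (mark_class T v) (cov M S T \<phi> x) = cov M S T \<phi> (class_act M S (mark_class S (mark_pull S \<phi> v)) x)"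
    if v: "realizable T v" for v
  proof -
    obtain X f where X: "(X, f) \<in> mark_class T v" "is_gset G X" "f \<in> gmaps G X T" "marks X f = v"
      using v by (rule realizable_obtain)
    obtain P p q where P: "is_pullback G P S X T p q \<phi> f" using ex_pullback[OF S X(2) T phi X(3)] .
    have PP: "is_gset G P" and p: "p \<in> gmaps G P S" and q: "q \<in> gmaps G P X"
      and bij: "bij_betw (\<lambda>s. (p s, q s)) (fst P) {(a, b). a \<in> fst S \<and> b \<in> fst X \<and> \<phi> a = f b}"
      using P by (simp_all add: is_pullback_def)
    have mem: "(P, p) \<in> mark_class S (mark_pull S \<phi> v)"
      using PP p marks_pullback[OF P] X(4)
      by (auto simp: mark_class_def gsets_over_iff mark_pull_def fun_eq_iff)
    have comm: "compose (fst P) f q = compose (fst P) \<phi> p"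
      using bij_betwE[OF bij] by (auto simp: compose_def fun_eq_iff)
    note px = con_closed[OF PP S p x]
    have "class_act M T (mark_class T v) (cov M S T \<phi> x) = cov M X T f (cov M P X q (con M P S p x))"
      unfolding class_act_eq[OF T X(1) z] over_act_def con_cov[OF pullback_sym[OF P] x] ..
    also have "\<dots> = cov M P T (compose (fst P) \<phi> p) (con M P S p x)"
      unfolding cov_comp[OF PP X(2) T q X(3) px, symmetric] comm ..
    also have "\<dots> = cov M S T \<phi> (class_act M S (mark_class S (mark_pull S \<phi> v)) x)"
      unfolding cov_comp[OF PP S T p phi px] class_act_eq[OF S mem x] over_act_def ..
    finally show ?thesis .
  qed
  note r = class_pull_mark_class(2)[OF S T phi u(1)] class_pull_mark_class(2)[OF S T phi u(2)]
  show ?thesis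
    unfolding u(3) con_burnside_diff[OF S T phi u(1,2)] burnside_act_diff[OF T u(1,2) z]
      burnside_act_diff[OF S r x] *[OF u(1)] *[OF u(2)]
    using class_act_closed[OF S r(1) x] class_act_closed[OF S r(2) x] by simp
qed

end

lemma burnside_act_natural:
  fixes G :: "('g, 'b) monoid_scheme"
    and M :: "('g, 'u, 'm) mackey" and N :: "('g, 'u, 'n) mackey"
  assumes "mackey_functor G M" "mackey_functor G N" and T: "nat_transf G M N \<Theta>"
    and S: "is_gset G S" and u: "u \<in> carrier (val (burnside G) S)" and x: "x \<in> carrier (val M S)"
  shows "\<Theta> S (burnside_act M S u x) = burnside_act N S u (\<Theta> S x)"
proof -
  interpret M: mackey_functor G "TYPE('u)" M by fact
  interpret N: mackey_functor G "TYPE('u)" N by fact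
  interpret VM: comm_group "val M S" by (rule M.comm_group_val[OF S])
  interpret VN: comm_group "val N S" by (rule N.comm_group_val[OF S])
  interpret \<Theta>: group_hom "val M S" "val N S" "\<Theta> S"
    by unfold_locales (use T[unfolded nat_transf_def, THEN conjunct1] S in blast)
  have *: "\<Theta> S (class_act M S (M.mark_class S v) x) = class_act N S (M.mark_class S v) (\<Theta> S x)"
    if v: "M.realizable S v" for v
  proof -
    obtain X f where X: "(X, f) \<in> M.mark_class S v" "is_gset G X" "f \<in> gmaps G X S" "M.marks X f = v"
      using v by (rule M.realizable_obtain)
    have nat: "\<Theta> S (cov M X S f y) = cov N X S f (\<Theta> X y)" "\<Theta> X (con M X S f z) = con N X S f (\<Theta> S z)"
      if "y \<in> carrier (val M X)" "z \<in> carrier (val M S)" for y z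
      using T X(2,3) S that unfolding nat_transf_def by blast+
    show ?thesis unfolding M.class_act_eq[OF S X(1) x] N.class_act_eq[OF S X(1) \<Theta>.hom_closed[OF x]]
      M.over_act_def N.over_act_def
      using nat M.con_closed[OF X(2) S X(3) x] x by simp
  qed
  obtain v w where u: "M.realizable S v" "M.realizable S w" "u = M.burnside_diff S v w"
    using u by (rule M.burnside_cases)
  show ?thesis
    unfolding u(3) M.burnside_act_diff[OF S u(1,2) x] N.burnside_act_diff[OF S u(1,2) \<Theta>.hom_closed[OF x]] *[OF u(1), symmetric] *[OF u(2), symmetric]
    using M.class_act_closed[OF S u(1) x] M.class_act_closed[OF S u(2) x] by simp
qed

section \<open>The ideal of a Mackey functor\<close>

lemma (in gsets) point_gset_eq: "point_gset G = gset_of {undefined} (\<lambda>g x. x)"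
  by (simp add: point_gset_def gset_of_def)

lemma (in gsets) is_gset_point: "is_gset G (point_gset G :: ('g, 'u) gset)"
  unfolding point_gset_eq by (rule is_gset_of) auto

lemma (in gsets) to_point_gmaps:
  fixes S :: "('g, 'u) gset"
  assumes "is_gset G S"
  shows "to_point S \<in> gmaps G S (point_gset G)"
  unfolding to_point_def point_gset_eq by (rule restrict_gmaps[OF _ assms]) auto

context mackey_functor
begin

text \<open>The covariant half of the definition follows from the contravariant half at the identity of \<open>S\<close>, because
  \<open>\<phi>\<^sub>*(a)\<close> acts through the action of \<open>a\<close> on \<open>M(S)\<close>.\<close>

lemma mem_burnside_ideal:
  assumes S: "is_gset G S"
  shows "a \<in> burnside_ideal G M S \<longleftrightarrow> a \<in> carrier (val (burnside G) S) \<and>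
    (\<forall>U \<psi>. is_gset G U \<and> \<psi> \<in> gmaps G U S \<longrightarrow>
      (\<forall>z\<in>carrier (val M U). burnside_act M U (con (burnside G) U S \<psi> a) z = \<one>\<^bsub>val M U\<^esub>))"
    (is "_ \<longleftrightarrow> ?c \<and> ?con")
proof -
  have "burnside_act M T (cov (burnside G) S T \<phi> a) y = \<one>\<^bsub>val M T\<^esub>"
    if c: ?c and con: ?con and T: "is_gset G T" and phi: "\<phi> \<in> gmaps G S T" and y: "y \<in> carrier (val M T)" for T \<phi> y
  proof -
    have "burnside_act M S (con (burnside G) S S (\<lambda>s\<in>fst S. s) a) (con M S T \<phi> y) = \<one>\<^bsub>val M S\<^esub>"
      using con S gmaps_id[OF S] con_closed[OF S T phi y] by blast
    then have "burnside_act M S a (con M S T \<phi> y) = \<one>\<^bsub>val M S\<^esub>" by (simp only: con_burnside_id[OF S c])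
    then show ?thesis using burnside_act_push[OF S T phi c y] group_hom.hom_one[OF cov_group_hom[OF S T phi]] by simp
  qed
  then show ?thesis unfolding burnside_ideal_def by blast
qed

lemma subgroup_burnside_ideal:
  assumes S: "is_gset G S"
  shows "subgroup (burnside_ideal G M S) (val (burnside G) S)"
proof -
  interpret A: comm_group "val (burnside G) S" by (rule comm_group_burnside)
  show ?thesis
  proof (rule A.subgroupI)
    show "burnside_ideal G M S \<subseteq> carrier (val (burnside G) S)" by (auto simp: burnside_ideal_def)
    have gh: "group_hom (val (burnside G) S) (val M U) (\<lambda>a. burnside_act M U (con (burnside G) U S \<psi> a) z)"
      if "is_gset G U" "\<psi> \<in> gmaps G U S" "z \<in> carrier (val M U)" for U \<psi> z
    proof -
      interpret g: group_hom "val (burnside G) U" "val M U" "\<lambda>u. burnside_act M U u z"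
        by (rule burnside_act_hom_left[OF that(1,3)])
      show ?thesis
        by unfold_locales
          (use con_burnside_hom[OF that(1) S that(2)] g.homh in \<open>auto simp: hom_def Pi_iff\<close>)
    qed
    have "\<one>\<^bsub>val (burnside G) S\<^esub> \<in> burnside_ideal G M S"
      unfolding mem_burnside_ideal[OF S] using group_hom.hom_one[OF gh] by auto
    then show "burnside_ideal G M S \<noteq> {}" by blast
    show "inv\<^bsub>val (burnside G) S\<^esub> a \<in> burnside_ideal G M S" if "a \<in> burnside_ideal G M S" for a
      using that unfolding mem_burnside_ideal[OF S]
    proof (elim conjE, intro conjI allI impI ballI)
      fix U \<psi> z assume a: "a \<in> carrier (val (burnside G) S)" and U: "is_gset G U \<and> \<psi> \<in> gmaps G U S" and z: "z \<in> carrier (val M U)"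
        and "\<forall>U \<psi>. is_gset G U \<and> \<psi> \<in> gmaps G U S \<longrightarrow>
          (\<forall>z\<in>carrier (val M U). burnside_act M U (con (burnside G) U S \<psi> a) z = \<one>\<^bsub>val M U\<^esub>)"
      then have "burnside_act M U (con (burnside G) U S \<psi> a) z = \<one>\<^bsub>val M U\<^esub>" by blast
      then show "burnside_act M U (con (burnside G) U S \<psi> (inv\<^bsub>val (burnside G) S\<^esub> a)) z = \<one>\<^bsub>val M U\<^esub>"
        using group_hom.hom_inv[OF gh[OF conjunct1[OF U] conjunct2[OF U] z] a]
          comm_group.axioms(2)[OF comm_group_val[OF conjunct1[OF U]]]
        by (simp add: group_def monoid.inv_one)
    qed simp
    show "a \<otimes>\<^bsub>val (burnside G) S\<^esub> b \<in> burnside_ideal G M S"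
      if a: "a \<in> burnside_ideal G M S" and b: "b \<in> burnside_ideal G M S" for a b
      unfolding mem_burnside_ideal[OF S]
    proof (intro conjI allI impI ballI)
      have ab: "a \<in> carrier (val (burnside G) S)" "b \<in> carrier (val (burnside G) S)"
        using a b by (auto simp: burnside_ideal_def)
      then show "a \<otimes>\<^bsub>val (burnside G) S\<^esub> b \<in> carrier (val (burnside G) S)" by simp
      fix U \<psi> z assume U: "is_gset G U \<and> \<psi> \<in> gmaps G U S" and z: "z \<in> carrier (val M U)"
      interpret V: comm_group "val M U" by (rule comm_group_val) (use U in blast)
      have "burnside_act M U (con (burnside G) U S \<psi> a) z = \<one>\<^bsub>val M U\<^esub>" "burnside_act M U (con (burnside G) U S \<psi> b) z = \<one>\<^bsub>val M U\<^esub>"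
        using a b U z unfolding mem_burnside_ideal[OF S] by blast+
      then show "burnside_act M U (con (burnside G) U S \<psi> (a \<otimes>\<^bsub>val (burnside G) S\<^esub> b)) z = \<one>\<^bsub>val M U\<^esub>"
        using group_hom.hom_mult[OF gh[OF conjunct1[OF U] conjunct2[OF U] z] ab] by simp
    qed
  qed
qed

text \<open>By base change, a restriction of \<open>\<phi>\<^sub>*(a)\<close> to \<open>U\<close> is induced from a restriction of \<open>a\<close> to a pullback, and the
  latter acts as zero.\<close>

lemma cov_burnside_ideal:
  assumes S: "is_gset G S" and T: "is_gset G T" and phi: "\<phi> \<in> gmaps G S T"
  shows "cov (burnside G) S T \<phi> ` burnside_ideal G M S \<subseteq> burnside_ideal G M T"
proof (rule image_subsetI)
  fix a assume aI: "a \<in> burnside_ideal G M S"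
  then have a: "a \<in> carrier (val (burnside G) S)" by (simp add: mem_burnside_ideal[OF S])
  show "cov (burnside G) S T \<phi> a \<in> burnside_ideal G M T"
    unfolding mem_burnside_ideal[OF T]
  proof (intro conjI allI impI ballI)
    show "cov (burnside G) S T \<phi> a \<in> carrier (val (burnside G) T)" by (rule cov_burnside_closed[OF S phi a])
    fix U \<psi> z assume "is_gset G U \<and> \<psi> \<in> gmaps G U T" and z: "z \<in> carrier (val M U)"
    then have U: "is_gset G U" and psi: "\<psi> \<in> gmaps G U T" by auto
    obtain P p q where P: "is_pullback G P U S T p q \<psi> \<phi>" using ex_pullback[OF U S T psi phi] .
    then have PP: "is_gset G P" and p: "p \<in> gmaps G P U" and q: "q \<in> gmaps G P S" by (simp_all add: is_pullback_def)
    note pz = con_closed[OF PP U p z]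
    have "burnside_act M P (con (burnside G) P S q a) (con M P U p z) = \<one>\<^bsub>val M P\<^esub>"
      using aI PP q pz unfolding mem_burnside_ideal[OF S] by blast
    then show "burnside_act M U (con (burnside G) U T \<psi> (cov (burnside G) S T \<phi> a)) z = \<one>\<^bsub>val M U\<^esub>"
      unfolding con_cov_burnside[OF P a] burnside_act_push[OF PP U p con_burnside_closed[OF PP S q a] z]
      using group_hom.hom_one[OF cov_group_hom[OF PP U p]] by simp
  qed
qed

text \<open>The criterion \<open>tensor_map_surj_iff\<close> for the quotient groups, rewritten in terms of representatives in the Burnside ring.\<close>

lemma dress_generating_iff:
  assumes Y: "\<And>p. prime p \<Longrightarrow> is_gset G (hyper_gset G p X :: ('g, 'u) gset)"
  shows "dress_generating G M X \<longleftrightarrow>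
    (\<forall>p::nat. prime p \<longrightarrow> (\<forall>a\<in>carrier (val (burnside G) (point_gset G)). \<exists>n. \<not> p dvd n \<and>
      (\<exists>b\<in>carrier (val (burnside G) (hyper_gset G p X)).
        a [^]\<^bsub>val (burnside G) (point_gset G)\<^esub> n \<otimes>\<^bsub>val (burnside G) (point_gset G)\<^esub>
        inv\<^bsub>val (burnside G) (point_gset G)\<^esub> cov (burnside G) (hyper_gset G p X) (point_gset G) (to_point (hyper_gset G p X)) b
        \<in> burnside_ideal G M (point_gset G))))"
proof -
  have "tensor_map (val (burnside_quotient G M) P) (int_localized p)
          (cov (burnside_quotient G M) Y P (to_point Y)) (\<lambda>z. z) ` carrier (tensor (val (burnside_quotient G M) Y) (int_localized p))
        = carrier (tensor (val (burnside_quotient G M) P) (int_localized p)) \<longleftrightarrow>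
      (\<forall>a\<in>carrier (val (burnside G) P). \<exists>n. \<not> p dvd n \<and>
        (\<exists>b\<in>carrier (val (burnside G) Y). a [^]\<^bsub>val (burnside G) P\<^esub> n \<otimes>\<^bsub>val (burnside G) P\<^esub>
          inv\<^bsub>val (burnside G) P\<^esub> cov (burnside G) Y P (to_point Y) b \<in> burnside_ideal G M P))"
    if p: "prime p" and Y: "is_gset G Y" and P: "P = point_gset G" for p :: nat and Y P :: "('g, 'u) gset"
  proof -
    let ?A = "val (burnside G) Y" and ?B = "val (burnside G) P" and ?f = "cov (burnside G) Y P (to_point Y)"
    let ?I = "burnside_ideal G M"
    interpret A: comm_group ?A by (rule comm_group_burnside)
    interpret B: comm_group ?B by (rule comm_group_burnside)
    have PP: "is_gset G P" using is_gset_point P by simp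
    have f: "to_point Y \<in> gmaps G Y P" using to_point_gmaps[OF Y] P by simp
    note sY = subgroup_burnside_ideal[OF Y] and sP = subgroup_burnside_ideal[OF PP]
    note nY = A.subgroup_imp_normal[OF sY] and nP = B.subgroup_imp_normal[OF sP]
    have v: "val (burnside_quotient G M) S = val (burnside G) S Mod ?I S" for S :: "('g, 'u) gset"
      by (simp add: burnside_quotient_def green_quotient_def)
    have cov: "cov (burnside_quotient G M) Y P (to_point Y) (?I Y #>\<^bsub>?A\<^esub> a) = ?I P #>\<^bsub>?B\<^esub> ?f a" if "a \<in> carrier ?A" for a
      using coset_map_eq[OF nY sP B.is_group cov_burnside_hom[OF Y f] cov_burnside_ideal[OF Y PP f] that]
      by (simp add: burnside_quotient_def green_quotient_def)
    have fc: "?f a \<in> carrier ?B" if "a \<in> carrier ?A" for a by (rule cov_burnside_closed[OF Y f that])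
    have fm: "?f (a \<otimes>\<^bsub>?A\<^esub> b) = ?f a \<otimes>\<^bsub>?B\<^esub> ?f b" if "a \<in> carrier ?A" "b \<in> carrier ?A" for a b
      by (rule hom_mult[OF cov_burnside_hom[OF Y f] that])
    have hom: "cov (burnside_quotient G M) Y P (to_point Y) \<in> hom (?A Mod ?I Y) (?B Mod ?I P)"
    proof (rule homI)
      fix C assume "C \<in> carrier (?A Mod ?I Y)"
      then obtain a where a: "a \<in> carrier ?A" "C = ?I Y #>\<^bsub>?A\<^esub> a" by (auto simp: carrier_FactGroup)
      then show "cov (burnside_quotient G M) Y P (to_point Y) C \<in> carrier (?B Mod ?I P)"
        using fc[OF a(1)] by (auto simp: carrier_FactGroup cov)
      fix D assume "D \<in> carrier (?A Mod ?I Y)"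
      then obtain b where b: "b \<in> carrier ?A" "D = ?I Y #>\<^bsub>?A\<^esub> b" by (auto simp: carrier_FactGroup)
      show "cov (burnside_quotient G M) Y P (to_point Y) (C \<otimes>\<^bsub>?A Mod ?I Y\<^esub> D) =
        cov (burnside_quotient G M) Y P (to_point Y) C \<otimes>\<^bsub>?B Mod ?I P\<^esub> cov (burnside_quotient G M) Y P (to_point Y) D"
        unfolding a(2) b(2) mult_FactGroup normal.rcos_sum[OF nY a(1) b(1)] cov[OF a(1)] cov[OF b(1)]
          normal.rcos_sum[OF nP fc[OF a(1)] fc[OF b(1)]]
        using a(1) b(1) by (simp add: cov fm)
    qed
    have img: "cov (burnside_quotient G M) Y P (to_point Y) ` carrier (?A Mod ?I Y) = (\<lambda>b. ?I P #>\<^bsub>?B\<^esub> ?f b) ` carrier ?A"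
      unfolding carrier_FactGroup image_image by (rule image_cong[OF refl cov])
    have "(?I P #>\<^bsub>?B\<^esub> a) [^]\<^bsub>?B Mod ?I P\<^esub> n \<in> cov (burnside_quotient G M) Y P (to_point Y) ` carrier (?A Mod ?I Y) \<longleftrightarrow>
      (\<exists>b\<in>carrier ?A. a [^]\<^bsub>?B\<^esub> n \<otimes>\<^bsub>?B\<^esub> inv\<^bsub>?B\<^esub> ?f b \<in> ?I P)" if a: "a \<in> carrier ?B" for a and n :: nat
    proof -
      have "(?I P #>\<^bsub>?B\<^esub> a) [^]\<^bsub>?B Mod ?I P\<^esub> n = ?I P #>\<^bsub>?B\<^esub> (a [^]\<^bsub>?B\<^esub> n)"
        by (rule normal.FactGroup_pow[OF nP a])
      then have "(?I P #>\<^bsub>?B\<^esub> a) [^]\<^bsub>?B Mod ?I P\<^esub> n \<in> cov (burnside_quotient G M) Y P (to_point Y) ` carrier (?A Mod ?I Y) \<longleftrightarrow>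
        (\<exists>b\<in>carrier ?A. ?I P #>\<^bsub>?B\<^esub> (a [^]\<^bsub>?B\<^esub> n) = ?I P #>\<^bsub>?B\<^esub> ?f b)"
        unfolding img image_iff by simp
      also have "\<dots> \<longleftrightarrow> (\<exists>b\<in>carrier ?A. a [^]\<^bsub>?B\<^esub> n \<otimes>\<^bsub>?B\<^esub> inv\<^bsub>?B\<^esub> ?f b \<in> ?I P)"
        by (intro bex_cong refl coset_eq_iff[OF sP B.is_group B.nat_pow_closed[OF a] fc])
      finally show ?thesis .
    qed
    then show ?thesis
      unfolding v tensor_map_surj_iff[OF A.abelian_FactGroup[OF sY] B.abelian_FactGroup[OF sP] hom p]
      by (simp add: carrier_FactGroup)
  qed
  note key = this
  show ?thesis
    unfolding dress_generating_def dress_generating_green_def Let_def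
    by (intro all_cong1 imp_cong key Y refl)
qed

end

section \<open>The G-set of a family\<close>

context gset_theory
begin

lemma conj_subgroup_eq:
  assumes "g \<in> carrier G" "H \<subseteq> carrier G"
  shows "conj_subgroup G g H = (\<lambda>h. g \<otimes> h \<otimes> inv g) ` H"
  unfolding conj_subgroup_def l_coset_def r_coset_def by auto

lemma conj_one: "H \<subseteq> carrier G \<Longrightarrow> conj_subgroup G \<one> H = H"
  by (subst conj_subgroup_eq) (auto simp: subset_iff image_iff)

lemma conj_conj:
  assumes "g \<in> carrier G" "h \<in> carrier G" "H \<subseteq> carrier G"
  shows "conj_subgroup G g (conj_subgroup G h H) = conj_subgroup G (g \<otimes> h) H"
proof -
  have "conj_subgroup G h H \<subseteq> carrier G" using assms by (auto simp: conj_subgroup_eq)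
  then have "conj_subgroup G g (conj_subgroup G h H) = (\<lambda>x. g \<otimes> (h \<otimes> x \<otimes> inv h) \<otimes> inv g) ` H"
    using assms by (simp add: conj_subgroup_eq image_image)
  also have "\<dots> = (\<lambda>x. (g \<otimes> h) \<otimes> x \<otimes> inv (g \<otimes> h)) ` H"
    using assms by (intro image_cong refl) (auto simp: inv_mult_group m_assoc subset_iff)
  finally show ?thesis using assms by (simp add: conj_subgroup_eq)
qed

lemma ex_conjugacy_representatives:
  assumes sub: "\<And>H. H \<in> C \<Longrightarrow> H \<subseteq> carrier G"
  obtains R where "R \<subseteq> C" "\<And>H. H \<in> C \<Longrightarrow> \<exists>!K. K \<in> R \<and> (\<exists>g\<in>carrier G. K = conj_subgroup G g H)"
proof -
  define rel where "rel H K \<longleftrightarrow> (\<exists>g\<in>carrier G. K = conj_subgroup G g H)" for H K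
  have refl: "rel H H" if "H \<in> C" for H
    unfolding rel_def using conj_one[OF sub[OF that]] one_closed by metis
  have sym: "rel K H" if "rel H K" "H \<in> C" for H K
    using that conj_conj[OF _ _ sub] conj_one[OF sub] unfolding rel_def by (metis inv_closed l_inv)
  have trans: "rel H L" if "rel H K" "rel K L" "H \<in> C" for H K L
    using that conj_conj[OF _ _ sub] unfolding rel_def by (metis m_closed)
  define r where "r H = (SOME K. K \<in> C \<and> rel H K)" for H
  have r: "r H \<in> C" "rel H (r H)" if "H \<in> C" for H
    using someI[of "\<lambda>K. K \<in> C \<and> rel H K" H] refl[OF that] that unfolding r_def by auto
  have eq: "r H = r H'" if "H \<in> C" "H' \<in> C" "rel H H'" for H H'
  proof -
    have "rel H K \<longleftrightarrow> rel H' K" for K using that sym trans by blast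
    then show ?thesis unfolding r_def by simp
  qed
  have "\<exists>!K. K \<in> r ` C \<and> rel H K" if H: "H \<in> C" for H
  proof (rule ex1I[of _ "r H"])
    show "r H \<in> r ` C \<and> rel H (r H)" using r[OF H] H by blast
    fix K assume K: "K \<in> r ` C \<and> rel H K"
    then obtain H' where H': "H' \<in> C" "K = r H'" by blast
    have "rel H H'" using trans[of H K H'] sym[of H' K] K H' r(2)[OF H'(1)] H by simp
    then show "K = r H" using eq H H' by metis
  qed
  moreover have "r ` C \<subseteq> C" using r(1) by blast
  ultimately show thesis using that unfolding rel_def by blast
qed

lemma coset_sum_eq: "coset_sum G R = gset_of (SIGMA H:R. lcosets\<^bsub>G\<^esub> H) (\<lambda>g (H, C). (H, g <#\<^bsub>G\<^esub> C))"
  by (simp add: coset_sum_def gset_of_def)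

lemma is_gset_coset_sum:
  assumes fin: "finite (carrier G)" and sub: "\<And>H. H \<in> R \<Longrightarrow> subgroup H G"
  shows "is_gset G (coset_sum G R)"
proof -
  have Hc: "H \<subseteq> carrier G" if "H \<in> R" for H using sub[OF that] by (rule subgroup.subset)
  have Cc: "C \<subseteq> carrier G" if "H \<in> R" "C \<in> lcosets H" for H C
    using lcosets_subset_PowG[OF sub[OF that(1)]] that(2) by blast
  have "finite R" using fin Hc by (meson finite_Pow_iff finite_subset PowI subsetI)
  moreover have "finite (lcosets H)" if "H \<in> R" for H
    using fin Cc[OF that] by (meson finite_Pow_iff finite_subset PowI subsetI)
  ultimately have "finite (SIGMA H:R. lcosets H)" by (rule finite_SigmaI)
  then show ?thesis unfolding coset_sum_eq
  proof (rule is_gset_of)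
    fix g x assume g: "g \<in> carrier G" and "x \<in> (SIGMA H:R. lcosets H)"
    then obtain H a where x: "x = (H, a <# H)" "H \<in> R" "a \<in> carrier G" by (auto simp: LCOSETS_def)
    then show "(case x of (H, C) \<Rightarrow> (H, g <# C)) \<in> (SIGMA H:R. lcosets H)"
      using g lcos_m_assoc[OF Hc[OF x(2)] g x(3)] by (auto simp: LCOSETS_def)
  qed (auto simp: lcos_mult_one Cc lcos_m_assoc[OF Cc, symmetric])
qed

end

context gsets
begin

text \<open>The choice in \<^const>\<open>gset_of_family\<close> is not vacuous: representatives exist and their coset spaces can be moved into
  \<open>'u\<close>. Each member of \<open>F\<close> lies in a maximal one, which is conjugate to a representative and so fixes a coset;
  conversely, the stabilizers of points are conjugate to representatives.\<close>

lemma gset_of_family: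
  assumes sub: "\<And>H. H \<in> F \<Longrightarrow> subgroup H G"
  shows is_gset_of_family: "is_gset G (gset_of_family G F :: ('g, 'u) gset)"
    and member_fixes_point: "\<And>H. H \<in> F \<Longrightarrow> \<exists>y\<in>fst (gset_of_family G F :: ('g, 'u) gset). fixed_by (gset_of_family G F) H y"
    and fixes_point_imp_subconjugate: "\<And>H y. y \<in> fst (gset_of_family G F :: ('g, 'u) gset) \<Longrightarrow> fixed_by (gset_of_family G F) H y \<Longrightarrow> H \<subseteq> carrier G \<Longrightarrow>
      \<exists>K\<in>F. \<exists>g\<in>carrier G. \<forall>h\<in>H. inv g \<otimes> h \<otimes> g \<in> K"
proof -
  let ?spec = "\<lambda>Y :: ('g, 'u) gset. is_gset G Y \<and>
     (\<exists>R \<subseteq> maximal_in F.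
        (\<forall>H\<in>maximal_in F. \<exists>!K. K \<in> R \<and> (\<exists>g\<in>carrier G. K = conj_subgroup G g H)) \<and>
        gset_iso G (coset_sum G R) Y)"
  have max: "H \<in> F" if "H \<in> maximal_in F" for H using that by (simp add: maximal_in_def)
  have "\<exists>Y. ?spec Y"
  proof -
    obtain R where R: "R \<subseteq> maximal_in F"
      "\<And>H. H \<in> maximal_in F \<Longrightarrow> \<exists>!K. K \<in> R \<and> (\<exists>g\<in>carrier G. K = conj_subgroup G g H)"
      using ex_conjugacy_representatives[of "maximal_in F"] subgroup.subset[OF sub[OF max]] by blast
    have "is_gset G (coset_sum G R)" using is_gset_coset_sum finite_carrier sub max R(1) by blast
    then obtain Y :: "('g, 'u) gset" and e where "is_gset G Y" "e \<in> gmaps G (coset_sum G R) Y" "bij_betw e (fst (coset_sum G R)) (fst Y)"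
      using transport by blast
    then have Y: "is_gset G Y" "gset_iso G (coset_sum G R) Y" unfolding gset_iso_def by (auto intro!: bexI[of _ e])
    show ?thesis by (intro exI[of _ Y] conjI exI[of _ R] ballI Y R)
  qed
  then have "?spec (gset_of_family G F)" unfolding gset_of_family_def by (rule someI_ex)
  then obtain R e where Y: "is_gset G (gset_of_family G F :: ('g, 'u) gset)" and R: "R \<subseteq> maximal_in F"
    "\<And>H. H \<in> maximal_in F \<Longrightarrow> \<exists>!K. K \<in> R \<and> (\<exists>g\<in>carrier G. K = conj_subgroup G g H)"
    and e: "e \<in> gmaps G (coset_sum G R) (gset_of_family G F :: ('g, 'u) gset)"
      "bij_betw e (fst (coset_sum G R)) (fst (gset_of_family G F :: ('g, 'u) gset))"
    unfolding gset_iso_def by (elim conjE exE bexE) (rule that, (assumption | erule bspec)+)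
  show "is_gset G (gset_of_family G F :: ('g, 'u) gset)" by (rule Y)
  have subR: "subgroup K G" if "K \<in> R" for K using that R(1) max sub by blast
  have cs: "is_gset G (coset_sum G R)" by (rule is_gset_coset_sum[OF finite_carrier subR])
  have fst_cs: "fst (coset_sum G R) = (SIGMA H:R. lcosets H)" by (simp add: coset_sum_def)
  have act: "snd (coset_sum G R) g (K, C) = (K, g <# C)" if "g \<in> carrier G" "K \<in> R" "C \<in> lcosets K" for g K C
    using that by (simp add: coset_sum_def)
  show "\<exists>y\<in>fst (gset_of_family G F :: ('g, 'u) gset). fixed_by (gset_of_family G F) H y" if H: "H \<in> F" for H
  proof -
    have "F \<subseteq> Pow (carrier G)" using sub subgroup.subset by blast
    then have "finite F" using finite_carrier finite_subset by blast
    then obtain L where L: "L \<in> F" "H \<subseteq> L" "\<forall>b\<in>F. L \<subseteq> b \<longrightarrow> L = b"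
      using finite_has_maximal2[OF _ H] by blast
    then have "L \<in> maximal_in F" by (auto simp: maximal_in_def)
    then obtain K g where K: "K \<in> R" "g \<in> carrier G" "K = conj_subgroup G g L" using R(2) by blast
    interpret K: subgroup K G by (rule subR[OF K(1)])
    have Lc: "L \<subseteq> carrier G" using sub[OF L(1)] by (rule subgroup.subset)
    have mem: "(K, inv g <# K) \<in> fst (coset_sum G R)" using K(1,2) by (auto simp: fst_cs LCOSETS_def)
    have "fixed_by (coset_sum G R) H (K, inv g <# K)"
      unfolding fixed_by_def
    proof
      fix h assume "h \<in> H \<inter> carrier G"
      then have h: "h \<in> L" "h \<in> carrier G" using L(2) by auto
      have "g \<otimes> h \<otimes> inv g \<in> K" using h K Lc by (simp add: conj_subgroup_eq)
      then have "inv g \<otimes> (g \<otimes> h \<otimes> inv g) \<in> inv g <# K" by (auto simp: l_coset_def)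
      also have "inv g \<otimes> (g \<otimes> h \<otimes> inv g) = h \<otimes> inv g" using h K by (simp add: m_assoc[symmetric])
      finally have "(h \<otimes> inv g) <# K = inv g <# K"
        using l_repr_independence[OF _ _ subR[OF K(1)]] K(2) by simp
      then have "h <# (inv g <# K) = inv g <# K" using lcos_m_assoc[OF K.subset h(2)] K(2) by simp
      then show "snd (coset_sum G R) h (K, inv g <# K) = (K, inv g <# K)"
        using act[OF h(2) K(1), of "inv g <# K"] inv_closed[OF K(2)] by (auto simp: LCOSETS_def)
    qed
    then show ?thesis using fixed_by_image[OF e(1) mem] gmapsD(1)[OF e(1) mem] by blast
  qed
  show "\<exists>K\<in>F. \<exists>g\<in>carrier G. \<forall>h\<in>H. inv g \<otimes> h \<otimes> g \<in> K"
    if y: "y \<in> fst (gset_of_family G F :: ('g, 'u) gset)" and fix_y: "fixed_by (gset_of_family G F) H y" and H: "H \<subseteq> carrier G" for H y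
  proof -
    obtain c where c: "c \<in> fst (coset_sum G R)" "y = e c"
      using y unfolding bij_betw_imp_surj_on[OF e(2), symmetric] by blast
    then obtain K g where K: "K \<in> R" "g \<in> carrier G" "c = (K, g <# K)" by (auto simp: fst_cs LCOSETS_def)
    interpret K: subgroup K G by (rule subR[OF K(1)])
    have fix_c: "fixed_by (coset_sum G R) H c"
      using fix_y fixed_by_inj[OF e(1) bij_betw_imp_inj_on[OF e(2)] cs c(1)] c(2) by simp
    have "inv g \<otimes> h \<otimes> g \<in> K" if h: "h \<in> H" for h
    proof -
      have hc: "h \<in> carrier G" using h H by blast
      have "snd (coset_sum G R) h c = c" using fix_c h hc by (auto simp: fixed_by_def)
      then have "h <# (g <# K) = g <# K" using act[OF hc K(1), of "g <# K"] K(2,3) by (auto simp: LCOSETS_def)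
      then have "(h \<otimes> g) <# K = g <# K" using lcos_m_assoc[OF K.subset hc K(2)] by simp
      then have "h \<otimes> g \<in> g <# K" using lcos_self[OF _ subR[OF K(1)], of "h \<otimes> g"] hc K(2) by simp
      then have "inv g \<otimes> (h \<otimes> g) \<in> K" using K.lcos_module_imp[OF is_group K(2)] by simp
      then show ?thesis using hc K(2) by (simp add: m_assoc)
    qed
    then show ?thesis using K R(1) max by blast
  qed
qed

end

section \<open>Integer-valued functions modulo a prime\<close>

locale function_rng =
  fixes L :: "('i \<Rightarrow> int) set"
  assumes zero: "(\<lambda>i. 0) \<in> L"
    and diff: "u \<in> L \<Longrightarrow> v \<in> L \<Longrightarrow> (\<lambda>i. u i - v i) \<in> L"
    and mult: "u \<in> L \<Longrightarrow> v \<in> L \<Longrightarrow> (\<lambda>i. u i * v i) \<in> L"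
begin

lemma uminus: "u \<in> L \<Longrightarrow> (\<lambda>i. - u i) \<in> L"
  using diff[OF zero] by simp

lemma add: "u \<in> L \<Longrightarrow> v \<in> L \<Longrightarrow> (\<lambda>i. u i + v i) \<in> L"
  using diff[OF _ uminus] by simp

lemma scale:
  assumes "u \<in> L"
  shows "(\<lambda>i. c * u i) \<in> L"
proof -
  have nat: "(\<lambda>i. int n * u i) \<in> L" for n
    by (induction n) (simp_all add: zero add assms distrib_right)
  show ?thesis
  proof (cases "c \<ge> 0")
    case True
    then show ?thesis using nat[of "nat c"] by simp
  next
    case False
    then show ?thesis using uminus[OF nat[of "nat (- c)"]] by simp
  qed
qed

text \<open>The product is a polynomial in \<open>u\<close> with integer coefficients; multiplied by a member of \<open>L\<close> it stays in \<open>L\<close>.\<close>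

lemma mult_prod:
  assumes "finite J" "x \<in> L" "u \<in> L"
  shows "(\<lambda>i. x i * (\<Prod>j\<in>J. c j - u i)) \<in> L"
  using assms(1)
proof induction
  case (insert j J)
  have "(\<lambda>i. c j * (x i * (\<Prod>j\<in>J. c j - u i)) - u i * (x i * (\<Prod>j\<in>J. c j - u i))) \<in> L"
    by (intro diff scale mult insert.IH assms)
  then show ?case using insert.hyps by (simp add: algebra_simps)
qed (simp add: assms)

text \<open>Expanding the second product, the constant term cancels and the other terms lie in \<open>L\<close>.\<close>

lemma prod_diff:
  assumes "finite J" "u \<in> L"
  shows "(\<lambda>i. (\<Prod>j\<in>J. c j) - (\<Prod>j\<in>J. c j - u i)) \<in> L"
  using assms(1)
proof induction
  case (insert j J)
  have "(\<lambda>i. c j * ((\<Prod>j\<in>J. c j) - (\<Prod>j\<in>J. c j - u i)) + u i * (\<Prod>j\<in>J. c j - u i)) \<in> L"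
    by (intro add scale mult_prod insert.IH insert.hyps assms)
  then show ?case using insert.hyps by (simp add: algebra_simps)
qed (simp add: zero)

text \<open>Induction on \<open>J\<close>. If \<open>u\<close> works on \<open>J\<close> but is divisible by \<open>p\<close> at the new point \<open>i\<close>, add to it a function \<open>w\<close> that vanishes on
  all of \<open>J\<close> and is prime to \<open>p\<close> at \<open>i\<close>.\<close>

lemma ex_nonzero_mod:
  assumes p: "prime p" and "finite J" "\<And>j. j \<in> J \<Longrightarrow> \<exists>v\<in>L. \<not> int p dvd v j"
  shows "\<exists>u\<in>L. \<forall>j\<in>J. \<not> int p dvd u j"
  using assms(2,3)
proof induction
  case empty
  then show ?case using zero by blast
next
  case (insert i J)
  then obtain u where u: "u \<in> L" "\<And>j. j \<in> J \<Longrightarrow> \<not> int p dvd u j" by blast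
  show ?case
  proof (cases "int p dvd u i")
    case False
    then show ?thesis using u by blast
  next
    case True
    obtain v where v: "v \<in> L" "\<not> int p dvd v i" using insert.prems by blast
    define w where "w k = v k * (\<Prod>j\<in>J. u j - u k)" for k
    have w: "w \<in> L" unfolding w_def by (rule mult_prod[OF insert.hyps(1) v(1) u(1)])
    have "w j = 0" if "j \<in> J" for j
      using insert.hyps(1) that unfolding w_def by auto
    then have "\<not> int p dvd u j + w j" if "j \<in> J" for j using u(2)[OF that] that by simp
    moreover have "\<not> int p dvd u i + w i"
    proof
      have pp: "prime (int p)" using p by simp
      assume "int p dvd u i + w i"
      then have "int p dvd w i" using True by (simp add: dvd_add_right_iff)
      then have "int p dvd (\<Prod>j\<in>J. u j - u i)" using v(2) pp by (simp add: w_def prime_dvd_mult_iff)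
      then obtain j where "j \<in> J" "int p dvd u j - u i"
        unfolding prime_dvd_prod_iff[OF insert.hyps(1) pp] by blast
      then have "int p dvd u j" using dvd_add[of "int p" "u j - u i" "u i"] True by simp
      then show False using u(2)[OF \<open>j \<in> J\<close>] by blast
    qed
    ultimately show ?thesis by (intro bexI[OF _ add[OF u(1) w]]) auto
  qed
qed

text \<open>With \<open>u\<close> from \<open>ex_nonzero_mod\<close>, the product of the \<open>u j - u\<close> vanishes on \<open>J\<close>; its constant term is prime to \<open>p\<close>, and
  minus the remaining terms is the required member of \<open>L\<close>.\<close>

lemma ex_constant_unit_mod:
  assumes p: "prime p" and J: "finite J" and "\<And>j. j \<in> J \<Longrightarrow> \<exists>v\<in>L. \<not> int p dvd v j"
  shows "\<exists>u\<in>L. \<exists>n::nat. \<not> p dvd n \<and> (\<forall>j\<in>J. u j = int n)"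
proof -
  obtain u where u: "u \<in> L" "\<And>j. j \<in> J \<Longrightarrow> \<not> int p dvd u j" using ex_nonzero_mod[OF assms] by blast
  define n where "n = (\<Prod>j\<in>J. u j)"
  define v where "v i = n - (\<Prod>j\<in>J. u j - u i)" for i
  have v: "v \<in> L" unfolding v_def n_def by (rule prod_diff[OF J u(1)])
  have vn: "v j = n" if "j \<in> J" for j using J that unfolding v_def by auto
  have pp: "prime (int p)" using p by simp
  have "\<not> int p dvd n" unfolding n_def prime_dvd_prod_iff[OF J pp] using u(2) by blast
  then have "\<not> p dvd nat \<bar>n\<bar>" by (simp add: dvd_nat_abs_iff)
  \<comment> \<open>\<open>n\<close> may be negative\<close>
  moreover have "(\<lambda>i. sgn n * v i) \<in> L" by (rule scale[OF v])
  moreover have "sgn n * v j = int (nat \<bar>n\<bar>)" if "j \<in> J" for j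
    using vn[OF that] by (simp add: sgn_if)
  ultimately show ?thesis by (intro bexI[of _ "\<lambda>i. sgn n * v i"] exI[of _ "nat \<bar>n\<bar>"]) auto
qed

end

section \<open>p-perfect subgroups\<close>

context gset_theory
begin

text \<open>Every orbit with more than one point has size divisible by \<open>p\<close> and may be removed.\<close>

lemma card_fixed_points_mod:
  fixes Z :: "('a, 'v) gset"
  assumes "prime p" "is_gset G Z" "\<And>z. z \<in> fst Z \<Longrightarrow> card (gorbit Z z) dvd p ^ k"
  shows "card (fst Z) mod p = card {z \<in> fst Z. \<forall>g\<in>carrier G. snd Z g z = z} mod p"
  using assms(2,3)
proof (induction "card (fst Z)" arbitrary: Z rule: less_induct)
  case less
  note Z = less.prems(1) and orb = less.prems(2)
  have fin: "finite (fst Z)" by (rule gset_finite[OF Z])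
  show ?case
  proof (cases "\<forall>z\<in>fst Z. \<forall>g\<in>carrier G. snd Z g z = z")
    case True
    then have "{z \<in> fst Z. \<forall>g\<in>carrier G. snd Z g z = z} = fst Z" by blast
    then show ?thesis by simp
  next
    case False
    then obtain z g where z: "z \<in> fst Z" and g: "g \<in> carrier G" "snd Z g z \<noteq> z" by blast
    let ?O = "gorbit Z z"
    note O = gorbit_invariant[OF Z z]
    have finO: "finite ?O" using fin O(1) finite_subset by blast
    have "snd Z g z \<in> ?O" using O(2,3) g(1) by blast
    then have "card ?O \<noteq> 1" using O(2) g(2) by (auto simp: card_1_singleton_iff)
    moreover obtain i where "card ?O = p ^ i" using orb[OF z] assms(1) by (auto simp: divides_primepow_nat)
    ultimately have pO: "p dvd card ?O" by (cases i) auto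
    have nofix: "\<not> (\<forall>h\<in>carrier G. snd Z h u = u)" if "u \<in> ?O" for u
    proof
      assume fix_u: "\<forall>h\<in>carrier G. snd Z h u = u"
      obtain a where a: "a \<in> carrier G" "u = snd Z a z"
        using \<open>u \<in> ?O\<close> by (auto simp: gorbit_def)
      then have "z = snd Z (inv a) u" using gset_inv(1)[OF Z a(1) z] by simp
      then have "z = u" using fix_u a by simp
      then show False using fix_u g by simp
    qed
    let ?Z = "sub_gset Z (fst Z - ?O)"
    have Z': "is_gset G ?Z" by (rule is_gset_sub[OF Z Diff_subset O(4)])
    have fst': "fst ?Z = fst Z - ?O" by (simp add: sub_gset_def)
    have "card (fst ?Z) < card (fst Z)"
      unfolding fst' using fin z O(2) by (intro psubset_card_mono) auto
    moreover have "gorbit ?Z u = gorbit Z u" if "u \<in> fst ?Z" for u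
      using that by (auto simp: gorbit_def sub_gset_def)
    ultimately have "card (fst ?Z) mod p = card {u \<in> fst ?Z. \<forall>h\<in>carrier G. snd ?Z h u = u} mod p"
      using less.hyps[OF _ Z'] orb fst' by simp
    moreover have "{u \<in> fst ?Z. \<forall>h\<in>carrier G. snd ?Z h u = u} = {u \<in> fst Z. \<forall>h\<in>carrier G. snd Z h u = u}"
    proof -
      have eq: "snd ?Z h u = snd Z h u" if "u \<in> fst Z - ?O" "h \<in> carrier G" for u h
        using that by (simp add: sub_gset_def)
      then have "{u \<in> fst ?Z. \<forall>h\<in>carrier G. snd ?Z h u = u} = {u \<in> fst Z - ?O. \<forall>h\<in>carrier G. snd Z h u = u}"
        unfolding fst' by (intro Collect_cong conj_cong ball_cong refl) simp
      also have "\<dots> = {u \<in> fst Z. \<forall>h\<in>carrier G. snd Z h u = u}" using nofix by blast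
      finally show ?thesis .
    qed
    moreover have "card (fst Z) = card (fst ?Z) + card ?O"
      unfolding fst' using card_Diff_subset[OF finO O(1)] card_mono[OF fin O(1)] by simp
    ultimately show ?thesis using pO by (auto simp: mod_add_right_eq[symmetric])
  qed
qed

definition fixcard :: "('a, 'v) gset \<Rightarrow> 'a set \<Rightarrow> nat" where
  "fixcard Z H = card {z \<in> fst Z. fixed_by Z H z}"

lemma stabilizer_subgroup_gset:
  assumes "is_gset G Z" "z \<in> fst Z"
  shows "subgroup {g \<in> carrier G. snd Z g z = z} G"
  using group_action.stabilizer_subgroup[of G "fst Z" "snd Z" z] assms by (simp add: is_gset_def stabilizer_def)

text \<open>The \<open>p\<close>-group \<open>H/N\<close> acts on the points fixed by \<open>N\<close>, and its fixed points are those of \<open>H\<close>. Instead of the quotient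
  group, \<open>H\<close> itself is used: its orbits on this set have size dividing the index of \<open>N\<close>.\<close>

lemma fixcard_normal_mod:
  fixes Z :: "('a, 'v) gset"
  assumes fin: "finite (carrier G)" and p: "prime p" and Z: "is_gset G Z" and H: "subgroup H G"
    and N: "N \<lhd> G\<lparr>carrier := H\<rparr>" and ord: "order (G\<lparr>carrier := H\<rparr> Mod N) = p ^ k"
  shows "fixcard Z H mod p = fixcard Z N mod p"
proof -
  let ?H = "G\<lparr>carrier := H\<rparr>"
  interpret H: group ?H by (rule subgroup_imp_group[OF H])
  interpret H: gset_theory ?H by unfold_locales
  interpret N: normal N ?H by (rule N)
  have Hc: "H \<subseteq> carrier G" by (rule subgroup.subset[OF H])
  have NH: "N \<subseteq> H" using N.subset by simp
  have finH: "finite H" using fin Hc finite_subset by blast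
  have Nc: "N \<subseteq> carrier G" using NH Hc by blast
  let ?E = "{z \<in> fst Z. fixed_by Z N z}"
  let ?W = "H.gset_of ?E (snd Z)"
  have inv_eq: "inv\<^bsub>?H\<^esub> h = inv h" if "h \<in> H" for h by (rule m_inv_consistent[OF H that])
  have W: "is_gset ?H ?W"
  proof (rule H.is_gset_of)
    show "finite ?E" using gset_finite[OF Z] by simp
    fix h z assume h: "h \<in> carrier ?H" and z: "z \<in> ?E"
    then have hH: "h \<in> H" and hG: "h \<in> carrier G" and zZ: "z \<in> fst Z" using Hc by auto
    have "snd Z n (snd Z h z) = snd Z h z" if n: "n \<in> N" for n
    proof -
      have nG: "n \<in> carrier G" using n Nc by blast
      have "inv h \<otimes> n \<otimes> h \<in> N" using N.inv_op_closed1[of h n] h n inv_eq[OF hH] by simp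
      then have "snd Z (inv h \<otimes> n \<otimes> h) z = z" using z Nc by (auto simp: fixed_by_def)
      then have "snd Z h (snd Z (inv h \<otimes> n \<otimes> h) z) = snd Z h z" by simp
      moreover have "snd Z h (snd Z (inv h \<otimes> n \<otimes> h) z) = snd Z (h \<otimes> (inv h \<otimes> n \<otimes> h)) z"
        using gset_mult[OF Z hG _ zZ] hG nG by simp
      moreover have "h \<otimes> (inv h \<otimes> n \<otimes> h) = n \<otimes> h" using hG nG by (simp add: m_assoc[symmetric])
      moreover have "snd Z (n \<otimes> h) z = snd Z n (snd Z h z)" by (rule gset_mult[OF Z nG hG zZ])
      ultimately show ?thesis by simp
    qed
    then show "snd Z h z \<in> ?E" using gset_closed[OF Z hG zZ] by (auto simp: fixed_by_def)
  next
    fix g h z assume "g \<in> carrier ?H" "h \<in> carrier ?H" "z \<in> ?E"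
    then show "snd Z (g \<otimes>\<^bsub>?H\<^esub> h) z = snd Z g (snd Z h z)"
      using gset_mult[OF Z, of g h z] Hc by auto
  qed (use gset_one[OF Z] in auto)
  have "card (H.gorbit ?W z) dvd p ^ k" if z: "z \<in> fst ?W" for z
  proof -
    interpret act: group_action ?H "fst ?W" "snd ?W" using W by (simp add: is_gset_def)
    let ?S = "stabilizer ?H (snd ?W) z"
    have S: "subgroup ?S ?H" by (rule act.stabilizer_subgroup[OF z])
    have NS: "N \<subseteq> ?S"
    proof
      fix n assume n: "n \<in> N"
      then have nH: "n \<in> carrier ?H" and nG: "n \<in> carrier G" using NH Nc by auto
      have zE: "z \<in> ?E" using z by simp
      have "snd ?W n z = snd Z n z" by (rule H.snd_gset_of[OF nH zE])
      also have "\<dots> = z" using zE n nG by (auto simp: fixed_by_def)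
      finally show "n \<in> ?S" using nH by (simp add: stabilizer_def)
    qed
    have os: "card (H.gorbit ?W z) * card ?S = card H"
      using act.orbit_stabilizer_theorem[OF z]
      by (simp add: order_def orbit_def H.gorbit_def image_def Setcompr_eq_image)
    have HN: "p ^ k * card N = card H"
      using H.lagrange[OF N.subgroup_axioms] ord by (simp add: order_def FactGroup_def)
    interpret S: group "?H\<lparr>carrier := ?S\<rparr>" by (rule H.subgroup_imp_group[OF S])
    have "subgroup N (?H\<lparr>carrier := ?S\<rparr>)" by (rule H.subgroup_incl[OF N.subgroup_axioms S NS])
    from S.lagrange[OF this] have "card (rcosets\<^bsub>?H\<lparr>carrier := ?S\<rparr>\<^esub> N) * card N = card ?S" by (simp add: order_def)
    note this[symmetric]
    then obtain c where c: "card ?S = c * card N" by (rule that)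
    have "card N > 0" using finH NH N.one_closed finite_subset by (auto simp: card_gt_0_iff)
    moreover have "card (H.gorbit ?W z) * c * card N = p ^ k * card N"
      unfolding HN os[symmetric] c by (simp only: mult.assoc)
    ultimately have "card (H.gorbit ?W z) * c = p ^ k" unfolding mult_cancel2 by simp
    then show ?thesis by (metis dvd_triv_left)
  qed
  from H.card_fixed_points_mod[OF p W this]
  have "card ?E mod p = card {z \<in> ?E. \<forall>h\<in>H. snd ?W h z = z} mod p" by simp
  moreover have "{z \<in> ?E. \<forall>h\<in>H. snd ?W h z = z} = {z \<in> fst Z. fixed_by Z H z}"
  proof -
    have eq: "snd ?W h z = snd Z h z" if "z \<in> ?E" "h \<in> H" for z h
      by (rule H.snd_gset_of) (use that in auto)
    then have "{z \<in> ?E. \<forall>h\<in>H. snd ?W h z = z} = {z \<in> ?E. \<forall>h\<in>H. snd Z h z = z}"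
      by (intro Collect_cong conj_cong ball_cong refl) simp
    also have "\<dots> = {z \<in> fst Z. fixed_by Z H z}"
      unfolding fixed_by_def using NH Hc by blast
    finally show ?thesis .
  qed
  ultimately show ?thesis by (simp add: fixcard_def)
qed

text \<open>These are the subgroups that equal their own \<open>O\<^sup>p\<close>. The one found in \<open>H\<close> by \<open>ex_p_perfect\<close> takes the place of
  \<open>O\<^sup>p(H)\<close> below; it lies in \<open>O\<^sup>p(H)\<close> by \<open>p_perfect_le_p_residual\<close>.\<close>

definition p_perfect :: "nat \<Rightarrow> 'a set \<Rightarrow> bool" where
  "p_perfect p Q \<longleftrightarrow> (\<forall>N k. N \<lhd> G\<lparr>carrier := Q\<rparr> \<and> order (G\<lparr>carrier := Q\<rparr> Mod N) = p ^ k \<longrightarrow> N = Q)"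

text \<open>Descend along normal subgroups of \<open>p\<close>-power index until there is none left; no step changes the number of fixed
  points modulo \<open>p\<close>.\<close>

lemma ex_p_perfect:
  assumes fin: "finite (carrier G)" and p: "prime p" and H: "subgroup H G"
  shows "\<exists>Q\<subseteq>H. subgroup Q G \<and> p_perfect p Q \<and>
    (\<forall>Z::('a, 'v) gset. is_gset G Z \<longrightarrow> fixcard Z H mod p = fixcard Z Q mod p)"
  using H
proof (induction "card H" arbitrary: H rule: less_induct)
  case less
  show ?case
  proof (cases "p_perfect p H")
    case True
    then show ?thesis using less.prems by blast
  next
    case False
    then obtain N k where N: "N \<lhd> G\<lparr>carrier := H\<rparr>" "order (G\<lparr>carrier := H\<rparr> Mod N) = p ^ k" "N \<noteq> H"
      by (auto simp: p_perfect_def)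
    have NH: "N \<subseteq> H" using subgroup.subset[OF normal_imp_subgroup[OF N(1)]] by simp
    have finH: "finite H" using fin subgroup.subset[OF less.prems] finite_subset by blast
    have "subgroup N G" by (rule incl_subgroup[OF less.prems normal_imp_subgroup[OF N(1)]])
    moreover have "card N < card H" using NH N(3) finH by (intro psubset_card_mono) auto
    ultimately obtain Q where Q: "Q \<subseteq> N" "subgroup Q G" "p_perfect p Q"
      "\<forall>Z::('a, 'v) gset. is_gset G Z \<longrightarrow> fixcard Z N mod p = fixcard Z Q mod p"
      using less.hyps by blast
    have "fixcard Z H mod p = fixcard Z Q mod p" if "is_gset G Z" for Z :: "('a, 'v) gset"
      using fixcard_normal_mod[OF fin p that less.prems N(1,2)] Q(4) that by simp
    then show ?thesis using Q NH by blast
  qed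
qed

text \<open>The image is a \<open>p\<close>-group, so the kernel is normal of \<open>p\<close>-power index.\<close>

lemma p_perfect_hom_trivial:
  assumes Q: "subgroup Q G" "p_perfect p Q" and p: "prime p" and h: "group_hom (G\<lparr>carrier := Q\<rparr>) P h"
    and ord: "card (carrier P) = p ^ k" and q: "q \<in> Q"
  shows "h q = \<one>\<^bsub>P\<^esub>"
proof -
  let ?Q = "G\<lparr>carrier := Q\<rparr>"
  interpret h: group_hom ?Q P h by (rule h)
  have img: "subgroup (h ` Q) P" using h.img_is_subgroup by simp
  have "card (h ` Q) dvd p ^ k"
    using h.H.lagrange[OF img] ord by (metis dvd_triv_right order_def)
  then obtain i where i: "card (h ` Q) = p ^ i" using p by (auto simp: divides_primepow_nat)
  interpret I: group "P\<lparr>carrier := h ` Q\<rparr>" by (rule h.H.subgroup_imp_group[OF img])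
  interpret hI: group_hom ?Q "P\<lparr>carrier := h ` Q\<rparr>" h
    by unfold_locales (use h.homh in \<open>auto simp: hom_def\<close>)
  have ker: "kernel ?Q (P\<lparr>carrier := h ` Q\<rparr>) h = kernel ?Q P h" by (simp add: kernel_def)
  have "(\<lambda>X. the_elem (h ` X)) \<in> iso (?Q Mod kernel ?Q (P\<lparr>carrier := h ` Q\<rparr>) h) (P\<lparr>carrier := h ` Q\<rparr>)"
    by (rule hI.FactGroup_iso_set) simp
  then have "order (?Q Mod kernel ?Q P h) = p ^ i"
    unfolding ker using i by (auto simp: iso_def order_def dest: bij_betw_same_card)
  moreover have "kernel ?Q P h \<lhd> ?Q" by (rule h.normal_kernel)
  ultimately have "kernel ?Q P h = Q" using Q(2) by (auto simp: p_perfect_def)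
  then show ?thesis using q by (auto simp: kernel_def)
qed

text \<open>For each normal subgroup \<open>N\<close> of \<open>p\<close>-power index in \<open>H\<close>, the map from \<open>Q\<close> to \<open>H/N\<close> is trivial.\<close>

lemma p_perfect_le_p_residual:
  assumes Q: "subgroup Q G" "p_perfect p Q" and p: "prime p" and H: "subgroup H G" and QH: "Q \<subseteq> H"
  shows "Q \<subseteq> p_residual G p H"
  unfolding p_residual_def
proof (intro Inter_greatest subsetI, elim CollectE conjE exE)
  fix N k q assume N: "N \<lhd> G\<lparr>carrier := H\<rparr>" and ord: "order (G\<lparr>carrier := H\<rparr> Mod N) = p ^ k" and q: "q \<in> Q"
  let ?H = "G\<lparr>carrier := H\<rparr>"
  interpret N: normal N ?H by (rule N)
  have "(\<lambda>a. N #>\<^bsub>?H\<^esub> a) \<in> hom ?H (?H Mod N)" by (rule N.r_coset_hom_Mod)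
  then have hom: "(\<lambda>a. N #>\<^bsub>?H\<^esub> a) \<in> hom (G\<lparr>carrier := Q\<rparr>) (?H Mod N)" using QH by (auto simp: hom_def Pi_iff subset_iff)
  have "group_hom (G\<lparr>carrier := Q\<rparr>) (?H Mod N) (\<lambda>a. N #>\<^bsub>?H\<^esub> a)"
    using hom subgroup_imp_group[OF Q(1)] N.factorgroup_is_group by (simp add: group_hom_def group_hom_axioms_def)
  from p_perfect_hom_trivial[OF Q p this _ q] have "N #>\<^bsub>?H\<^esub> q = N" using ord by (simp add: order_def)
  moreover have "q \<in> N #>\<^bsub>?H\<^esub> q"
    using q QH by (intro N.rcos_self[OF _ N.subgroup_axioms]) auto
  ultimately show "q \<in> N" by simp
qed

lemma p_residual_subgroup:
  assumes K: "subgroup K G"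
  shows "subgroup (p_residual G p K) G" "\<And>N k. N \<lhd> G\<lparr>carrier := K\<rparr> \<Longrightarrow> order (G\<lparr>carrier := K\<rparr> Mod N) = p ^ k \<Longrightarrow> p_residual G p K \<subseteq> N"
proof -
  let ?K = "G\<lparr>carrier := K\<rparr>"
  interpret K: group ?K by (rule subgroup_imp_group[OF K])
  have "carrier ?K \<lhd> ?K" by (rule K.normal_invI[OF K.subgroup_self]) (intro K.m_closed K.inv_closed)
  then have KK: "K \<lhd> ?K" by simp
  have "order (?K Mod K) = 1"
  proof -
    have "card (rcosets\<^bsub>?K\<^esub> K) * card K = card K"
      using K.lagrange[OF normal_imp_subgroup[OF KK]] by (simp add: order_def)
    moreover have "rcosets\<^bsub>?K\<^esub> K = {K}"
    proof -
      have "K #>\<^bsub>?K\<^esub> a = K" if "a \<in> K" for a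
        using K.coset_join2[of a K] normal_imp_subgroup[OF KK] that by simp
      then show ?thesis using subgroup.one_closed[OF K] by (auto simp: RCOSETS_def)
    qed
    ultimately show ?thesis by (simp add: order_def FactGroup_def)
  qed
  then have "\<exists>k. order (?K Mod K) = p ^ k" by (intro exI[of _ 0]) simp
  then have "subgroup (p_residual G p K) ?K"
    unfolding p_residual_def using KK
    by (intro K.subgroups_Inter) (auto intro: normal_imp_subgroup)
  then show "subgroup (p_residual G p K) G" by (rule incl_subgroup[OF K])
  show "\<And>N k. N \<lhd> ?K \<Longrightarrow> order (?K Mod N) = p ^ k \<Longrightarrow> p_residual G p K \<subseteq> N"
    unfolding p_residual_def by blast
qed

text \<open>The preimage of a Sylow subgroup of the quotient.\<close>

lemma ex_sylow_over_normal:
  assumes fin: "finite (carrier G)" and p: "prime p" and Q: "Q \<lhd> G"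
  shows "\<exists>K. subgroup K G \<and> Q \<subseteq> K \<and> (\<exists>k. order (G\<lparr>carrier := K\<rparr> Mod Q) = p ^ k) \<and> \<not> p dvd card (lcosets K)"
proof -
  interpret Q: normal Q G by (rule Q)
  interpret M: group "G Mod Q" by (rule Q.factorgroup_is_group)
  have finM: "finite (carrier (G Mod Q))" using fin by (simp add: carrier_FactGroup)
  have pos: "order (G Mod Q) > 0" using finM M.order_gt_0_iff_finite by simp
  obtain a m where am: "order (G Mod Q) = p ^ a * m" "\<not> p dvd m"
    using multiplicity_decompose'[of "order (G Mod Q)" p] pos p by (metis gr_implies_not0 not_prime_unit)
  obtain P where P: "subgroup P (G Mod Q)" "card P = p ^ a"
    using sylow_thm[OF p M.is_group am(1) finM] by blast
  define K where "K = {g \<in> carrier G. Q #> g \<in> P}"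
  have hom: "group_hom G (G Mod Q) (\<lambda>g. Q #> g)"
    using Q.r_coset_hom_Mod by unfold_locales
  interpret h: group_hom G "G Mod Q" "\<lambda>g. Q #> g" by (rule hom)
  have K: "subgroup K G"
  proof (rule subgroupI)
    have "\<one> \<in> K" unfolding K_def using subgroup.one_closed[OF P(1)] h.hom_one by simp
    then show "K \<noteq> {}" by blast
    show "inv x \<in> K" if "x \<in> K" for x
      using that subgroup.m_inv_closed[OF P(1)] h.hom_inv unfolding K_def by (metis (no_types, lifting) inv_closed mem_Collect_eq)
    show "x \<otimes> y \<in> K" if "x \<in> K" "y \<in> K" for x y
      using that subgroup.m_closed[OF P(1)] h.hom_mult unfolding K_def by (metis (no_types, lifting) m_closed mem_Collect_eq)
  qed (auto simp: K_def)
  have QK: "Q \<subseteq> K"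
    using Q.rcos_const Q.subset subgroup.one_closed[OF P(1)] unfolding K_def by (auto simp: Q.rcos_const[OF is_group])
  interpret K: group "G\<lparr>carrier := K\<rparr>" by (rule subgroup_imp_group[OF K])
  have QnK: "Q \<lhd> G\<lparr>carrier := K\<rparr>" by (rule normal_restrict_supergroup[OF K Q QK])
  have rc: "Q #>\<^bsub>G\<lparr>carrier := K\<rparr>\<^esub> g = Q #> g" for g by (simp add: r_coset_def)
  have "carrier (G\<lparr>carrier := K\<rparr> Mod Q) = P"
  proof
    show "carrier (G\<lparr>carrier := K\<rparr> Mod Q) \<subseteq> P" by (auto simp: carrier_FactGroup rc K_def)
    show "P \<subseteq> carrier (G\<lparr>carrier := K\<rparr> Mod Q)"
    proof
      fix X assume X: "X \<in> P"
      then have "X \<in> carrier (G Mod Q)" using subgroup.subset[OF P(1)] by blast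
      then obtain g where "g \<in> carrier G" "X = Q #> g" by (auto simp: carrier_FactGroup)
      then show "X \<in> carrier (G\<lparr>carrier := K\<rparr> Mod Q)" using X by (auto simp: carrier_FactGroup rc K_def)
    qed
  qed
  then have ordK: "order (G\<lparr>carrier := K\<rparr> Mod Q) = p ^ a" using P(2) by (simp add: order_def)
  have "card Q > 0" using finite_subset[OF Q.subset fin] Q.one_closed unfolding card_gt_0_iff by blast
  have "p ^ a * card Q = card K"
    using K.lagrange[OF normal_imp_subgroup[OF QnK]] ordK by (simp add: order_def FactGroup_def)
  moreover have "p ^ a * m * card Q = card (carrier G)"
    using lagrange[OF Q.subgroup_axioms] am(1) by (simp add: order_def FactGroup_def)
  moreover have "card (lcosets K) * card K = card (carrier G)"
    using l_lagrange[OF fin K] by (simp add: order_def)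
  ultimately have "card (lcosets K) * (p ^ a * card Q) = m * (p ^ a * card Q)" by (simp add: ac_simps)
  then have "card (lcosets K) = m" using \<open>card Q > 0\<close> p by (simp add: prime_gt_0_nat)
  then show ?thesis using K QK ordK am(2) by blast
qed

text \<open>For a finite subgroup, an inclusion between conjugates is an equality.\<close>

lemma mem_normalizer:
  assumes Q: "subgroup Q G" and fin: "finite (carrier G)"
  shows "g \<in> normalizer G Q \<longleftrightarrow> g \<in> carrier G \<and> (\<forall>q\<in>Q. inv g \<otimes> q \<otimes> g \<in> Q)"
proof -
  have Qc: "Q \<subseteq> carrier G" by (rule subgroup.subset[OF Q])
  have finQ: "finite Q" using fin Qc finite_subset by blast
  have "conj_subgroup G g Q = Q \<longleftrightarrow> (\<forall>q\<in>Q. inv g \<otimes> q \<otimes> g \<in> Q)" if g: "g \<in> carrier G"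
  proof -
    have cancel: "g \<otimes> (inv g \<otimes> q \<otimes> g) \<otimes> inv g = q" "inv g \<otimes> (g \<otimes> q \<otimes> inv g) \<otimes> g = q" if "q \<in> Q" for q
    proof -
      have q: "q \<in> carrier G" using that Qc by blast
      show "g \<otimes> (inv g \<otimes> q \<otimes> g) \<otimes> inv g = q" using g q by (simp add: m_assoc) (simp add: m_assoc[symmetric])
      show "inv g \<otimes> (g \<otimes> q \<otimes> inv g) \<otimes> g = q" using g q by (simp add: m_assoc) (simp add: m_assoc[symmetric])
    qed
    have inj: "inj_on (\<lambda>q. inv g \<otimes> q \<otimes> g) Q"
      by (rule inj_on_inverseI[where g = "\<lambda>x. g \<otimes> x \<otimes> inv g"]) (rule cancel(1))
    show ?thesis
    proof
      assume eq: "conj_subgroup G g Q = Q"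
      show "\<forall>q\<in>Q. inv g \<otimes> q \<otimes> g \<in> Q"
      proof
        fix q assume "q \<in> Q"
        then obtain r where "r \<in> Q" "q = g \<otimes> r \<otimes> inv g" using eq by (auto simp: conj_subgroup_eq[OF g Qc])
        then show "inv g \<otimes> q \<otimes> g \<in> Q" using cancel(2) by simp
      qed
    next
      assume sub: "\<forall>q\<in>Q. inv g \<otimes> q \<otimes> g \<in> Q"
      then have "(\<lambda>q. inv g \<otimes> q \<otimes> g) ` Q = Q" using inj finQ by (intro endo_inj_surj) auto
      then have "conj_subgroup G g Q = (\<lambda>h. g \<otimes> h \<otimes> inv g) ` (\<lambda>q. inv g \<otimes> q \<otimes> g) ` Q"
        by (simp add: conj_subgroup_eq[OF g Qc])
      also have "\<dots> = Q" unfolding image_image using cancel(1) by simp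
      finally show "conj_subgroup G g Q = Q" .
    qed
  qed
  then show ?thesis using Qc by (auto simp: normalizer_def stabilizer_def conj_subgroup_def)
qed

text \<open>Choose a \<open>p\<close>-perfect \<open>Q\<close> in \<open>H\<close> with as many fixed points modulo \<open>p\<close>, and \<open>K\<close> such that \<open>K/Q\<close> is a Sylow subgroup of
  \<open>N(Q)/Q\<close>. Then \<open>O\<^sup>p(K)\<close> is contained in \<open>Q\<close>, and \<open>Q\<close> in \<open>O\<^sup>p(K0)\<close>, so that \<open>K\<close> belongs to the hyper family. If \<open>Q\<close>
  fixes the coset \<open>g K\<close>, then conjugation by the inverse of \<open>g\<close> maps \<open>Q\<close> into \<open>K\<close>; followed by \<open>K \<rightarrow> K/Q\<close> it is
  trivial, whence \<open>g\<close> normalizes \<open>Q\<close>.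
  The fixed cosets thus form \<open>N(Q)/K\<close>, which has order prime to \<open>p\<close>.\<close>

theorem ex_hyper_subgroup_fixcard:
  assumes fin: "finite (carrier G)" and p: "prime p"
    and F: "\<And>H K. H \<in> F \<Longrightarrow> subgroup K G \<Longrightarrow> K \<subseteq> H \<Longrightarrow> K \<in> F"
    and H: "subgroup H G" and K0: "K0 \<in> hyper_family G p F" and HK: "H \<subseteq> K0"
  shows "\<exists>K\<in>hyper_family G p F. \<forall>Z::('a, 'v) gset. \<forall>e. is_gset G Z \<longrightarrow>
    e \<in> gmaps G (coset_sum G {K}) Z \<longrightarrow> bij_betw e (fst (coset_sum G {K})) (fst Z) \<longrightarrow> \<not> p dvd fixcard Z H"
proof -
  have K0: "subgroup K0 G" "p_residual G p K0 \<in> F" using K0 by (auto simp: hyper_family_def)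
  obtain Q where Q: "Q \<subseteq> H" "subgroup Q G" "p_perfect p Q"
    and mod: "\<forall>Z::('a, 'v) gset. is_gset G Z \<longrightarrow> fixcard Z H mod p = fixcard Z Q mod p"
    using ex_p_perfect[OF fin p H] by blast
  have "Q \<subseteq> p_residual G p K0" using p_perfect_le_p_residual[OF Q(2,3) p K0(1)] Q(1) HK by blast
  then have QF: "Q \<in> F" using F K0(2) Q(2) by blast
  have Qc: "Q \<subseteq> carrier G" by (rule subgroup.subset[OF Q(2)])
  let ?N = "normalizer G Q"
  have N: "subgroup ?N G" by (rule normalizer_imp_subgroup[OF Qc])
  have Nc: "?N \<subseteq> carrier G" by (rule subgroup.subset[OF N])
  interpret N: group "G\<lparr>carrier := ?N\<rparr>" by (rule subgroup_imp_group[OF N])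
  interpret N: gset_theory "G\<lparr>carrier := ?N\<rparr>" by unfold_locales
  have QN: "Q \<lhd> G\<lparr>carrier := ?N\<rparr>" by (rule subgroup_in_normalizer[OF Q(2)])
  have finN: "finite (carrier (G\<lparr>carrier := ?N\<rparr>))" using fin Nc finite_subset by auto
  obtain K k where K: "subgroup K (G\<lparr>carrier := ?N\<rparr>)" "Q \<subseteq> K" "order (G\<lparr>carrier := K\<rparr> Mod Q) = p ^ k"
    and pK: "\<not> p dvd card (lcosets\<^bsub>G\<lparr>carrier := ?N\<rparr>\<^esub> K)"
    using N.ex_sylow_over_normal[OF finN p QN] by auto
  have KN: "K \<subseteq> ?N" using subgroup.subset[OF K(1)] by simp
  have KG: "subgroup K G" by (rule incl_subgroup[OF N K(1)])
  have Kc: "K \<subseteq> carrier G" by (rule subgroup.subset[OF KG])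
  have QK: "Q \<lhd> G\<lparr>carrier := K\<rparr>" using N.normal_restrict_supergroup[OF K(1) QN K(2)] by simp
  have "p_residual G p K \<subseteq> Q" by (rule p_residual_subgroup(2)[OF KG QK K(3)])
  then have "p_residual G p K \<in> F" using F QF p_residual_subgroup(1)[OF KG] by blast
  then have KF: "K \<in> hyper_family G p F" using KG by (simp add: hyper_family_def)
  have fst_cs: "fst (coset_sum G {K}) = {K} \<times> lcosets K" by (auto simp: coset_sum_def)
  have cs: "is_gset G (coset_sum G {K})" by (rule is_gset_coset_sum[OF fin]) (use KG in auto)
  \<comment> \<open>the cosets fixed by \<open>Q\<close> are those of elements normalizing \<open>Q\<close>\<close>
  have fixed: "fixed_by (coset_sum G {K}) Q (K, g <# K) \<longleftrightarrow> g \<in> ?N" if g: "g \<in> carrier G" for g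
  proof -
    have act: "snd (coset_sum G {K}) q (K, g <# K) = (K, q <# (g <# K))" if "q \<in> Q" for q
      using that g Qc by (auto simp: coset_sum_def LCOSETS_def)
    have "q <# (g <# K) = g <# K \<longleftrightarrow> inv g \<otimes> q \<otimes> g \<in> K" if q: "q \<in> Q" for q
    proof -
      have qc: "q \<in> carrier G" using q Qc by blast
      have "q <# (g <# K) = (q \<otimes> g) <# K" by (rule lcos_m_assoc[OF Kc qc g])
      moreover have "(q \<otimes> g) <# K = g <# K \<longleftrightarrow> q \<otimes> g \<in> g <# K"
        using lcos_self[OF _ KG, of "q \<otimes> g"] l_repr_independence[OF _ g KG] qc g by auto
      moreover have "q \<otimes> g \<in> g <# K \<longleftrightarrow> inv g \<otimes> (q \<otimes> g) \<in> K"
        using subgroup.lcos_module_imp[OF KG is_group g] subgroup.lcos_module_rev[OF KG is_group g, of "q \<otimes> g"] qc g by auto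
      ultimately show ?thesis using qc g by (simp add: m_assoc)
    qed
    then have "fixed_by (coset_sum G {K}) Q (K, g <# K) \<longleftrightarrow> (\<forall>q\<in>Q. inv g \<otimes> q \<otimes> g \<in> K)"
      using act Qc by (auto simp: fixed_by_def)
    also have "\<dots> \<longleftrightarrow> (\<forall>q\<in>Q. inv g \<otimes> q \<otimes> g \<in> Q)"
    proof
      assume conj: "\<forall>q\<in>Q. inv g \<otimes> q \<otimes> g \<in> K"
      let ?K = "G\<lparr>carrier := K\<rparr>"
      interpret QK: normal Q ?K by (rule QK)
      have "(\<lambda>q. inv g \<otimes> q \<otimes> g) \<in> hom (G\<lparr>carrier := Q\<rparr>) ?K"
      proof (rule homI)
        fix x y assume "x \<in> carrier (G\<lparr>carrier := Q\<rparr>)" "y \<in> carrier (G\<lparr>carrier := Q\<rparr>)"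
        then have xy: "x \<in> carrier G" "y \<in> carrier G" using Qc by auto
        have "inv g \<otimes> x \<otimes> g \<otimes> (inv g \<otimes> y \<otimes> g) = inv g \<otimes> x \<otimes> (g \<otimes> inv g) \<otimes> y \<otimes> g"
          using g xy by (simp only: m_assoc m_closed inv_closed)
        then show "inv g \<otimes> (x \<otimes>\<^bsub>G\<lparr>carrier := Q\<rparr>\<^esub> y) \<otimes> g = (inv g \<otimes> x \<otimes> g) \<otimes>\<^bsub>?K\<^esub> (inv g \<otimes> y \<otimes> g)"
          using g xy by (simp add: m_assoc)
      qed (use conj in simp)
      then have "(\<lambda>q. Q #>\<^bsub>?K\<^esub> (inv g \<otimes> q \<otimes> g)) \<in> hom (G\<lparr>carrier := Q\<rparr>) (?K Mod Q)"
        using QK.r_coset_hom_Mod by (auto simp: hom_def Pi_iff)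
      then have gh: "group_hom (G\<lparr>carrier := Q\<rparr>) (?K Mod Q) (\<lambda>q. Q #>\<^bsub>?K\<^esub> (inv g \<otimes> q \<otimes> g))"
        using subgroup_imp_group[OF Q(2)] QK.factorgroup_is_group by (simp add: group_hom_def group_hom_axioms_def)
      show "\<forall>q\<in>Q. inv g \<otimes> q \<otimes> g \<in> Q"
      proof
        fix q assume q: "q \<in> Q"
        have "Q #>\<^bsub>?K\<^esub> (inv g \<otimes> q \<otimes> g) = Q"
          using p_perfect_hom_trivial[OF Q(2,3) p gh _ q] K(3) by (simp add: order_def)
        moreover have "inv g \<otimes> q \<otimes> g \<in> Q #>\<^bsub>?K\<^esub> (inv g \<otimes> q \<otimes> g)"
          using conj q by (intro QK.rcos_self[OF _ QK.subgroup_axioms]) auto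
        ultimately show "inv g \<otimes> q \<otimes> g \<in> Q" by simp
      qed
    qed (use K(2) in blast)
    finally show ?thesis unfolding mem_normalizer[OF Q(2) fin] using g by blast
  qed
  have "{c \<in> fst (coset_sum G {K}). fixed_by (coset_sum G {K}) Q c} = Pair K ` (lcosets\<^bsub>G\<lparr>carrier := ?N\<rparr>\<^esub> K)"
  proof (intro equalityI subsetI)
    fix c assume c: "c \<in> {c \<in> fst (coset_sum G {K}). fixed_by (coset_sum G {K}) Q c}"
    then obtain g where g: "g \<in> carrier G" "c = (K, g <# K)" by (auto simp: fst_cs LCOSETS_def)
    then have "g \<in> ?N" using fixed c by simp
    then show "c \<in> Pair K ` (lcosets\<^bsub>G\<lparr>carrier := ?N\<rparr>\<^esub> K)" using g by (auto simp: LCOSETS_def l_coset_def)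
  next
    fix c assume "c \<in> Pair K ` (lcosets\<^bsub>G\<lparr>carrier := ?N\<rparr>\<^esub> K)"
    then obtain g where g: "g \<in> ?N" "c = (K, g <# K)" by (auto simp: LCOSETS_def l_coset_def)
    then have gc: "g \<in> carrier G" using Nc by blast
    then show "c \<in> {c \<in> fst (coset_sum G {K}). fixed_by (coset_sum G {K}) Q c}"
      using g fixed[OF gc] by (auto simp: fst_cs LCOSETS_def)
  qed
  then have card_fix: "card {c \<in> fst (coset_sum G {K}). fixed_by (coset_sum G {K}) Q c} = card (lcosets\<^bsub>G\<lparr>carrier := ?N\<rparr>\<^esub> K)"
    by (simp add: card_image inj_on_def)
  have "\<not> p dvd fixcard Z H" if Z: "is_gset G Z" and e: "e \<in> gmaps G (coset_sum G {K}) Z"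
    and b: "bij_betw e (fst (coset_sum G {K})) (fst Z)" for Z :: "('a, 'v) gset" and e
  proof -
    have "e ` {c \<in> fst (coset_sum G {K}). fixed_by (coset_sum G {K}) Q c} = {z \<in> fst Z. fixed_by Z Q z}"
      unfolding bij_betw_imp_surj_on[OF b, symmetric] using fixed_by_inj[OF e bij_betw_imp_inj_on[OF b] cs] by blast
    then have "fixcard Z Q = card {c \<in> fst (coset_sum G {K}). fixed_by (coset_sum G {K}) Q c}"
      unfolding fixcard_def using card_image[OF inj_on_subset[OF bij_betw_imp_inj_on[OF b]],
        of "{c \<in> fst (coset_sum G {K}). fixed_by (coset_sum G {K}) Q c}"] by auto
    then have "\<not> p dvd fixcard Z Q" using card_fix pK by simp
    moreover have "fixcard Z H mod p = fixcard Z Q mod p" using mod Z by blast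
    ultimately show ?thesis by (simp add: dvd_eq_mod_eq_0)
  qed
  then show ?thesis using KF by blast
qed

end

section \<open>Inductions from a hyperelementary G-set\<close>

context gset_theory
begin

text \<open>Stabilizers are subgroups; therefore marks at arbitrary sets are marks at subgroups.\<close>

lemma fixed_by_generate:
  assumes X: "is_gset G X" and x: "x \<in> fst X"
  shows "fixed_by X (generate G (H \<inter> carrier G)) x \<longleftrightarrow> fixed_by X H x"
proof -
  let ?S = "{g \<in> carrier G. snd X g x = x}"
  have S: "subgroup ?S G" by (rule stabilizer_subgroup_gset[OF X x])
  have sub: "generate G (H \<inter> carrier G) \<subseteq> carrier G" by (rule generate_incl) simp
  have "fixed_by X (generate G (H \<inter> carrier G)) x \<longleftrightarrow> generate G (H \<inter> carrier G) \<subseteq> ?S"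
    using sub by (auto simp: fixed_by_def)
  also have "\<dots> \<longleftrightarrow> H \<inter> carrier G \<subseteq> ?S"
    using generate_subgroup_incl[OF _ S] generate.incl[of _ "H \<inter> carrier G" G] by blast
  also have "\<dots> \<longleftrightarrow> fixed_by X H x" by (auto simp: fixed_by_def)
  finally show ?thesis .
qed

lemma marks_generate:
  assumes X: "is_gset G X"
  shows "marks X f (generate G (H \<inter> carrier G)) s = marks X f H s"
proof -
  have "{x \<in> fst X. f x = s \<and> fixed_by X (generate G (H \<inter> carrier G)) x} = {x \<in> fst X. f x = s \<and> fixed_by X H x}"
    using fixed_by_generate[OF X] by blast
  then show ?thesis by (simp add: marks_def)
qed

lemma fixcard_conj:
  assumes Z: "is_gset G Z" and g: "g \<in> carrier G" and H: "H \<subseteq> carrier G"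
  shows "fixcard Z (conj_subgroup G g H) = fixcard Z H"
proof -
  have fixed: "fixed_by Z (conj_subgroup G g H) (snd Z g z) \<longleftrightarrow> fixed_by Z H z" if z: "z \<in> fst Z" for z
  proof -
    have "snd Z (g \<otimes> h \<otimes> inv g) (snd Z g z) = snd Z g z \<longleftrightarrow> snd Z h z = z" if h: "h \<in> H" for h
    proof -
      have hc: "h \<in> carrier G" using h H by blast
      have "snd Z (g \<otimes> h \<otimes> inv g) (snd Z g z) = snd Z g (snd Z h z)"
        using gset_mult[OF Z, of "g \<otimes> h" "inv g" "snd Z g z"] gset_mult[OF Z, of g h z]
          gset_inv(1)[OF Z g z] gset_closed[OF Z g z] g hc z by simp
      then show ?thesis
        using gset_inv(1)[OF Z g z] gset_inv(1)[OF Z g gset_closed[OF Z hc z]] by metis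
    qed
    moreover have "g \<otimes> h \<otimes> inv g \<in> carrier G" if "h \<in> H" for h using that g H by blast
    ultimately show ?thesis using H by (auto simp: fixed_by_def conj_subgroup_eq[OF g H])
  qed
  have "bij_betw (snd Z g) {z \<in> fst Z. fixed_by Z H z} {z \<in> fst Z. fixed_by Z (conj_subgroup G g H) z}"
  proof (rule bij_betw_byWitness[where f' = "snd Z (inv g)"])
    show "snd Z g ` {z \<in> fst Z. fixed_by Z H z} \<subseteq> {z \<in> fst Z. fixed_by Z (conj_subgroup G g H) z}"
      using fixed gset_closed[OF Z g] by auto
    show "snd Z (inv g) ` {z \<in> fst Z. fixed_by Z (conj_subgroup G g H) z} \<subseteq> {z \<in> fst Z. fixed_by Z H z}"
    proof (rule image_subsetI)
      fix z assume z: "z \<in> {z \<in> fst Z. fixed_by Z (conj_subgroup G g H) z}"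
      then have zz: "snd Z (inv g) z \<in> fst Z" using gset_closed[OF Z, of "inv g" z] g by simp
      show "snd Z (inv g) z \<in> {z \<in> fst Z. fixed_by Z H z}"
        using fixed[OF zz] gset_inv(2)[OF Z g, of z] z zz by simp
    qed
  qed (use gset_inv[OF Z g] in auto)
  then show ?thesis unfolding fixcard_def by (simp add: bij_betw_same_card)
qed

end

lemma family_of_downward:
  assumes "H \<in> family_of G X" "subgroup K G" "K \<subseteq> H"
  shows "K \<in> family_of G X"
  using assms unfolding family_of_def is_family_def by blast

context gsets
begin

lemma hyper_gset_facts:
  fixes X :: "('g, 'u) gset"
  shows is_gset_hyper: "is_gset G (hyper_gset G p X :: ('g, 'u) gset)"
    and hyper_member_fixes: "\<And>H. H \<in> hyper_family G p (family_of G X) \<Longrightarrow> \<exists>y\<in>fst (hyper_gset G p X). fixed_by (hyper_gset G p X) H y"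
    and fixes_hyper_imp: "\<And>H y. y \<in> fst (hyper_gset G p X) \<Longrightarrow> fixed_by (hyper_gset G p X) H y \<Longrightarrow> H \<subseteq> carrier G \<Longrightarrow>
      \<exists>K\<in>hyper_family G p (family_of G X). \<exists>g\<in>carrier G. \<forall>h\<in>H. inv g \<otimes> h \<otimes> g \<in> K"
proof -
  have sub: "subgroup H G" if "H \<in> hyper_family G p (family_of G X)" for H
    using that by (simp add: hyper_family_def)
  note f = gset_of_family[of "hyper_family G p (family_of G X)", OF sub, folded hyper_gset_def]
  show "is_gset G (hyper_gset G p X :: ('g, 'u) gset)" by (rule f(1))
  show "\<And>H. H \<in> hyper_family G p (family_of G X) \<Longrightarrow> \<exists>y\<in>fst (hyper_gset G p X). fixed_by (hyper_gset G p X) H y"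
    by (rule f(2))
  show "\<And>H y. y \<in> fst (hyper_gset G p X) \<Longrightarrow> fixed_by (hyper_gset G p X) H y \<Longrightarrow> H \<subseteq> carrier G \<Longrightarrow>
      \<exists>K\<in>hyper_family G p (family_of G X). \<exists>g\<in>carrier G. \<forall>h\<in>H. inv g \<otimes> h \<otimes> g \<in> K"
    by (rule f(3))
qed

lemma bmarks_generate:
  assumes "u \<in> carrier (val (burnside G) S)"
  shows "bmarks S u (generate G (H \<inter> carrier G)) s = bmarks S u H s"
proof -
  obtain v w where u: "realizable S v" "realizable S w" "u = burnside_diff S v w" using assms by (rule burnside_cases)
  have *: "v (generate G (H \<inter> carrier G)) s = v H s" if "realizable S v" for v
  proof -
    obtain X f where "(X, f) \<in> mark_class S v" and X: "is_gset G X" and f: "f \<in> gmaps G X S" and v: "marks X f = v"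
      using \<open>realizable S v\<close> by (rule realizable_obtain)
    show ?thesis unfolding v[symmetric] by (rule marks_generate[OF X])
  qed
  show ?thesis unfolding u(3) bmarks_diff[OF u(1,2)] *[OF u(1)] *[OF u(2)] ..
qed

text \<open>The product of \<open>b\<close> with the restriction of \<open>a\<close> to \<open>Y\<close>. For the class of a \<open>G\<close>-set \<open>W\<close> it is obtained by pulling \<open>b\<close> back
  to \<open>Y \<times> W\<close> and pushing it forward again.\<close>

lemma burnside_scale:
  assumes Y: "is_gset G Y" and a: "a \<in> carrier (val (burnside G) (point_gset G :: ('g, 'u) gset))" and b: "b \<in> carrier (val (burnside G) Y)"
  shows "\<exists>c\<in>carrier (val (burnside G) Y). \<forall>H y. bmarks Y c H y = bmarks (point_gset G) a H undefined * bmarks Y b H y"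
proof -
  let ?P = "point_gset G :: ('g, 'u) gset"
  interpret A: comm_group "val (burnside G) Y" by (rule comm_group_burnside)
  obtain v w where uu: "realizable ?P v" "realizable ?P w" "a = burnside_diff ?P v w" using a by (rule burnside_cases)
  have *: "\<exists>c\<in>carrier (val (burnside G) Y). \<forall>H y. bmarks Y c H y = int (v H undefined) * bmarks Y b H y"
    if v: "realizable ?P v" for v
  proof -
    obtain W f where "(W, f) \<in> mark_class ?P v" and W: "is_gset G W" and f: "f \<in> gmaps G W ?P" and v: "marks W f = v"
      using v by (rule realizable_obtain)
    obtain Z q r where Z: "is_pullback G Z Y W ?P q r (to_point Y) f"
      using ex_pullback[OF Y W is_gset_point to_point_gmaps[OF Y] f] .
    have ZZ: "is_gset G Z" and q: "q \<in> gmaps G Z Y" using Z by (simp_all add: is_pullback_def)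
    note c1 = con_burnside_closed[OF ZZ Y q b]
    let ?c = "cov (burnside G) Z Y q (con (burnside G) Z Y q b)"
    have "bmarks Y ?c H y = int (v H undefined) * bmarks Y b H y" for H y
    proof -
      have "bmarks Y ?c H y = (\<Sum>z | z \<in> fst Z \<and> q z = y. if z \<in> fst Z \<and> fixed_by Z H z then bmarks Y b H (q z) else 0)"
        unfolding bmarks_cov[OF ZZ q c1] bmarks_con[OF ZZ Y q b] mark_push_def mark_pull_def ..
      also have "\<dots> = (\<Sum>z | z \<in> fst Z \<and> q z = y \<and> fixed_by Z H z. bmarks Y b H y)"
        using gset_finite[OF ZZ] by (intro sum.mono_neutral_cong_right) auto
      also have "\<dots> = int (marks Z q H y) * bmarks Y b H y" by (simp add: marks_def)
      also have "\<dots> = int (v H undefined) * bmarks Y b H y"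
        unfolding marks_pullback[OF Z] v using bmarks_support[OF b, of y H] by (auto simp: to_point_def)
      finally show ?thesis .
    qed
    then show ?thesis using cov_burnside_closed[OF ZZ q c1] by blast
  qed
  obtain c where c: "c \<in> carrier (val (burnside G) Y)" "\<And>H y. bmarks Y c H y = int (v H undefined) * bmarks Y b H y"
    using *[OF uu(1)] by blast
  obtain d where d: "d \<in> carrier (val (burnside G) Y)" "\<And>H y. bmarks Y d H y = int (w H undefined) * bmarks Y b H y"
    using *[OF uu(2)] by blast
  show ?thesis
  proof (intro bexI allI)
    show "c \<otimes>\<^bsub>val (burnside G) Y\<^esub> inv\<^bsub>val (burnside G) Y\<^esub> d \<in> carrier (val (burnside G) Y)" using c d by simp
    show "bmarks Y (c \<otimes>\<^bsub>val (burnside G) Y\<^esub> inv\<^bsub>val (burnside G) Y\<^esub> d) H y = bmarks ?P a H undefined * bmarks Y b H y" for H y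
      using c d unfolding uu(3) bmarks_diff[OF uu(1,2)]
      by (simp add: bmarks_mult bmarks_inv left_diff_distrib)
  qed
qed

text \<open>By \<open>bmarks_cov_point\<close>, this is the mark at \<open>H\<close> of the element induced from \<open>b\<close> to the point.\<close>

definition total_mark :: "('g, 'u) gset \<Rightarrow> ('g, 'u) burnside_elem \<Rightarrow> 'g set \<Rightarrow> int" where
  "total_mark Y b H = (\<Sum>y\<in>fst Y. bmarks Y b H y)"

lemma bmarks_cov_point:
  assumes Y: "is_gset G Y" and b: "b \<in> carrier (val (burnside G) Y)"
  shows "bmarks (point_gset G) (cov (burnside G) Y (point_gset G) (to_point Y) b) H undefined = total_mark Y b H"
proof -
  have "{y. y \<in> fst Y \<and> to_point Y y = undefined} = fst Y" by (auto simp: to_point_def)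
  then show ?thesis unfolding bmarks_cov[OF Y to_point_gmaps[OF Y] b] mark_push_def total_mark_def by simp
qed

text \<open>Elements induced from \<open>Y\<close> form an ideal of the Burnside ring, so their marks are closed under products.\<close>

lemma function_rng_total_mark:
  assumes Y: "is_gset G Y"
  shows "function_rng (total_mark Y ` carrier (val (burnside G) Y))"
proof
  interpret A: comm_group "val (burnside G) Y" by (rule comm_group_burnside)
  let ?L = "total_mark Y ` carrier (val (burnside G) Y)"
  have "total_mark Y \<one>\<^bsub>val (burnside G) Y\<^esub> = (\<lambda>H. 0)" by (auto simp: total_mark_def bmarks_one)
  from this[symmetric] show "(\<lambda>H. 0) \<in> ?L" by (rule image_eqI) (rule A.one_closed)
  fix u v assume "u \<in> ?L" "v \<in> ?L"
  then obtain b c where b: "b \<in> carrier (val (burnside G) Y)" "u = total_mark Y b"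
    and c: "c \<in> carrier (val (burnside G) Y)" "v = total_mark Y c" by blast
  have "total_mark Y (b \<otimes>\<^bsub>val (burnside G) Y\<^esub> inv\<^bsub>val (burnside G) Y\<^esub> c) = (\<lambda>H. u H - v H)"
    using b c by (simp add: total_mark_def fun_eq_iff bmarks_mult bmarks_inv sum_subtractf)
  from this[symmetric] show "(\<lambda>H. u H - v H) \<in> ?L" by (rule image_eqI) (use b c in simp)
  obtain d where d: "d \<in> carrier (val (burnside G) Y)"
    "\<And>H y. bmarks Y d H y = bmarks (point_gset G) (cov (burnside G) Y (point_gset G) (to_point Y) b) H undefined * bmarks Y c H y"
    using burnside_scale[OF Y cov_burnside_closed[OF Y to_point_gmaps[OF Y] b(1)] c(1)] by blast
  have "total_mark Y d = (\<lambda>H. u H * v H)"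
    unfolding b(2) c(2) fun_eq_iff total_mark_def[of Y d] total_mark_def[of Y c] d(2) bmarks_cov_point[OF Y b(1)]
    by (simp add: sum_distrib_left)
  from this[symmetric] show "(\<lambda>H. u H * v H) \<in> ?L" using d(1) by (rule image_eqI)
qed

text \<open>Up to conjugation \<open>H\<close> lies in the hyper family, so \<open>ex_hyper_subgroup_fixcard\<close> provides a member \<open>K\<close> of this family
  for which the mark of \<open>G/K\<close> at \<open>H\<close> is prime to \<open>p\<close>. As \<open>K\<close> fixes a point of \<open>Y\<close>, there is a map from \<open>G/K\<close> to \<open>Y\<close>.\<close>

lemma ex_total_mark_nonzero:
  fixes X :: "('g, 'u) gset"
  assumes p: "prime p" and Y: "Y = hyper_gset G p X" and H: "subgroup H G"
    and y: "y \<in> fst Y" "fixed_by Y H y"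
  shows "\<exists>b\<in>carrier (val (burnside G) Y). \<not> int p dvd total_mark Y b H"
proof -
  let ?F = "hyper_family G p (family_of G X)"
  have YY: "is_gset G Y" unfolding Y by (rule is_gset_hyper)
  have Hc: "H \<subseteq> carrier G" by (rule subgroup.subset[OF H])
  obtain K0 g where K0: "K0 \<in> ?F" and g: "g \<in> carrier G" and sub: "\<And>h. h \<in> H \<Longrightarrow> inv g \<otimes> h \<otimes> g \<in> K0"
    using fixes_hyper_imp[of y p X H] y Hc unfolding Y by blast
  let ?H = "conj_subgroup G (inv g) H"
  have H': "subgroup ?H G"
    unfolding conj_subgroup_def using subgroup_conjugation_is_surj2[OF inv_closed[OF g] H] .
  have HK: "?H \<subseteq> K0" using sub g by (auto simp: conj_subgroup_eq[OF inv_closed[OF g] Hc])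
  obtain K where K: "K \<in> ?F" and nd: "\<And>(Z :: ('g, 'u) gset) e. is_gset G Z \<Longrightarrow> e \<in> gmaps G (coset_sum G {K}) Z \<Longrightarrow>
      bij_betw e (fst (coset_sum G {K})) (fst Z) \<Longrightarrow> \<not> p dvd fixcard Z ?H"
    using ex_hyper_subgroup_fixcard[where 'v = 'u and F = "family_of G X", OF finite_carrier p _ H' K0 HK]
      family_of_downward[of _ G X] by metis
  have KG: "subgroup K G" using K by (simp add: hyper_family_def)
  have cs: "is_gset G (coset_sum G {K})" by (rule is_gset_coset_sum[OF finite_carrier]) (use KG in auto)
  obtain Z :: "('g, 'u) gset" and e where Z: "is_gset G Z" and e: "e \<in> gmaps G (coset_sum G {K}) Z"
    and b: "bij_betw e (fst (coset_sum G {K})) (fst Z)" using transport[OF cs] by blast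
  have "\<not> p dvd fixcard Z H"
    using nd[OF Z e b] fixcard_conj[OF Z inv_closed[OF g] Hc] by simp
  \<comment> \<open>the map \<open>G/K \<rightarrow> Y\<close> given by a point that \<open>K\<close> fixes\<close>
  obtain y0 where y0: "y0 \<in> fst Y" "fixed_by Y K y0" using hyper_member_fixes[OF K] unfolding Y by blast
  let ?c = "(K, \<one> <# K)"
  have c: "?c \<in> fst (coset_sum G {K})" by (auto simp: coset_sum_def LCOSETS_def)
  have act: "snd (coset_sum G {K}) a ?c = (K, a <# K)" if "a \<in> carrier G" for a
    using that lcos_m_assoc[OF subgroup.subset[OF KG] that one_closed] by (auto simp: coset_sum_def LCOSETS_def)
  have stab: "snd Y a y0 = y0" if a: "a \<in> carrier G" and "snd (coset_sum G {K}) a ?c = ?c" for a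
  proof -
    have "a <# K = \<one> <# K" using that act[OF a] by simp
    then have "a \<in> K" using lcos_self[OF a KG] lcos_mult_one[OF subgroup.subset[OF KG]] by simp
    then show ?thesis using y0(2) a by (auto simp: fixed_by_def)
  qed
  obtain h where h: "\<And>a. a \<in> carrier G \<Longrightarrow> h (snd (coset_sum G {K}) a ?c) = snd Y a y0"
    using orbit_map[OF cs YY c y0(1) stab] by blast
  have orb: "\<exists>a\<in>carrier G. x = snd (coset_sum G {K}) a ?c" if "x \<in> fst (coset_sum G {K})" for x
    using that act by (auto simp: coset_sum_def LCOSETS_def)
  have hmap: "restrict h (fst (coset_sum G {K})) \<in> gmaps G (coset_sum G {K}) Y"
  proof (rule restrict_gmaps[OF _ cs])
    show "h x \<in> fst Y" if "x \<in> fst (coset_sum G {K})" for x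
      using orb[OF that] h gset_closed[OF YY _ y0(1)] by auto
    fix a x assume a: "a \<in> carrier G" and "x \<in> fst (coset_sum G {K})"
    then obtain a' where a': "a' \<in> carrier G" "x = snd (coset_sum G {K}) a' ?c" using orb by blast
    then have "snd (coset_sum G {K}) a x = snd (coset_sum G {K}) (a \<otimes> a') ?c"
      using gset_mult[OF cs a a'(1) c] by simp
    then show "h (snd (coset_sum G {K}) a x) = snd Y a (h x)"
      using h[of "a \<otimes> a'"] h[OF a'(1)] gset_mult[OF YY a a'(1) y0(1)] a a' by simp
  qed
  define f where "f = compose (fst Z) (restrict h (fst (coset_sum G {K}))) (restrict (inv_into (fst (coset_sum G {K})) e) (fst Z))"
  have f: "f \<in> gmaps G Z Y" unfolding f_def by (rule gmaps_compose[OF gmaps_inv[OF e cs Z b] hmap Z])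
  have r: "realizable Y (marks Z f)" using Z f unfolding realizable_def gsets_over_iff by blast
  let ?b = "burnside_diff Y (marks Z f) 0"
  have "total_mark Y ?b H = int (\<Sum>y\<in>fst Y. marks Z f H y)"
    unfolding total_mark_def bmarks_diff[OF r realizable_0] by simp
  also have "(\<Sum>y\<in>fst Y. marks Z f H y) = fixcard Z H"
  proof -
    have "(\<Sum>y\<in>fst Y. marks Z f H y) = (\<Sum>y | y \<in> fst Y \<and> to_point Y y = undefined. marks Z f H y)"
      by (rule sum.cong) (auto simp: to_point_def)
    also have "\<dots> = marks Z (compose (fst Z) (to_point Y) f) H undefined"
      by (rule marks_compose[OF Z gset_finite[OF YY] f, symmetric])
    also have "\<dots> = fixcard Z H"
      unfolding marks_def fixcard_def using gmapsD(1)[OF f] by (intro arg_cong[of _ _ card]) (auto simp: compose_def to_point_def)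
    finally show ?thesis .
  qed
  finally have tm: "total_mark Y ?b H = int (fixcard Z H)" .
  have "\<not> int p dvd total_mark Y ?b H" unfolding tm using \<open>\<not> p dvd fixcard Z H\<close> by simp
  then show ?thesis using burnside_diff_closed[OF r realizable_0] by blast
qed

text \<open>Dress's theorem on the Burnside ring. An element of the Burnside ring of the point restricts to zero on \<open>Y\<close> if and
  only if its marks vanish at the subgroups fixing a point of \<open>Y\<close>. On this finite set of subgroups some element
  induced from \<open>Y\<close> has constant marks \<open>n\<close> prime to \<open>p\<close>; multiplying it by \<open>a\<close> yields \<open>b\<close>.\<close>

theorem burnside_hyper_induction:
  fixes X :: "('g, 'u) gset"
  assumes p: "prime p" and Y: "Y = hyper_gset G p X"
    and a: "a \<in> carrier (val (burnside G) (point_gset G))"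
  shows "\<exists>n. \<not> p dvd n \<and> (\<exists>b\<in>carrier (val (burnside G) Y).
    con (burnside G) Y (point_gset G) (to_point Y)
      (a [^]\<^bsub>val (burnside G) (point_gset G)\<^esub> n \<otimes>\<^bsub>val (burnside G) (point_gset G)\<^esub>
        inv\<^bsub>val (burnside G) (point_gset G)\<^esub> cov (burnside G) Y (point_gset G) (to_point Y) b) = \<one>\<^bsub>val (burnside G) Y\<^esub>)"
proof -
  let ?P = "point_gset G :: ('g, 'u) gset"
  let ?B = "val (burnside G) ?P"
  interpret A: comm_group "val (burnside G) Y" by (rule comm_group_burnside)
  interpret B: comm_group ?B by (rule comm_group_burnside)
  have YY: "is_gset G Y" unfolding Y by (rule is_gset_hyper)
  note tp = to_point_gmaps[OF YY] and PP = is_gset_point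
  interpret L: function_rng "total_mark Y ` carrier (val (burnside G) Y)" by (rule function_rng_total_mark[OF YY])
  define I where "I = {H. subgroup H G \<and> (\<exists>y\<in>fst Y. fixed_by Y H y)}"
  have "I \<subseteq> Pow (carrier G)" unfolding I_def using subgroup.subset by blast
  then have finI: "finite I" using finite_carrier finite_subset by blast
  have "\<exists>v\<in>total_mark Y ` carrier (val (burnside G) Y). \<not> int p dvd v H" if "H \<in> I" for H
  proof -
    obtain y where "subgroup H G" "y \<in> fst Y" "fixed_by Y H y" using \<open>H \<in> I\<close> unfolding I_def by blast
    then obtain b where "b \<in> carrier (val (burnside G) Y)" "\<not> int p dvd total_mark Y b H"
      using ex_total_mark_nonzero[OF p Y] by blast
    then show ?thesis by (intro bexI[of _ "total_mark Y b"] imageI)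
  qed
  from L.ex_constant_unit_mod[OF p finI this] obtain u n where u: "u \<in> total_mark Y ` carrier (val (burnside G) Y)" and n: "\<not> p dvd n" "\<And>H. H \<in> I \<Longrightarrow> u H = int n"
    by blast
  obtain c where c: "c \<in> carrier (val (burnside G) Y)" "u = total_mark Y c" using u by blast
  obtain b where b: "b \<in> carrier (val (burnside G) Y)" "\<And>H y. bmarks Y b H y = bmarks ?P a H undefined * bmarks Y c H y"
    using burnside_scale[OF YY a c(1)] by blast
  have tb: "total_mark Y b H = bmarks ?P a H undefined * int n" if "H \<in> I" for H
    using n(2)[OF that] unfolding c(2) total_mark_def b(2) sum_distrib_left[symmetric] by simp
  let ?cb = "cov (burnside G) Y ?P (to_point Y) b"
  let ?k = "a [^]\<^bsub>?B\<^esub> n \<otimes>\<^bsub>?B\<^esub> inv\<^bsub>?B\<^esub> ?cb"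
  have cb: "?cb \<in> carrier ?B" by (rule cov_burnside_closed[OF YY tp b(1)])
  have k: "?k \<in> carrier ?B" using a cb by simp
  have "bmarks ?P ?k H undefined = 0" if "H \<in> I" for H
    using a cb by (simp add: bmarks_mult bmarks_inv bmarks_pow bmarks_cov_point[OF YY b(1)] tb[OF that])
  then have zero: "bmarks ?P ?k H undefined = 0" if "y \<in> fst Y" "fixed_by Y H y" for H y
  proof -
    have "subgroup (generate G (H \<inter> carrier G)) G" by (rule generate_is_subgroup) simp
    then have "generate G (H \<inter> carrier G) \<in> I"
      unfolding I_def using fixed_by_generate[OF YY that(1)] that by blast
    then show ?thesis using \<open>\<And>H. H \<in> I \<Longrightarrow> bmarks ?P ?k H undefined = 0\<close> bmarks_generate[OF k] by metis
  qed
  have "con (burnside G) Y ?P (to_point Y) ?k = \<one>\<^bsub>val (burnside G) Y\<^esub>"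
  proof (rule bmarks_inj[OF con_burnside_closed[OF YY PP tp k] A.one_closed], intro ext)
    fix H y
    show "bmarks Y (con (burnside G) Y ?P (to_point Y) ?k) H y = bmarks Y \<one>\<^bsub>val (burnside G) Y\<^esub> H y"
      unfolding bmarks_con[OF YY PP tp k] bmarks_one mark_pull_def using zero[of y H] by (simp add: to_point_def)
  qed
  then show ?thesis using n(1) b(1) by blast
qed

end

section \<open>Inheritance of Dress generating sets\<close>

context mackey_functor
begin

lemma burnside_ideal_closed:
  "is_gset G S \<Longrightarrow> a \<in> burnside_ideal G M S \<Longrightarrow> a \<in> carrier (val (burnside G) S)"
  by (simp add: mem_burnside_ideal)

lemma burnside_act_pow:
  assumes S: "is_gset G S" and u: "u \<in> carrier (val (burnside G) S)" and x: "x \<in> carrier (val M S)"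
  shows "burnside_act M S (u [^]\<^bsub>val (burnside G) S\<^esub> (n::nat)) x = burnside_act M S u (x [^]\<^bsub>val M S\<^esub> n)"
proof -
  interpret l: group_hom "val (burnside G) S" "val M S" "\<lambda>u. burnside_act M S u x" by (rule burnside_act_hom_left[OF S x])
  interpret r: group_hom "val M S" "val M S" "burnside_act M S u" by (rule burnside_act_hom[OF S u])
  show ?thesis using u x by (simp add: l.hom_nat_pow r.hom_nat_pow)
qed

text \<open>Over \<open>U\<close> the hypothesis on the unit says that \<open>m\<close> times any \<open>z\<close> in \<open>M(U)\<close> is induced from \<open>U \<times> Y\<close>. By Frobenius
  reciprocity \<open>k\<close> then acts on \<open>m z\<close> through its restriction to \<open>U \<times> Y\<close>, which factors through the restriction to
  \<open>Y\<close> and so is zero.\<close>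

lemma burnside_multiple_in_ideal:
  fixes R :: "('g, 'u, 'r) green"
  assumes R: "is_green_ring G R" and mod: "green_module G R M" and Y: "is_gset G Y"
    and r: "r \<in> carrier (val R Y)"
    and one: "gone R (point_gset G) [^]\<^bsub>val R (point_gset G)\<^esub> (m::nat) = cov R Y (point_gset G) (to_point Y) r"
    and k: "k \<in> carrier (val (burnside G) (point_gset G))"
    and res: "con (burnside G) Y (point_gset G) (to_point Y) k = \<one>\<^bsub>val (burnside G) Y\<^esub>"
  shows "k [^]\<^bsub>val (burnside G) (point_gset G)\<^esub> m \<in> burnside_ideal G M (point_gset G)"
proof -
  let ?P = "point_gset G :: ('g, 'u) gset"
  note PP = is_gset_point and tp = to_point_gmaps[OF Y]
  interpret B: comm_group "val (burnside G) ?P" by (rule comm_group_burnside)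
  obtain \<mu> where pair: "is_pairing G R M M \<mu>" and unit: "\<And>S x. is_gset G S \<Longrightarrow> x \<in> carrier (val M S) \<Longrightarrow> \<mu> S (gone R S) x = x"
    using mod unfolding green_module_def by blast
  have Rm: "is_mackey G R" using R by (simp add: is_green_ring_def)
  have Rb: "is_bifunctor G R" using Rm by (simp add: is_mackey_def)
  have Rg: "comm_group (val R S)" if "is_gset G S" for S
    using Rb[unfolded is_bifunctor_def, THEN conjunct1] that by blast
  have Rcon: "con R S T f \<in> hom (val R T) (val R S)" if "is_gset G S" "is_gset G T" "f \<in> gmaps G S T" for S T f
    using Rb[unfolded is_bifunctor_def, THEN conjunct2, THEN conjunct1] that by blast
  have Rpb: "con R S1 T f (cov R S2 T g x) = cov R S S1 p (con R S S2 q x)"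
    if "is_pullback G S S1 S2 T p q f g" "x \<in> carrier (val R S2)" for S S1 S2 T p q f g x
    using Rm[unfolded is_mackey_def, THEN conjunct2, THEN conjunct1] that by blast
  have Rone: "con R S T f (gone R T) = gone R S" if "is_gset G S" "is_gset G T" "f \<in> gmaps G S T" for S T f
    using R[unfolded is_green_ring_def, THEN conjunct2, THEN conjunct2, THEN conjunct2] that by blast
  have Rone_closed: "gone R S \<in> carrier (val R S)" if "is_gset G S" for S
  proof -
    have "ring (val_ring R S)" using R[unfolded is_green_ring_def, THEN conjunct2, THEN conjunct2, THEN conjunct1] that by blast
    from monoid.one_closed[OF ring.is_monoid[OF this]] show ?thesis by (simp add: val_ring_def)
  qed
  have bil: "bilinear_on (val R S) (val M S) (val M S) (\<mu> S)" if "is_gset G S" for S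
    using pair[unfolded is_pairing_def, THEN conjunct1] that by blast
  have frob: "\<mu> T (cov R S T f x) y = cov M S T f (\<mu> S x (con M S T f y))"
    if "is_gset G S" "is_gset G T" "f \<in> gmaps G S T" "x \<in> carrier (val R S)" "y \<in> carrier (val M T)" for S T f x y
    using pair[unfolded is_pairing_def, THEN conjunct2] that by blast
  show ?thesis unfolding mem_burnside_ideal[OF PP]
  proof (intro conjI allI impI ballI)
    show "k [^]\<^bsub>val (burnside G) ?P\<^esub> m \<in> carrier (val (burnside G) ?P)" using k by simp
    fix U \<psi> z assume "is_gset G U \<and> \<psi> \<in> gmaps G U ?P" and z: "z \<in> carrier (val M U)"
    then have U: "is_gset G U" and psi: "\<psi> \<in> gmaps G U ?P" by auto
    obtain W q t where W: "is_pullback G W U Y ?P q t \<psi> (to_point Y)" using ex_pullback[OF U Y PP psi tp] .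
    have WW: "is_gset G W" and q: "q \<in> gmaps G W U" and t: "t \<in> gmaps G W Y"
      and bij: "bij_betw (\<lambda>s. (q s, t s)) (fst W) {(a, b). a \<in> fst U \<and> b \<in> fst Y \<and> \<psi> a = to_point Y b}"
      using W by (simp_all add: is_pullback_def)
    interpret VU: comm_group "val M U" by (rule comm_group_val[OF U])
    interpret RU: comm_group "val R U" by (rule Rg[OF U])
    interpret RP: comm_group "val R ?P" by (rule Rg[OF PP])
    interpret c: group_hom "val R ?P" "val R U" "con R U ?P \<psi>" by unfold_locales (rule Rcon[OF U PP psi])
    interpret mu: group_hom "val R U" "val M U" "\<lambda>a. \<mu> U a z"
      by unfold_locales (use bil[OF U] z in \<open>simp add: bilinear_on_def\<close>)
    \<comment> \<open>multiplication by \<open>m\<close> on \<open>M(U)\<close> factors through the transfer from \<open>U \<times> Y\<close>\<close>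
    define r' where "r' = con R W Y t r"
    have r': "r' \<in> carrier (val R W)" unfolding r'_def by (rule hom_in_carrier[OF Rcon[OF WW Y t] r])
    define w where "w = \<mu> W r' (con M W U q z)"
    note qz = con_closed[OF WW U q z]
    have w: "w \<in> carrier (val M W)"
      unfolding w_def using bil[OF WW] r' qz unfolding bilinear_on_def by (auto intro: hom_in_carrier)
    have "gone R U [^]\<^bsub>val R U\<^esub> m = con R U ?P \<psi> (gone R ?P [^]\<^bsub>val R ?P\<^esub> m)"
      using c.hom_nat_pow[OF Rone_closed[OF PP], of m] Rone[OF U PP psi] by simp
    also have "\<dots> = cov R W U q r'" unfolding one r'_def by (rule Rpb[OF W r])
    finally have gone_pow: "gone R U [^]\<^bsub>val R U\<^esub> m = cov R W U q r'" .
    have "z [^]\<^bsub>val M U\<^esub> m = \<mu> U (gone R U [^]\<^bsub>val R U\<^esub> m) z"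
      using mu.hom_nat_pow[OF Rone_closed[OF U], of m] unit[OF U z] by simp
    also have "\<dots> = cov M W U q w" unfolding gone_pow w_def by (rule frob[OF WW U q r' z])
    finally have zm: "z [^]\<^bsub>val M U\<^esub> m = cov M W U q w" .
    have comm: "compose (fst W) \<psi> q = compose (fst W) (to_point Y) t"
      using bij_betwE[OF bij] by (auto simp: compose_def fun_eq_iff)
    let ?ku = "con (burnside G) U ?P \<psi> k"
    note ku = con_burnside_closed[OF U PP psi k]
    have "con (burnside G) W U q ?ku = con (burnside G) W Y t (con (burnside G) Y ?P (to_point Y) k)"
      unfolding con_burnside_comp[OF WW U PP q psi k, symmetric] comm con_burnside_comp[OF WW Y PP t tp k] ..
    also have "\<dots> = \<one>\<^bsub>val (burnside G) W\<^esub>"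
      unfolding res
      using con_burnside_hom[OF WW Y t] comm_group_burnside[of W] comm_group_burnside[of Y]
      by (intro group_hom.hom_one) (simp add: group_hom_def group_hom_axioms_def comm_group_def)
    finally have kw: "con (burnside G) W U q ?ku = \<one>\<^bsub>val (burnside G) W\<^esub>" .
    have "con (burnside G) U ?P \<psi> (k [^]\<^bsub>val (burnside G) ?P\<^esub> m) = ?ku [^]\<^bsub>val (burnside G) U\<^esub> m"
      using con_burnside_hom[OF U PP psi] comm_group_burnside[of U] B.is_group k
      by (intro group_hom.hom_nat_pow) (simp_all add: group_hom_def group_hom_axioms_def comm_group_def)
    then have "burnside_act M U (con (burnside G) U ?P \<psi> (k [^]\<^bsub>val (burnside G) ?P\<^esub> m)) z = burnside_act M U ?ku (cov M W U q w)"
      using burnside_act_pow[OF U ku z] zm by simp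
    also have "\<dots> = cov M W U q (burnside_act M W \<one>\<^bsub>val (burnside G) W\<^esub> w)"
      unfolding burnside_act_cov[OF WW U q ku w] kw ..
    also have "\<dots> = \<one>\<^bsub>val M U\<^esub>"
      unfolding group_hom.hom_one[OF burnside_act_hom_left[OF WW w]] by (rule group_hom.hom_one[OF cov_group_hom[OF WW U q]])
    finally show "burnside_act M U (con (burnside G) U ?P \<psi> (k [^]\<^bsub>val (burnside G) ?P\<^esub> m)) z = \<one>\<^bsub>val M U\<^esub>" .
  qed
qed

text \<open>With \<open>n\<close> and \<open>b\<close> from \<open>burnside_hyper_induction\<close> and \<open>m\<close> such that \<open>m 1\<close> is induced from \<open>Y\<close> in the Green ring, the
  element \<open>m n a\<close> is induced from \<open>m b\<close> modulo the ideal.\<close>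

theorem dress_generating_green_module:
  fixes R :: "('g, 'u, 'r) green" and X :: "('g, 'u) gset"
  assumes R: "is_green_ring G R" and mod: "green_module G R M" and gen: "dress_generating_green G R X"
  shows "dress_generating G M X"
  unfolding dress_generating_iff[of X, OF is_gset_hyper]
proof (intro allI impI ballI)
  fix p :: nat and a assume p: "prime p" and a: "a \<in> carrier (val (burnside G) (point_gset G :: ('g, 'u) gset))"
  define Y where "Y = hyper_gset G p X"
  let ?P = "point_gset G :: ('g, 'u) gset"
  let ?B = "val (burnside G) ?P"
  interpret B: comm_group ?B by (rule comm_group_burnside)
  interpret A: comm_group "val (burnside G) Y" by (rule comm_group_burnside)
  have Y: "is_gset G Y" unfolding Y_def by (rule is_gset_hyper)
  note PP = is_gset_point and tp = to_point_gmaps[OF Y]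
  have Rb: "is_bifunctor G R" using R by (simp add: is_green_ring_def is_mackey_def)
  have Rg: "comm_group (val R S)" if "is_gset G S" for S
    using Rb[unfolded is_bifunctor_def, THEN conjunct1] that by blast
  have Rcov: "cov R Y ?P (to_point Y) \<in> hom (val R Y) (val R ?P)"
    using Rb[unfolded is_bifunctor_def, THEN conjunct2, THEN conjunct1] Y PP tp by blast
  have one_closed: "gone R ?P \<in> carrier (val R ?P)"
  proof -
    have "ring (val_ring R ?P)" using R[unfolded is_green_ring_def, THEN conjunct2, THEN conjunct2, THEN conjunct1] PP by blast
    from monoid.one_closed[OF ring.is_monoid[OF this]] show ?thesis by (simp add: val_ring_def)
  qed
  have "tensor_map (val R ?P) (int_localized p) (cov R Y ?P (to_point Y)) (\<lambda>z. z) ` carrier (tensor (val R Y) (int_localized p))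
      = carrier (tensor (val R ?P) (int_localized p))"
    using gen p unfolding dress_generating_green_def Let_def Y_def by blast
  then obtain m r where m: "\<not> p dvd m" and r: "r \<in> carrier (val R Y)"
    and one: "gone R ?P [^]\<^bsub>val R ?P\<^esub> m = cov R Y ?P (to_point Y) r"
    unfolding tensor_map_surj_iff[OF Rg[OF Y] Rg[OF PP] Rcov p] using one_closed by blast
  obtain n b where n: "\<not> p dvd n" and b: "b \<in> carrier (val (burnside G) Y)"
    and res: "con (burnside G) Y ?P (to_point Y) (a [^]\<^bsub>?B\<^esub> n \<otimes>\<^bsub>?B\<^esub> inv\<^bsub>?B\<^esub> cov (burnside G) Y ?P (to_point Y) b) = \<one>\<^bsub>val (burnside G) Y\<^esub>"
    using burnside_hyper_induction[OF p Y_def a] by blast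
  let ?cb = "cov (burnside G) Y ?P (to_point Y) b"
  have cb: "?cb \<in> carrier ?B" by (rule cov_burnside_closed[OF Y tp b])
  have "(a [^]\<^bsub>?B\<^esub> n \<otimes>\<^bsub>?B\<^esub> inv\<^bsub>?B\<^esub> ?cb) [^]\<^bsub>?B\<^esub> m \<in> burnside_ideal G M ?P"
    by (rule burnside_multiple_in_ideal[OF R mod Y r one _ res]) (use a cb in simp)
  also have "(a [^]\<^bsub>?B\<^esub> n \<otimes>\<^bsub>?B\<^esub> inv\<^bsub>?B\<^esub> ?cb) [^]\<^bsub>?B\<^esub> m = a [^]\<^bsub>?B\<^esub> (n * m) \<otimes>\<^bsub>?B\<^esub> inv\<^bsub>?B\<^esub> (?cb [^]\<^bsub>?B\<^esub> m)"
    using a cb by (simp add: B.nat_pow_distrib B.nat_pow_pow B.nat_pow_inv)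
  also have "?cb [^]\<^bsub>?B\<^esub> m = cov (burnside G) Y ?P (to_point Y) (b [^]\<^bsub>val (burnside G) Y\<^esub> m)"
    using cov_burnside_hom[OF Y tp] A.is_group B.is_group b
    by (intro group_hom.hom_nat_pow[symmetric]) (simp_all add: group_hom_def group_hom_axioms_def)
  finally have "a [^]\<^bsub>?B\<^esub> (n * m) \<otimes>\<^bsub>?B\<^esub> inv\<^bsub>?B\<^esub> cov (burnside G) Y ?P (to_point Y) (b [^]\<^bsub>val (burnside G) Y\<^esub> m) \<in> burnside_ideal G M ?P" .
  moreover have "\<not> p dvd n * m" using n m p by (simp add: prime_dvd_mult_iff)
  moreover have "b [^]\<^bsub>val (burnside G) Y\<^esub> m \<in> carrier (val (burnside G) Y)" using b by simp
  ultimately show "\<exists>n. \<not> p dvd n \<and> (\<exists>b\<in>carrier (val (burnside G) (hyper_gset G p X)).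
        a [^]\<^bsub>?B\<^esub> n \<otimes>\<^bsub>?B\<^esub> inv\<^bsub>?B\<^esub> cov (burnside G) (hyper_gset G p X) ?P (to_point (hyper_gset G p X)) b \<in> burnside_ideal G M ?P)"
    unfolding Y_def by blast
qed

end

text \<open>The quotient by the larger ideal inherits surjectivity, as both are quotients of the same Burnside ring.\<close>

lemma dress_generating_mono:
  fixes G :: "('g, 'b) monoid_scheme" and M :: "('g, 'u, 'm) mackey" and N :: "('g, 'u, 'n) mackey"
  assumes M: "mackey_functor G M" and N: "mackey_functor G N"
    and sub: "burnside_ideal G M (point_gset G) \<subseteq> burnside_ideal G N (point_gset G)"
    and gen: "dress_generating G M X"
  shows "dress_generating G N X"
proof -
  interpret M: mackey_functor G "TYPE('u)" M by (rule M)
  interpret N: mackey_functor G "TYPE('u)" N by (rule N)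
  show ?thesis
    using gen sub unfolding M.dress_generating_iff[of X, OF M.is_gset_hyper] N.dress_generating_iff[of X, OF M.is_gset_hyper]
    by blast
qed

text \<open>What acts as zero on \<open>M\<close> acts as zero on the image of \<open>N\<close>, hence on \<open>N\<close> by injectivity.\<close>

lemma burnside_ideal_sub_functor:
  fixes G :: "('g, 'b) monoid_scheme" and M :: "('g, 'u, 'm) mackey" and N :: "('g, 'u, 'n) mackey"
  assumes M: "mackey_functor G M" and N: "mackey_functor G N" and S: "is_gset G S" and sub: "sub_functor G N M"
  shows "burnside_ideal G M S \<subseteq> burnside_ideal G N S"
proof
  interpret M: mackey_functor G "TYPE('u)" M by (rule M)
  interpret N: mackey_functor G "TYPE('u)" N by (rule N)
  obtain \<Theta> where T: "nat_transf G N M \<Theta>" and inj: "\<And>S. is_gset G S \<Longrightarrow> inj_on (\<Theta> S) (carrier (val N S))"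
    using sub unfolding sub_functor_def by blast
  fix a assume aI: "a \<in> burnside_ideal G M S"
  then have a: "a \<in> carrier (val (burnside G) S)" by (rule M.burnside_ideal_closed[OF S])
  show "a \<in> burnside_ideal G N S" unfolding N.mem_burnside_ideal[OF S]
  proof (intro conjI allI impI ballI a)
    fix U \<psi> z assume "is_gset G U \<and> \<psi> \<in> gmaps G U S" and z: "z \<in> carrier (val N U)"
    then have U: "is_gset G U" and psi: "\<psi> \<in> gmaps G U S" by auto
    interpret \<Theta>: group_hom "val N U" "val M U" "\<Theta> U"
      using N.comm_group_val[OF U] M.comm_group_val[OF U] T[unfolded nat_transf_def, THEN conjunct1] U
      by (simp add: group_hom_def group_hom_axioms_def comm_group_def del: split_paired_All)
    note u = M.con_burnside_closed[OF U S psi a]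
    have "\<Theta> U (burnside_act N U (con (burnside G) U S \<psi> a) z) = burnside_act M U (con (burnside G) U S \<psi> a) (\<Theta> U z)"
      by (rule burnside_act_natural[OF N M T U u z])
    also have "\<dots> = \<one>\<^bsub>val M U\<^esub>"
      using aI U psi \<Theta>.hom_closed[OF z] unfolding M.mem_burnside_ideal[OF S] by blast
    also have "\<dots> = \<Theta> U \<one>\<^bsub>val N U\<^esub>" by simp
    finally show "burnside_act N U (con (burnside G) U S \<psi> a) z = \<one>\<^bsub>val N U\<^esub>"
      using inj_onD[OF inj[OF U]] N.burnside_act_closed[OF U u z] by simp
  qed
qed

text \<open>Every element of \<open>N(U)\<close> comes from \<open>M(U)\<close>, where the action is zero.\<close>

lemma burnside_ideal_quotient_functor:
  fixes G :: "('g, 'b) monoid_scheme" and M :: "('g, 'u, 'm) mackey" and N :: "('g, 'u, 'n) mackey"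
  assumes M: "mackey_functor G M" and N: "mackey_functor G N" and S: "is_gset G S" and quot: "quotient_functor G N M"
  shows "burnside_ideal G M S \<subseteq> burnside_ideal G N S"
proof
  interpret M: mackey_functor G "TYPE('u)" M by (rule M)
  interpret N: mackey_functor G "TYPE('u)" N by (rule N)
  obtain \<Theta> where T: "nat_transf G M N \<Theta>" and surj: "\<And>S. is_gset G S \<Longrightarrow> \<Theta> S ` carrier (val M S) = carrier (val N S)"
    using quot unfolding quotient_functor_def by blast
  fix a assume aI: "a \<in> burnside_ideal G M S"
  then have a: "a \<in> carrier (val (burnside G) S)" by (rule M.burnside_ideal_closed[OF S])
  show "a \<in> burnside_ideal G N S" unfolding N.mem_burnside_ideal[OF S]
  proof (intro conjI allI impI ballI a)
    fix U \<psi> z assume "is_gset G U \<and> \<psi> \<in> gmaps G U S" and z: "z \<in> carrier (val N U)"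
    then have U: "is_gset G U" and psi: "\<psi> \<in> gmaps G U S" by auto
    interpret \<Theta>: group_hom "val M U" "val N U" "\<Theta> U"
      using N.comm_group_val[OF U] M.comm_group_val[OF U] T[unfolded nat_transf_def, THEN conjunct1] U
      by (simp add: group_hom_def group_hom_axioms_def comm_group_def del: split_paired_All)
    note u = M.con_burnside_closed[OF U S psi a]
    obtain x where x: "x \<in> carrier (val M U)" "z = \<Theta> U x" using surj[OF U] z by blast
    have "burnside_act N U (con (burnside G) U S \<psi> a) z = \<Theta> U (burnside_act M U (con (burnside G) U S \<psi> a) x)"
      unfolding x(2) by (rule burnside_act_natural[OF M N T U u x(1), symmetric])
    also have "burnside_act M U (con (burnside G) U S \<psi> a) x = \<one>\<^bsub>val M U\<^esub>"
      using aI U psi x(1) unfolding M.mem_burnside_ideal[OF S] by blast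
    finally show "burnside_act N U (con (burnside G) U S \<psi> a) z = \<one>\<^bsub>val N U\<^esub>" by simp
  qed
qed

text \<open>The action on \<open>N(U)\<close> is an endomorphism that vanishes on the image of \<open>M(U)\<close>, as does the zero endomorphism. The
  defining injectivity of a full lattice identifies the two.\<close>

lemma burnside_ideal_full_lattice:
  fixes G :: "('g, 'b) monoid_scheme" and M :: "('g, 'u, 'm) mackey" and N :: "('g, 'u, 'n) mackey"
  assumes M: "mackey_functor G M" and N: "mackey_functor G N" and S: "is_gset G S" and lat: "full_lattice G M N"
  shows "burnside_ideal G M S \<subseteq> burnside_ideal G N S"
proof
  interpret M: mackey_functor G "TYPE('u)" M by (rule M)
  interpret N: mackey_functor G "TYPE('u)" N by (rule N)
  obtain \<Theta> where T: "nat_transf G M N \<Theta>"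
    and inj: "\<And>S. is_gset G S \<Longrightarrow> inj_on (\<lambda>h. compose (carrier (val M S)) h (\<Theta> S)) (ext_hom (val N S) (val N S))"
    using lat unfolding full_lattice_def by blast
  fix a assume aI: "a \<in> burnside_ideal G M S"
  then have a: "a \<in> carrier (val (burnside G) S)" by (rule M.burnside_ideal_closed[OF S])
  show "a \<in> burnside_ideal G N S" unfolding N.mem_burnside_ideal[OF S]
  proof (intro conjI allI impI ballI a)
    fix U \<psi> z assume "is_gset G U \<and> \<psi> \<in> gmaps G U S" and z: "z \<in> carrier (val N U)"
    then have U: "is_gset G U" and psi: "\<psi> \<in> gmaps G U S" by auto
    interpret \<Theta>: group_hom "val M U" "val N U" "\<Theta> U"
      using N.comm_group_val[OF U] M.comm_group_val[OF U] T[unfolded nat_transf_def, THEN conjunct1] U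
      by (simp add: group_hom_def group_hom_axioms_def comm_group_def del: split_paired_All)
    note u = M.con_burnside_closed[OF U S psi a]
    interpret act: group_hom "val N U" "val N U" "burnside_act N U (con (burnside G) U S \<psi> a)"
      by (rule N.burnside_act_hom[OF U u])
    let ?V = "val N U"
    define h where "h = restrict (burnside_act N U (con (burnside G) U S \<psi> a)) (carrier ?V)"
    define h0 where "h0 = (\<lambda>x\<in>carrier ?V. \<one>\<^bsub>?V\<^esub>)"
    have "h \<in> ext_hom ?V ?V" by (auto simp: h_def ext_hom_def hom_def)
    moreover have "h0 \<in> ext_hom ?V ?V" by (auto simp: h0_def ext_hom_def hom_def)
    moreover have "h (\<Theta> U x) = h0 (\<Theta> U x)" if x: "x \<in> carrier (val M U)" for x
    proof -
      have "h (\<Theta> U x) = \<Theta> U (burnside_act M U (con (burnside G) U S \<psi> a) x)"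
        using \<Theta>.hom_closed[OF x] burnside_act_natural[OF M N T U u x] by (simp add: h_def)
      also have "burnside_act M U (con (burnside G) U S \<psi> a) x = \<one>\<^bsub>val M U\<^esub>"
        using aI U psi x unfolding M.mem_burnside_ideal[OF S] by blast
      finally show ?thesis using \<Theta>.hom_closed[OF x] by (simp add: h0_def)
    qed
    then have "compose (carrier (val M U)) h (\<Theta> U) = compose (carrier (val M U)) h0 (\<Theta> U)"
      by (auto simp: compose_def fun_eq_iff)
    ultimately have "h = h0" using inj_onD[OF inj[OF U]] by blast
    then have "h z = h0 z" by simp
    then show "burnside_act N U (con (burnside G) U S \<psi> a) z = \<one>\<^bsub>?V\<^esub>" using z by (simp add: h_def h0_def)
  qed
qed

theorem theorem3p8:
  fixes G :: "('g, 'b) monoid_scheme"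
    and R :: "('g, 'u, 'r) green"
    and M N :: "('g, 'u, 'm) mackey"
    and X :: "('g, 'u) gset"
  assumes "infinite (UNIV :: 'u set)"
    and "group G" and "finite (carrier G)"
    and "is_green_ring G R" and "is_mackey G M" and "is_mackey G N"
    and "is_gset G X"
  shows "(green_module G R M \<and> dress_generating_green G R X \<longrightarrow> dress_generating G M X) \<and>
         (sub_quotient G N M \<and> dress_generating G M X \<longrightarrow> dress_generating G N X) \<and>
         (full_lattice G M N \<and> dress_generating G M X \<longrightarrow> dress_generating G N X)"
proof -
  interpret gsets G "TYPE('u)"
    by (rule gsets.intro[OF gset_theory.intro[OF assms(2)] gsets_axioms.intro[OF assms(3,1)]])
  have mf: "mackey_functor G L" if "is_mackey G L" for L :: "('g, 'u, 'm) mackey"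
    by (rule mackey_functor.intro[OF gsets_axioms mackey_functor_axioms.intro[OF that]])
  note PP = is_gset_point
  have "burnside_ideal G M (point_gset G) \<subseteq> burnside_ideal G N (point_gset G)" if sq: "sub_quotient G N M"
  proof -
    obtain r :: nat and L where L: "L 0 = N" "L r = M" "\<And>i. i \<le> r \<Longrightarrow> is_mackey G (L i)"
      "\<And>i. i < r \<Longrightarrow> sub_functor G (L i) (L (Suc i)) \<or> quotient_functor G (L i) (L (Suc i))"
      using sq unfolding sub_quotient_def by blast
    have "burnside_ideal G (L i) (point_gset G) \<subseteq> burnside_ideal G (L 0) (point_gset G)" if "i \<le> r" for i
      using that
    proof (induction i)
      case (Suc i)
      have m: "mackey_functor G (L i)" "mackey_functor G (L (Suc i))" using mf L(3) Suc.prems by simp_all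
      have "burnside_ideal G (L (Suc i)) (point_gset G) \<subseteq> burnside_ideal G (L i) (point_gset G)"
        using L(4)[of i] Suc.prems burnside_ideal_sub_functor[OF m(2,1) PP] burnside_ideal_quotient_functor[OF m(2,1) PP] by auto
      then show ?case using Suc by simp
    qed simp
    then show ?thesis using L(1,2) by blast
  qed
  moreover have "burnside_ideal G M (point_gset G) \<subseteq> burnside_ideal G N (point_gset G)" if "full_lattice G M N"
    by (rule burnside_ideal_full_lattice[OF mf[OF assms(5)] mf[OF assms(6)] PP that])
  ultimately show ?thesis
    using mackey_functor.dress_generating_green_module[OF mf[OF assms(5)] assms(4)]
      dress_generating_mono[OF mf[OF assms(5)] mf[OF assms(6)]] by blast
qed

end
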